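(* In $\mathsf{RCA}_0$, $\mathsf{CD}\text{-}\mathsf{PB}$ implies $\mathsf{L}_{\omega_1,\omega}\text{-}\mathsf{CA}$.
   Context: The following definitions are made in $\mathsf{RCA}_0$. Formulas: a formula of $L_{\omega_1,\omega}$ (in a language with only the atomic formulas true and false) is a well-founded tree $T\subseteq\omega^{<\omega}$ whose interior nodes are labeled $\cup$ (infinite disjunction) or $\cap$ (infinite conjunction) and whose leaves are labeled true or false. An evaluation map for it is a function $f:T\to\{0,1\}$ such that $f(\sigma)=1$ at a leaf $\sigma$ labeled true, $f(\sigma)=0$ at a leaf labeled false, $f(\sigma)=1$ at a $\cup$ node iff $f(\sigma^\frown n)=1$ for some $\sigma^\frown n\in T$, and $f(\sigma)=1$ at a $\cap$ node iff $f(\sigma^\frown n)=1$ for all $\sigma^\frown n\in T$. A formula is completely determined if it has an evaluation map, and true if it has an evaluation map $f$ with $f(\lambda)=1$, where $\lambda$ is the empty string (the root). $\mathsf{L}_{\omega_1,\omega}\text{-}\mathsf{CA}$ is the statement: if $\{\phi_i:i\in\mathbb N\}$ is a sequence of completely determined $L_{\omega_1,\omega}$ formulas, then the set $\{i:\phi_i\text{ is true}\}$ exists. Open and clopen sets: an open subset of $2^\omega$ is coded by a set $U\subseteq 2^{<\omega}$, and $X\in U$ means that some $p\in U$ satisfies $p\prec X$. A clopen set is coded by a natural number canonically coding a finite set $F\subseteq 2^{<\omega}$; $X$ belongs to it iff $p\prec X$ for some $p\in F$. Borel codes: a labeled Borel code is a well-founded tree $T\subseteq\omega^{<\omega}$ together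 with a function $\ell$ with domain $T$ such that $\ell(\sigma)\in\{\cup,\cap\}$ if $\sigma$ is an interior node, and $\ell(\sigma)$ is a standard code for a clopen subset of $2^\omega$ if $\sigma$ is a leaf. For $X\in 2^\omega$, an evaluation map for $X$ in $T$ is a function $f:T\to\{0,1\}$ such that at a leaf $\sigma$, $f(\sigma)=1$ iff $X$ is in the clopen set coded by $\ell(\sigma)$, and at $\cup$ and $\cap$ nodes $f$ satisfies the same conditions as for formulas. We write $X\in|T|$ if there is an evaluation map $f$ for $X$ in $T$ with $f(\lambda)=1$. $T^c$ is the labeled Borel code with the same tree, with $\cup$ and $\cap$ swapped and each leaf label replaced by a code for the complementary clopen set. A completely determined Borel code is a labeled Borel code $T$ such that every $X\in2^\omega$ has an evaluation map in $T$. A Baire code is a collection of open sets $U,V,\{D_n\}_{n\in\omega}$ such that $U\cap V=\emptyset$ and $U\cup V$ and each $D_n$ are dense. It is a Baire approximation to $T$ if for all $X\in\bigcap_n D_n$: $X\in U\Rightarrow X\in|T|$ and $X\in V\Rightarrow X\in|T^c|$. $\mathsf{CD}\text{-}\mathsf{PB}$ is the statement "Every completely determined Borel set has the property of Baire", i.e. every completely determined Borel code has a Baire approximation. *)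

theory Defs
  imports Main
begin

section \<open>Structures for second-order arithmetic and models of RCA0\<close>

text \<open>
  A structure for the language of second-order arithmetic: the numbers are all the elements of
  the type, the sets are the members of the field \<open>Sets\<close>. Both parts may be nonstandard.
  "In RCA0, A implies B" is read as: B holds in every model of RCA0 in which A holds.
  All notions defined below are therefore internal: number quantifiers range over the
  numbers of the structure, and quantifiers over sets, functions and points over its \<open>Sets\<close>.
\<close>

record 'a l2_structure =
  Zero :: 'a ("\<zero>\<index>")
  One :: 'a ("\<one>\<index>")
  Add :: "'a \<Rightarrow> 'a \<Rightarrow> 'a" (infixl "\<oplus>\<index>" 65)
  Mul :: "'a \<Rightarrow> 'a \<Rightarrow> 'a" (infixl "\<otimes>\<index>" 70)
  Less :: "'a \<Rightarrow> 'a \<Rightarrow> bool" (infix "\<lhd>\<index>" 50)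
  Sets :: "'a set set"

datatype num_term =
    NVar nat
  | NZero
  | NOne
  | NAdd num_term num_term
  | NMul num_term num_term

text \<open>Formulas with bounded number quantifiers only; \<open>FMem t k\<close> says that \<open>t\<close> is a member
  of the \<open>k\<close>-th set variable. In \<open>FAll x t \<theta>\<close> and \<open>FEx x t \<theta>\<close> the bound \<open>t\<close> is outside the scope
  of the quantified variable \<open>x\<close>.\<close>

datatype bounded_fm =
    FEq num_term num_term
  | FLess num_term num_term
  | FMem num_term nat
  | FNot bounded_fm
  | FAnd bounded_fm bounded_fm
  | FOr bounded_fm bounded_fm
  | FAll nat num_term bounded_fm
  | FEx nat num_term bounded_fm

context
  fixes M :: "'a l2_structure" (structure)
begin

primrec term_val :: "(nat \<Rightarrow> 'a) \<Rightarrow> num_term \<Rightarrow> 'a" where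
  "term_val e (NVar x) = e x"
| "term_val e NZero = \<zero>"
| "term_val e NOne = \<one>"
| "term_val e (NAdd s t) = term_val e s \<oplus> term_val e t"
| "term_val e (NMul s t) = term_val e s \<otimes> term_val e t"

primrec bounded_sat :: "(nat \<Rightarrow> 'a set) \<Rightarrow> (nat \<Rightarrow> 'a) \<Rightarrow> bounded_fm \<Rightarrow> bool" where
  "bounded_sat E e (FEq s t) \<longleftrightarrow> term_val e s = term_val e t"
| "bounded_sat E e (FLess s t) \<longleftrightarrow> term_val e s \<lhd> term_val e t"
| "bounded_sat E e (FMem t k) \<longleftrightarrow> term_val e t \<in> E k"
| "bounded_sat E e (FNot \<theta>) \<longleftrightarrow> \<not> bounded_sat E e \<theta>"
| "bounded_sat E e (FAnd \<theta> \<eta>) \<longleftrightarrow> bounded_sat E e \<theta> \<and> bounded_sat E e \<eta>"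
| "bounded_sat E e (FOr \<theta> \<eta>) \<longleftrightarrow> bounded_sat E e \<theta> \<or> bounded_sat E e \<eta>"
| "bounded_sat E e (FAll x t \<theta>) \<longleftrightarrow> (\<forall>a. a \<lhd> term_val e t \<longrightarrow> bounded_sat E (e(x := a)) \<theta>)"
| "bounded_sat E e (FEx x t \<theta>) \<longleftrightarrow> (\<exists>a. a \<lhd> term_val e t \<and> bounded_sat E (e(x := a)) \<theta>)"

text \<open>The predicates defined by Sigma-0-1 and Pi-0-1 formulas in the distinguished variable
  \<open>x\<close>; the other variables, interpreted by \<open>E\<close> and \<open>e\<close>, are number and set parameters.\<close>

definition Sigma1_pred :: "(nat \<Rightarrow> 'a set) \<Rightarrow> (nat \<Rightarrow> 'a) \<Rightarrow> nat \<Rightarrow> nat \<Rightarrow> bounded_fm \<Rightarrow> 'a \<Rightarrow> bool" where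
  "Sigma1_pred E e x y \<theta> n \<longleftrightarrow> (\<exists>m. bounded_sat E (e(x := n, y := m)) \<theta>)"

definition Pi1_pred :: "(nat \<Rightarrow> 'a set) \<Rightarrow> (nat \<Rightarrow> 'a) \<Rightarrow> nat \<Rightarrow> nat \<Rightarrow> bounded_fm \<Rightarrow> 'a \<Rightarrow> bool" where
  "Pi1_pred E e x y \<theta> n \<longleftrightarrow> (\<forall>m. bounded_sat E (e(x := n, y := m)) \<theta>)"

definition basic_axioms :: bool where
  "basic_axioms \<longleftrightarrow>
     (\<forall>n. n \<oplus> \<one> \<noteq> \<zero>) \<and>
     (\<forall>m n. m \<oplus> \<one> = n \<oplus> \<one> \<longrightarrow> m = n) \<and>
     (\<forall>m. m \<oplus> \<zero> = m) \<and>
     (\<forall>m n. m \<oplus> (n \<oplus> \<one>) = (m \<oplus> n) \<oplus> \<one>) \<and>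
     (\<forall>m. m \<otimes> \<zero> = \<zero>) \<and>
     (\<forall>m n. m \<otimes> (n \<oplus> \<one>) = (m \<otimes> n) \<oplus> m) \<and>
     (\<forall>m. \<not> m \<lhd> \<zero>) \<and>
     (\<forall>m n. m \<lhd> n \<oplus> \<one> \<longleftrightarrow> m \<lhd> n \<or> m = n)"

definition Sigma1_induction :: bool where
  "Sigma1_induction \<longleftrightarrow>
     (\<forall>E e x y \<theta>. range E \<subseteq> Sets M \<longrightarrow>
        Sigma1_pred E e x y \<theta> \<zero> \<longrightarrow>
        (\<forall>n. Sigma1_pred E e x y \<theta> n \<longrightarrow> Sigma1_pred E e x y \<theta> (n \<oplus> \<one>)) \<longrightarrow>
        (\<forall>n. Sigma1_pred E e x y \<theta> n))"

definition Delta1_comprehension :: bool where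
  "Delta1_comprehension \<longleftrightarrow>
     (\<forall>E e x y \<theta> z \<eta>. range E \<subseteq> Sets M \<longrightarrow>
        (\<forall>n. Sigma1_pred E e x y \<theta> n \<longleftrightarrow> Pi1_pred E e x z \<eta> n) \<longrightarrow>
        {n. Sigma1_pred E e x y \<theta> n} \<in> Sets M)"

text \<open>Nonemptiness of \<open>Sets\<close> is part of being a structure for two-sorted logic; without
  it the two schemes would be vacuous.\<close>

definition RCA0_model :: bool where
  "RCA0_model \<longleftrightarrow>
     Sets M \<noteq> {} \<and> basic_axioms \<and> Sigma1_induction \<and> Delta1_comprehension"


section \<open>Coding inside RCA0\<close>

text \<open>The pairing map and the coding of finite sets and finite sequences are those of Simpson,
  Subsystems of Second Order Arithmetic, II.2: the finite set of all \<open>i \<lhd> k\<close> such that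
  \<open>m (i + 1) + 1\<close> divides \<open>n\<close> is coded by the least triple \<open>(k, (m, n))\<close> defining it.\<close>

definition pair :: "'a \<Rightarrow> 'a \<Rightarrow> 'a" where
  "pair i j = ((i \<oplus> j) \<otimes> (i \<oplus> j)) \<oplus> i"

definition is_triple :: "'a \<Rightarrow> bool" where
  "is_triple c \<longleftrightarrow> (\<exists>k m n. c = pair k (pair m n))"

definition elems :: "'a \<Rightarrow> 'a set" where
  "elems c = {i. \<exists>k m n. c = pair k (pair m n) \<and> i \<lhd> k \<and>
                   (\<exists>q. n = ((m \<otimes> (i \<oplus> \<one>)) \<oplus> \<one>) \<otimes> q)}"

definition finite_code :: "'a \<Rightarrow> bool" where
  "finite_code c \<longleftrightarrow> is_triple c \<and> (\<forall>d. is_triple d \<and> d \<lhd> c \<longrightarrow> elems d \<noteq> elems c)"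

definition code_of :: "'a set \<Rightarrow> 'a" where
  "code_of A = (THE c. finite_code c \<and> elems c = A)"

text \<open>A finite sequence is (the code of) its graph, so initial segments of sequences, as well
  as of functions, are given by inclusion of graphs.\<close>

definition seq :: "'a \<Rightarrow> bool" where
  "seq s \<longleftrightarrow> finite_code s \<and>
     (\<forall>z \<in> elems s. \<exists>i j. z = pair i j) \<and>
     (\<forall>i j k. pair i j \<in> elems s \<and> pair i k \<in> elems s \<longrightarrow> j = k) \<and>
     (\<exists>l. \<forall>i. i \<lhd> l \<longleftrightarrow> (\<exists>j. pair i j \<in> elems s))"

definition seq_length :: "'a \<Rightarrow> 'a" where
  "seq_length s = (THE l. \<forall>i. i \<lhd> l \<longleftrightarrow> (\<exists>j. pair i j \<in> elems s))"

definition empty_seq :: 'a where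
  "empty_seq = code_of {}"

definition snoc :: "'a \<Rightarrow> 'a \<Rightarrow> 'a" where
  "snoc s n = code_of (insert (pair (seq_length s) n) (elems s))"

definition binary_string :: "'a \<Rightarrow> bool" where
  "binary_string p \<longleftrightarrow> seq p \<and> (\<forall>i j. pair i j \<in> elems p \<longrightarrow> j = \<zero> \<or> j = \<one>)"

text \<open>Functions are sets of pairs belonging to the structure.\<close>

definition fun_on :: "'a set \<Rightarrow> 'a set \<Rightarrow> 'a set \<Rightarrow> bool" where
  "fun_on A B f \<longleftrightarrow> f \<in> Sets M \<and>
     (\<forall>z \<in> f. \<exists>x \<in> A. \<exists>y \<in> B. z = pair x y) \<and>
     (\<forall>x \<in> A. \<exists>!y. pair x y \<in> f)"

definition app :: "'a set \<Rightarrow> 'a \<Rightarrow> 'a" where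
  "app f x = (THE y. pair x y \<in> f)"

text \<open>The \<open>i\<close>-th member of the sequence of sets coded by \<open>A\<close>.\<close>

definition nth_set :: "'a set \<Rightarrow> 'a \<Rightarrow> 'a set" where
  "nth_set A i = {m. pair m i \<in> A}"


section \<open>Labeled well-founded trees and evaluation maps\<close>

text \<open>Every tree is required to contain its root, the empty string: otherwise the evaluation
  of a formula or Borel code at the root would be meaningless.\<close>

definition wf_tree :: "'a set \<Rightarrow> bool" where
  "wf_tree T \<longleftrightarrow> T \<in> Sets M \<and> (\<forall>\<sigma> \<in> T. seq \<sigma>) \<and> empty_seq \<in> T \<and>
     (\<forall>\<sigma> \<in> T. \<forall>\<tau>. seq \<tau> \<and> elems \<tau> \<subseteq> elems \<sigma> \<longrightarrow> \<tau> \<in> T) \<and>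
     \<not> (\<exists>f. fun_on UNIV UNIV f \<and> (\<forall>\<tau>. seq \<tau> \<and> elems \<tau> \<subseteq> f \<longrightarrow> \<tau> \<in> T))"

definition leaf :: "'a set \<Rightarrow> 'a \<Rightarrow> bool" where
  "leaf T \<sigma> \<longleftrightarrow> \<sigma> \<in> T \<and> \<not> (\<exists>n. snoc \<sigma> n \<in> T)"

definition interior_node :: "'a set \<Rightarrow> 'a \<Rightarrow> bool" where
  "interior_node T \<sigma> \<longleftrightarrow> \<sigma> \<in> T \<and> (\<exists>n. snoc \<sigma> n \<in> T)"

text \<open>The codes of the two connectives and of leaf labels are kept disjoint, so that the label
  of a node tells whether it is a leaf.\<close>

definition union_label :: 'a where
  "union_label = pair \<zero> \<zero>"

definition inter_label :: 'a where
  "inter_label = pair \<zero> \<one>"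

definition leaf_label :: "'a \<Rightarrow> 'a" where
  "leaf_label a = pair \<one> a"

definition labeled_tree :: "'a set \<Rightarrow> 'a set \<Rightarrow> 'a set \<Rightarrow> bool" where
  "labeled_tree A T L \<longleftrightarrow> wf_tree T \<and> fun_on T UNIV L \<and>
     (\<forall>\<sigma>. interior_node T \<sigma> \<longrightarrow> app L \<sigma> = union_label \<or> app L \<sigma> = inter_label) \<and>
     (\<forall>\<sigma>. leaf T \<sigma> \<longrightarrow> (\<exists>a \<in> A. app L \<sigma> = leaf_label a))"

text \<open>\<open>P a\<close> is the truth value of a leaf labeled \<open>a\<close>.\<close>

definition evaluation_map :: "('a \<Rightarrow> bool) \<Rightarrow> 'a set \<Rightarrow> 'a set \<Rightarrow> 'a set \<Rightarrow> bool" where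
  "evaluation_map P T L f \<longleftrightarrow> fun_on T {\<zero>, \<one>} f \<and>
     (\<forall>\<sigma> a. leaf T \<sigma> \<and> app L \<sigma> = leaf_label a \<longrightarrow> (app f \<sigma> = \<one> \<longleftrightarrow> P a)) \<and>
     (\<forall>\<sigma>. interior_node T \<sigma> \<and> app L \<sigma> = union_label \<longrightarrow>
        (app f \<sigma> = \<one> \<longleftrightarrow> (\<exists>n. snoc \<sigma> n \<in> T \<and> app f (snoc \<sigma> n) = \<one>))) \<and>
     (\<forall>\<sigma>. interior_node T \<sigma> \<and> app L \<sigma> = inter_label \<longrightarrow>
        (app f \<sigma> = \<one> \<longleftrightarrow> (\<forall>n. snoc \<sigma> n \<in> T \<longrightarrow> app f (snoc \<sigma> n) = \<one>)))"


section \<open>Infinitary propositional formulas\<close>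

text \<open>The leaf labels true and false are \<open>leaf_label \<one>\<close> and \<open>leaf_label \<zero>\<close>.\<close>

definition Lw1w_formula :: "'a set \<Rightarrow> 'a set \<Rightarrow> bool" where
  "Lw1w_formula T L \<longleftrightarrow> labeled_tree {\<zero>, \<one>} T L"

definition formula_evaluation :: "'a set \<Rightarrow> 'a set \<Rightarrow> 'a set \<Rightarrow> bool" where
  "formula_evaluation T L f \<longleftrightarrow> evaluation_map (\<lambda>a. a = \<one>) T L f"

definition completely_determined_formula :: "'a set \<Rightarrow> 'a set \<Rightarrow> bool" where
  "completely_determined_formula T L \<longleftrightarrow> Lw1w_formula T L \<and> (\<exists>f. formula_evaluation T L f)"

definition formula_true :: "'a set \<Rightarrow> 'a set \<Rightarrow> bool" where
  "formula_true T L \<longleftrightarrow> (\<exists>f. formula_evaluation T L f \<and> app f empty_seq = \<one>)"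

definition Lw1w_CA :: bool where
  "Lw1w_CA \<longleftrightarrow> (\<forall>T \<in> Sets M. \<forall>L \<in> Sets M.
     (\<forall>i. completely_determined_formula (nth_set T i) (nth_set L i)) \<longrightarrow>
     {i. formula_true (nth_set T i) (nth_set L i)} \<in> Sets M)"


section \<open>Borel codes and the property of Baire\<close>

definition cantor_space :: "'a set set" where
  "cantor_space = {X. fun_on UNIV {\<zero>, \<one>} X}"

definition open_code :: "'a set \<Rightarrow> bool" where
  "open_code U \<longleftrightarrow> U \<in> Sets M \<and> (\<forall>p \<in> U. binary_string p)"

definition in_open :: "'a set \<Rightarrow> 'a set \<Rightarrow> bool" where
  "in_open X U \<longleftrightarrow> (\<exists>p \<in> U. elems p \<subseteq> X)"

definition clopen_code :: "'a \<Rightarrow> bool" where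
  "clopen_code c \<longleftrightarrow> finite_code c \<and> (\<forall>p \<in> elems c. binary_string p)"

definition in_clopen :: "'a set \<Rightarrow> 'a \<Rightarrow> bool" where
  "in_clopen X c \<longleftrightarrow> in_open X (elems c)"

definition borel_code :: "'a set \<Rightarrow> 'a set \<Rightarrow> bool" where
  "borel_code T L \<longleftrightarrow> labeled_tree {c. clopen_code c} T L"

definition borel_evaluation :: "'a set \<Rightarrow> 'a set \<Rightarrow> 'a set \<Rightarrow> 'a set \<Rightarrow> bool" where
  "borel_evaluation X T L f \<longleftrightarrow> evaluation_map (in_clopen X) T L f"

definition in_borel :: "'a set \<Rightarrow> 'a set \<Rightarrow> 'a set \<Rightarrow> bool" where
  "in_borel X T L \<longleftrightarrow> (\<exists>f. borel_evaluation X T L f \<and> app f empty_seq = \<one>)"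

definition completely_determined_borel_code :: "'a set \<Rightarrow> 'a set \<Rightarrow> bool" where
  "completely_determined_borel_code T L \<longleftrightarrow>
     borel_code T L \<and> (\<forall>X \<in> cantor_space. \<exists>f. borel_evaluation X T L f)"

text \<open>The tree of the complementary code is the same, and a leaf may carry any code of the
  complementary clopen set. Which one is immaterial, since evaluation maps depend only
  on the clopen sets coded by the leaf labels.\<close>

definition complement_labeling :: "'a set \<Rightarrow> 'a set \<Rightarrow> 'a set \<Rightarrow> bool" where
  "complement_labeling T L L' \<longleftrightarrow> borel_code T L' \<and>
     (\<forall>\<sigma> \<in> T.
        (app L \<sigma> = union_label \<longrightarrow> app L' \<sigma> = inter_label) \<and>
        (app L \<sigma> = inter_label \<longrightarrow> app L' \<sigma> = union_label) \<and>
        (\<forall>c. app L \<sigma> = leaf_label c \<longrightarrow>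
           (\<exists>d. app L' \<sigma> = leaf_label d \<and> clopen_code d \<and>
              (\<forall>X \<in> cantor_space. in_clopen X d \<longleftrightarrow> \<not> in_clopen X c))))"

definition in_borel_complement :: "'a set \<Rightarrow> 'a set \<Rightarrow> 'a set \<Rightarrow> bool" where
  "in_borel_complement X T L \<longleftrightarrow> (\<exists>L'. complement_labeling T L L' \<and> in_borel X T L')"

definition dense_open :: "'a set \<Rightarrow> bool" where
  "dense_open U \<longleftrightarrow>
     (\<forall>p. binary_string p \<longrightarrow> (\<exists>X \<in> cantor_space. elems p \<subseteq> X \<and> in_open X U))"

definition baire_code :: "'a set \<Rightarrow> 'a set \<Rightarrow> 'a set \<Rightarrow> bool" where
  "baire_code U V D \<longleftrightarrow> open_code U \<and> open_code V \<and>
     D \<in> Sets M \<and> (\<forall>n. open_code (nth_set D n)) \<and>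
     \<not> (\<exists>X \<in> cantor_space. in_open X U \<and> in_open X V) \<and>
     dense_open (U \<union> V) \<and> (\<forall>n. dense_open (nth_set D n))"

definition baire_approximation :: "'a set \<Rightarrow> 'a set \<Rightarrow> 'a set \<Rightarrow> 'a set \<Rightarrow> 'a set \<Rightarrow> bool" where
  "baire_approximation U V D T L \<longleftrightarrow> baire_code U V D \<and>
     (\<forall>X \<in> cantor_space. (\<forall>n. in_open X (nth_set D n)) \<longrightarrow>
        (in_open X U \<longrightarrow> in_borel X T L) \<and>
        (in_open X V \<longrightarrow> in_borel_complement X T L))"

definition CD_PB :: bool where
  "CD_PB \<longleftrightarrow> (\<forall>T L. completely_determined_borel_code T L \<longrightarrow>
     (\<exists>U V D. baire_approximation U V D T L))"

end

end

(* Given completely determined formulas phi_i, replace in phi_i every leaf "true" by the clopen set of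
   all extensions of 0^i 1 and every leaf "false" by the empty set, and join the results by one
   disjunction. The evaluation map of phi_i yields one for every X extending 0^i 1, and such an X
   belongs to the resulting Borel set iff phi_i is true. So if U, V, D is a Baire approximation, then
   phi_i is true iff some q in U is compatible with 0^i 1, and false iff some q in V is: one of the
   two happens by density, and a generic X extending both strings decides which. This makes the set of true
   formulas Delta-0-1.

   The two recursions this needs, for a generic point and for a path on which two evaluation maps
   disagree, are instances of dependent choice for Sigma-0-1 relations, proved by Sigma-0-1 induction.
   Definability is handled semantically: a class of predicates on environments, closed under the
   logical operations, each of which is represented by a formula with parameters. *)

theory Submission
  imports Defs
begin

section \<open>Definability of predicates and functions\<close>

text \<open>The hypothesis supplies evaluation maps for one formula at a time. A sequence of maps,
  one for each formula, would yield the set of true formulas at once by reading off the roots, but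
  no such sequence is given. The joint Borel code gets around this: complete determination asks for
  a map at each single point \<open>X\<close>, and since the strings \<open>0^i 1\<close> are
  pairwise incompatible, \<open>X\<close> extends at most one of them. At \<open>X\<close> all
  leaves coming from the other formulas are false, so constant zero is correct there and one given
  map suffices. The missing uniformity is then supplied by \<open>U\<close> and \<open>V\<close>,
  which are sets of the structure and thus legitimate parameters of comprehension. The numbers of
  the structure may be nonstandard, so induction and set formation of the host logic do not apply to
  them. Every induction and every set carries a definability condition; the closure rules are shaped
  so that these conditions can be discharged by repeated introduction.\<close>

primrec rename_term :: "(nat \<Rightarrow> nat) \<Rightarrow> num_term \<Rightarrow> num_term" where
  "rename_term \<rho> (NVar x) = NVar (\<rho> x)"
| "rename_term \<rho> NZero = NZero"
| "rename_term \<rho> NOne = NOne"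
| "rename_term \<rho> (NAdd s t) = NAdd (rename_term \<rho> s) (rename_term \<rho> t)"
| "rename_term \<rho> (NMul s t) = NMul (rename_term \<rho> s) (rename_term \<rho> t)"

primrec rename_fm :: "(nat \<Rightarrow> nat) \<Rightarrow> (nat \<Rightarrow> nat) \<Rightarrow> bounded_fm \<Rightarrow> bounded_fm" where
  "rename_fm \<rho> \<pi> (FEq s t) = FEq (rename_term \<rho> s) (rename_term \<rho> t)"
| "rename_fm \<rho> \<pi> (FLess s t) = FLess (rename_term \<rho> s) (rename_term \<rho> t)"
| "rename_fm \<rho> \<pi> (FMem t k) = FMem (rename_term \<rho> t) (\<pi> k)"
| "rename_fm \<rho> \<pi> (FNot \<theta>) = FNot (rename_fm \<rho> \<pi> \<theta>)"
| "rename_fm \<rho> \<pi> (FAnd \<theta> \<eta>) = FAnd (rename_fm \<rho> \<pi> \<theta>) (rename_fm \<rho> \<pi> \<eta>)"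
| "rename_fm \<rho> \<pi> (FOr \<theta> \<eta>) = FOr (rename_fm \<rho> \<pi> \<theta>) (rename_fm \<rho> \<pi> \<eta>)"
| "rename_fm \<rho> \<pi> (FAll x t \<theta>) = FAll (\<rho> x) (rename_term \<rho> t) (rename_fm \<rho> \<pi> \<theta>)"
| "rename_fm \<rho> \<pi> (FEx x t \<theta>) = FEx (\<rho> x) (rename_term \<rho> t) (rename_fm \<rho> \<pi> \<theta>)"

lemma term_val_rename: "term_val M e (rename_term \<rho> t) = term_val M (\<lambda>n. e (\<rho> n)) t"
  by (induction t) simp_all

text \<open>Injectivity of \<open>\<rho>\<close> keeps a renamed quantifier from capturing another
  variable. Set variables are never bound, so \<open>\<pi>\<close> may be arbitrary.\<close>

lemma bounded_sat_rename:
  assumes "inj \<rho>"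
  shows "bounded_sat M E e (rename_fm \<rho> \<pi> \<theta>)
    \<longleftrightarrow> bounded_sat M (\<lambda>k. E (\<pi> k)) (\<lambda>n. e (\<rho> n)) \<theta>"
proof (induction \<theta> arbitrary: e)
  case (FAll x t \<theta>)
  have "(\<lambda>n. (e(\<rho> x := a)) (\<rho> n)) = (\<lambda>n. e (\<rho> n))(x := a)" for a
    using assms by (auto simp: fun_eq_iff inj_eq)
  then show ?case by (simp add: FAll.IH term_val_rename)
next
  case (FEx x t \<theta>)
  have "(\<lambda>n. (e(\<rho> x := a)) (\<rho> n)) = (\<lambda>n. e (\<rho> n))(x := a)" for a
    using assms by (auto simp: fun_eq_iff inj_eq)
  then show ?case by (simp add: FEx.IH term_val_rename)
qed (simp_all add: term_val_rename)

text \<open>Environments are handled in de Bruijn style: \<open>case_nat a e\<close> extends \<open>e\<close> by a new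
  variable \<open>0\<close>. In the named variables of formulas, the environment \<open>e\<close>, the number parameters
  \<open>c\<close> and the unused variables \<open>j\<close> are interleaved.\<close>

definition interleave :: "(nat \<Rightarrow> 'b) \<Rightarrow> (nat \<Rightarrow> 'b) \<Rightarrow> (nat \<Rightarrow> 'b) \<Rightarrow> nat \<Rightarrow> 'b" where
  "interleave e c j n =
     (if n mod 3 = 0 then e else if n mod 3 = 1 then c else j) (n div 3)"

lemma interleave_simps [simp]:
  "interleave e c j (3 * n) = e n"
  "interleave e c j (3 * n + 1) = c n"
  "interleave e c j (3 * n + 2) = j n"
proof -
  have "(3 * n + 1) mod 3 = 1" "(3 * n + 1) div 3 = n" "(3 * n + 2) mod 3 = 2"
      "(3 * n + 2) div 3 = n"
    by presburger+
  then show "interleave e c j (3 * n) = e n" "interleave e c j (3 * n + 1) = c n"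
    "interleave e c j (3 * n + 2) = j n"
    unfolding interleave_def by simp_all
qed

lemma mod3_cases:
  obtains k where "n = 3 * k" | k where "n = 3 * k + 1" | k where "n = 3 * k + (2::nat)"
proof -
  have "n = 3 * (n div 3) + n mod 3" "n mod 3 < 3" by simp_all
  then show thesis
    using that(1)[of "n div 3"] that(2)[of "n div 3"] that(3)[of "n div 3"] by linarith
qed

lemma comp_interleave:
    "(\<lambda>n. x (interleave f g h n)) = interleave (\<lambda>k. x (f k)) (\<lambda>k. x (g k)) (\<lambda>k. x (h k))"
  by (simp add: interleave_def fun_eq_iff)

lemma inj_interleave:
  assumes "inj f" "inj g" "inj h" "\<And>k l. f k \<noteq> g l" "\<And>k l. f k \<noteq> h l" "\<And>k l. g k \<noteq> h l"
  shows "inj (interleave f g h)"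
proof (rule injI)
  fix m n
  assume "interleave f g h m = interleave f g h n"
  then show "m = n"
    by (cases m rule: mod3_cases; cases n rule: mod3_cases)
      (simp_all only: interleave_simps inj_eq[OF assms(1)] inj_eq[OF assms(2)] inj_eq[OF assms(3)]
        assms(4-6) assms(4-6)[symmetric])
qed

text \<open>Two formulas come with separate parameter lists; \<open>params_left\<close> and
  \<open>params_right\<close> send them to the even and odd positions of one joined list, fixing all
  other variables.\<close>

definition params_left :: "nat \<Rightarrow> nat" where
  "params_left = interleave (\<lambda>k. 3 * k) (\<lambda>k. 3 * (2 * k) + 1) (\<lambda>k. 3 * k + 2)"

definition params_right :: "nat \<Rightarrow> nat" where
  "params_right = interleave (\<lambda>k. 3 * k) (\<lambda>k. 3 * (2 * k + 1) + 1) (\<lambda>k. 3 * k + 2)"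

text \<open>Variable \<open>0\<close> of the extended environment goes to the first spare variable,
  whose name is \<open>2\<close>; the other environment variables drop by one and the spare
  variables move up to make room. A quantifier over \<open>2\<close> then binds exactly the new
  variable.\<close>

definition bind_var :: "nat \<Rightarrow> nat" where
  "bind_var = interleave (case_nat 2 (\<lambda>k. 3 * k)) (\<lambda>k. 3 * k + 1) (\<lambda>k. 3 * Suc k + 2)"

lemma inj_params: "inj params_left" "inj params_right"
  unfolding params_left_def params_right_def
  by (rule inj_interleave; (simp add: inj_def; fail | presburger))+

lemma inj_bind_var: "inj bind_var"
  unfolding bind_var_def
proof (rule inj_interleave)
  show "inj (case_nat 2 (\<lambda>k. 3 * k))"
    unfolding inj_def by (auto split: nat.split) presburger+
qed (auto simp: inj_def split: nat.split; presburger)+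

definition join :: "(nat \<Rightarrow> 'b) \<Rightarrow> (nat \<Rightarrow> 'b) \<Rightarrow> nat \<Rightarrow> 'b" where
  "join c d n = (if even n then c else d) (n div 2)"

lemma join_simps [simp]: "join c d (2 * n) = c n" "join c d (2 * n + 1) = d n"
    "join c d (Suc (2 * n)) = d n"
  by (simp_all add: join_def)

lemma range_join: "range E \<subseteq> S \<Longrightarrow> range F \<subseteq> S \<Longrightarrow> range (join E F) \<subseteq> S"
  by (auto simp: join_def subset_iff)

lemma interleave_params:
  "(\<lambda>n. interleave e (join c d) j (params_left n)) = interleave e c j"
  "(\<lambda>n. interleave e (join c d) j (params_right n)) = interleave e d j"
  unfolding params_left_def params_right_def comp_interleave interleave_simps join_simps
  by simp_all

lemma interleave_bind_var:
  "(\<lambda>n. interleave e c (case_nat a j) (bind_var n)) = interleave (case_nat a e) c j"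
proof -
  have "interleave e c (case_nat a j) (case_nat 2 (\<lambda>k. 3 * k) n) = case_nat a e n" for n
    using interleave_simps(3)[of e c "case_nat a j" 0]
    by (cases n) (simp_all add: numeral_2_eq_2)
  then show ?thesis
    unfolding bind_var_def comp_interleave interleave_simps by simp
qed

lemma interleave_upd0:
  "(interleave e c j)(0 := a) = interleave (case_nat a (\<lambda>n. e (Suc n))) c j"
proof
  fix n
  show "((interleave e c j)(0 := a)) n = interleave (case_nat a (\<lambda>n. e (Suc n))) c j n"
    by (cases n rule: mod3_cases) (auto simp: interleave_def split: nat.split)
qed

lemma interleave_upd2:
  "(interleave e c j)(2 := a) = interleave e c (case_nat a (\<lambda>n. j (Suc n)))"
proof
  fix n
  show "((interleave e c j)(2 := a)) n = interleave e c (case_nat a (\<lambda>n. j (Suc n))) n"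
    by (cases n rule: mod3_cases) (auto simp: interleave_def split: nat.split, presburger+)
qed

lemma interleave_upd3:
  "(interleave e c j)(3 := a) = interleave (case_nat (e 0) (case_nat a (\<lambda>n. e (Suc (Suc n))))) c j"
proof
  fix n
  show "((interleave e c j)(3 := a)) n
      = interleave (case_nat (e 0) (case_nat a (\<lambda>n. e (Suc (Suc n))))) c j n"
    by (cases n rule: mod3_cases) (auto simp: interleave_def split: nat.split, presburger+)
qed

text \<open>The names \<open>0\<close> and \<open>3\<close> belong to the environment variables
  \<open>0\<close> and \<open>1\<close>, here the witness and the argument of a Sigma-0-1
  predicate.\<close>

lemma interleave_upd:
  "(interleave e c j)(3 := n, 0 := m) = interleave (case_nat m (case_nat n (\<lambda>k. e (Suc (Suc k))))) c j"
  by (simp add: interleave_upd3 interleave_upd0)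

section \<open>Semantic classes of predicates and their representation by formulas with
  parameters\<close>

locale rca0 =
  fixes M :: "'a l2_structure" (structure)
  assumes model: "RCA0_model M"
begin

text \<open>Elements of the structure occur directly as constants, and its sets do so in
  \<open>bounded_pred\<close>. Parameters thus need no names until a formula is extracted.\<close>

inductive term_fn :: "((nat \<Rightarrow> 'a) \<Rightarrow> 'a) \<Rightarrow> bool" where
  term_var: "term_fn (\<lambda>e. e n)"
| term_const: "term_fn (\<lambda>e. a)"
| term_add: "term_fn F \<Longrightarrow> term_fn G \<Longrightarrow> term_fn (\<lambda>e. F e \<oplus> G e)"
| term_mul: "term_fn F \<Longrightarrow> term_fn G \<Longrightarrow> term_fn (\<lambda>e. F e \<otimes> G e)"

inductive bounded_pred :: "((nat \<Rightarrow> 'a) \<Rightarrow> bool) \<Rightarrow> bool" where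
  bounded_eq: "term_fn F \<Longrightarrow> term_fn G \<Longrightarrow> bounded_pred (\<lambda>e. F e = G e)"
| bounded_less: "term_fn F \<Longrightarrow> term_fn G \<Longrightarrow> bounded_pred (\<lambda>e. F e \<lhd> G e)"
| bounded_mem: "term_fn F \<Longrightarrow> A \<in> Sets M \<Longrightarrow> bounded_pred (\<lambda>e. F e \<in> A)"
| bounded_not: "bounded_pred R \<Longrightarrow> bounded_pred (\<lambda>e. \<not> R e)"
| bounded_and: "bounded_pred R \<Longrightarrow> bounded_pred Q \<Longrightarrow> bounded_pred (\<lambda>e. R e \<and> Q e)"
| bounded_ex: "term_fn F \<Longrightarrow> bounded_pred R \<Longrightarrow>
    bounded_pred (\<lambda>e. \<exists>a. a \<lhd> F e \<and> R (case_nat a e))"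

text \<open>Quantifying over all \<open>j\<close> says that the spare variables do not influence the
  value, which leaves them free for later quantifiers.\<close>

definition term_rep :: "((nat \<Rightarrow> 'a) \<Rightarrow> 'a) \<Rightarrow> num_term \<Rightarrow> (nat \<Rightarrow> 'a) \<Rightarrow> bool" where
  "term_rep F t c \<longleftrightarrow> (\<forall>e j. F e = term_val M (interleave e c j) t)"

definition pred_rep ::
  "((nat \<Rightarrow> 'a) \<Rightarrow> bool) \<Rightarrow> bounded_fm \<Rightarrow> (nat \<Rightarrow> 'a set) \<Rightarrow> (nat \<Rightarrow> 'a) \<Rightarrow> bool" where
  "pred_rep R \<theta> E c \<longleftrightarrow> (\<forall>e j. R e \<longleftrightarrow> bounded_sat M E (interleave e c j) \<theta>)"

lemma term_rep_join:
  "term_rep F t c \<Longrightarrow> term_rep F (rename_term params_left t) (join c d)"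
  "term_rep F t d \<Longrightarrow> term_rep F (rename_term params_right t) (join c d)"
  by (simp_all add: term_rep_def term_val_rename interleave_params)

lemma pred_rep_join:
  "pred_rep R \<theta> E c \<Longrightarrow> pred_rep R (rename_fm params_left (\<lambda>k. 2 * k) \<theta>) (join E F) (join c d)"
  "pred_rep R \<theta> F d \<Longrightarrow> pred_rep R (rename_fm params_right (\<lambda>k. 2 * k + 1) \<theta>) (join E F) (join c d)"
  by (simp_all add: pred_rep_def bounded_sat_rename inj_params interleave_params)

lemma term_fn_rep: "term_fn F \<Longrightarrow> \<exists>t c. term_rep F t c"
proof (induction rule: term_fn.induct)
  case (term_var n)
  have "term_rep (\<lambda>e. e n) (NVar (3 * n)) c" for c
    by (simp add: term_rep_def)
  then show ?case by blast
next
  case (term_const a)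
  have "term_rep (\<lambda>e. a) (NVar (3 * 0 + 1)) (\<lambda>_. a)"
    unfolding term_rep_def term_val.simps interleave_simps by simp
  then show ?case by blast
next
  case (term_add F G)
  then obtain s c t d where "term_rep F s c" "term_rep G t d" by blast
  from term_rep_join(1)[OF this(1), of d] term_rep_join(2)[OF this(2), of c]
  have "term_rep (\<lambda>e. F e \<oplus> G e)
      (NAdd (rename_term params_left s) (rename_term params_right t)) (join c d)"
    by (simp add: term_rep_def)
  then show ?case by blast
next
  case (term_mul F G)
  then obtain s c t d where "term_rep F s c" "term_rep G t d" by blast
  from term_rep_join(1)[OF this(1), of d] term_rep_join(2)[OF this(2), of c]
  have "term_rep (\<lambda>e. F e \<otimes> G e)
      (NMul (rename_term params_left s) (rename_term params_right t)) (join c d)"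
    by (simp add: term_rep_def)
  then show ?case by blast
qed

lemma Sets_nonempty: "\<exists>A. A \<in> Sets M"
  using model unfolding RCA0_model_def by blast

lemma bounded_pred_rep:
  "bounded_pred R \<Longrightarrow> \<exists>\<theta> E c. range E \<subseteq> Sets M \<and> pred_rep R \<theta> E c"
proof (induction rule: bounded_pred.induct)
  case (bounded_eq F G)
  then obtain s c t d where "term_rep F s c" "term_rep G t d" using term_fn_rep by blast
  from term_rep_join(1)[OF this(1), of d] term_rep_join(2)[OF this(2), of c]
  have "pred_rep (\<lambda>e. F e = G e)
      (FEq (rename_term params_left s) (rename_term params_right t)) E (join c d)" for E
    by (simp add: term_rep_def pred_rep_def)
  \<comment> \<open>The formula mentions no set, but the schemes still demand an interpretation of
    all set variables inside \<open>Sets M\<close>.\<close>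
  moreover obtain A where "A \<in> Sets M" using Sets_nonempty by blast
  then have "range (\<lambda>_::nat. A) \<subseteq> Sets M" by auto
  ultimately show ?case by blast
next
  case (bounded_less F G)
  then obtain s c t d where "term_rep F s c" "term_rep G t d" using term_fn_rep by blast
  from term_rep_join(1)[OF this(1), of d] term_rep_join(2)[OF this(2), of c]
  have "pred_rep (\<lambda>e. F e \<lhd> G e)
      (FLess (rename_term params_left s) (rename_term params_right t)) E (join c d)" for E
    by (simp add: term_rep_def pred_rep_def)
  moreover obtain A where "A \<in> Sets M" using Sets_nonempty by blast
  then have "range (\<lambda>_::nat. A) \<subseteq> Sets M" by auto
  ultimately show ?case by blast
next
  case (bounded_mem F A)
  then obtain t c where "term_rep F t c" using term_fn_rep by blast
  then have "pred_rep (\<lambda>e. F e \<in> A) (FMem t 0) (\<lambda>_. A) c"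
    by (simp add: term_rep_def pred_rep_def)
  moreover have "range (\<lambda>_::nat. A) \<subseteq> Sets M" using bounded_mem by auto
  ultimately show ?case by blast
next
  case (bounded_not R)
  then obtain \<theta> E c where "range E \<subseteq> Sets M" "pred_rep R \<theta> E c" by blast
  moreover from this have "pred_rep (\<lambda>e. \<not> R e) (FNot \<theta>) E c"
    by (simp add: pred_rep_def)
  ultimately show ?case by blast
next
  case (bounded_and R Q)
  from bounded_and.IH obtain \<theta> E c \<eta> F d where *: "range E \<subseteq> Sets M" "pred_rep R \<theta> E c"
    "range F \<subseteq> Sets M" "pred_rep Q \<eta> F d" by (elim exE conjE)
  from pred_rep_join(1)[OF *(2), of F d] pred_rep_join(2)[OF *(4), of E c]
  have "pred_rep (\<lambda>e. R e \<and> Q e) (FAnd (rename_fm params_left (\<lambda>k. 2 * k) \<theta>)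
      (rename_fm params_right (\<lambda>k. 2 * k + 1) \<eta>)) (join E F) (join c d)"
    by (simp add: pred_rep_def)
  then show ?case using range_join[OF *(1,3)] by blast
next
  case (bounded_ex F R)
  from term_fn_rep[OF bounded_ex(1)] bounded_ex.IH obtain t c \<theta> E d
    where *: "term_rep F t c" "range E \<subseteq> Sets M" "pred_rep R \<theta> E d"
    by (elim exE conjE)
  let ?t = "rename_term params_left t"
  let ?\<theta> = "rename_fm params_right (\<lambda>k. 2 * k + 1) \<theta>"
  have t: "term_rep F ?t (join c d)" and \<theta>: "pred_rep R ?\<theta> (join E E) (join c d)"
    using term_rep_join(1)[OF *(1)] pred_rep_join(2)[OF *(3)] by blast+
  have "pred_rep (\<lambda>e. \<exists>a. a \<lhd> F e \<and> R (case_nat a e))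
      (FEx 2 ?t (rename_fm bind_var id ?\<theta>)) (join E E) (join c d)"
    using t \<theta> unfolding pred_rep_def term_rep_def
    by (simp add: bounded_sat_rename inj_bind_var interleave_upd2 interleave_bind_var)
  then show ?case using range_join[OF *(2) *(2)] by blast
qed

lemma term_fn_subst: "term_fn F \<Longrightarrow> (\<And>n. term_fn (T n)) \<Longrightarrow> term_fn (\<lambda>e. F (\<lambda>n. T n e))"
  by (induction rule: term_fn.induct) (auto intro: term_fn.intros)

lemma bounded_pred_subst:
  "bounded_pred R \<Longrightarrow> (\<And>n. term_fn (T n)) \<Longrightarrow> bounded_pred (\<lambda>e. R (\<lambda>n. T n e))"
proof (induction arbitrary: T rule: bounded_pred.induct)
  case (bounded_ex F R)
  \<comment> \<open>The lifting of the substitution \<open>T\<close> under the binder: variable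
    \<open>0\<close> stays, the others are substituted in the environment without it.\<close>
  define T' where "T' = case_nat (\<lambda>e. e 0) (\<lambda>n e. T n (\<lambda>k. e (Suc k)))"
  have "term_fn (T' n)" for n
    using term_fn_subst[OF bounded_ex.prems term_var, of _ Suc]
    by (auto simp: T'_def term_var split: nat.split)
  from bounded_ex.IH[OF this] have "bounded_pred (\<lambda>e. R (\<lambda>n. T' n e))" .
  moreover have "case_nat a (\<lambda>n. T n e) = (\<lambda>n. T' n (case_nat a e))" for a and e :: "nat \<Rightarrow> 'a"
    by (auto simp: T'_def split: nat.split)
  ultimately show ?case
    using bounded_pred.bounded_ex[OF term_fn_subst[OF bounded_ex(1) bounded_ex.prems],
        of "\<lambda>e. R (\<lambda>n. T' n e)" "\<lambda>n. n"] by simp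
next
  case (bounded_eq F G)
  then show ?case by (intro bounded_pred.bounded_eq) (rule term_fn_subst; assumption)+
next
  case (bounded_less F G)
  then show ?case by (intro bounded_pred.bounded_less) (rule term_fn_subst; assumption)+
next
  case (bounded_mem F A)
  then show ?case by (intro bounded_pred.bounded_mem) (rule term_fn_subst; assumption)
qed (intro bounded_pred.bounded_not bounded_pred.bounded_and; simp)+

text \<open>The bound variable is an argument of \<open>R\<close> instead of sitting inside
  \<open>case_nat\<close>, so that the rule unifies with quantifiers as they are written in
  goals.\<close>

lemma bounded_ex': "term_fn F \<Longrightarrow> bounded_pred (\<lambda>e. R (e 0) (\<lambda>n. e (Suc n))) \<Longrightarrow>
    bounded_pred (\<lambda>e. \<exists>a. a \<lhd> F e \<and> R a e)"
  using bounded_ex[of F "\<lambda>e. R (e 0) (\<lambda>n. e (Suc n))"] by simp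

lemma bounded_or: "bounded_pred R \<Longrightarrow> bounded_pred Q \<Longrightarrow> bounded_pred (\<lambda>e. R e \<or> Q e)"
  using bounded_not[OF bounded_and[OF bounded_not bounded_not]] by simp

lemma bounded_all': "term_fn F \<Longrightarrow> bounded_pred (\<lambda>e. R (e 0) (\<lambda>n. e (Suc n))) \<Longrightarrow>
    bounded_pred (\<lambda>e. \<forall>a. a \<lhd> F e \<longrightarrow> R a e)"
  using bounded_not[OF bounded_ex'[of F "\<lambda>a e. \<not> R a e", OF _ bounded_not]] by simp

definition sigma_pred :: "((nat \<Rightarrow> 'a) \<Rightarrow> bool) \<Rightarrow> bool" where
  "sigma_pred R \<longleftrightarrow> (\<exists>B. bounded_pred B \<and> R = (\<lambda>e. \<exists>m. B (case_nat m e)))"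

lemma bounded_sigma: "bounded_pred R \<Longrightarrow> sigma_pred R"
  unfolding sigma_pred_def
  by (rule exI[of _ "\<lambda>e. R (\<lambda>n. e (Suc n))"]) (simp add: bounded_pred_subst[where T =
      "\<lambda>n e. e (Suc n)"] term_var)

lemma sigma_exI: "bounded_pred (\<lambda>e. R (e 0) (\<lambda>n. e (Suc n))) \<Longrightarrow> sigma_pred (\<lambda>e. \<exists>a. R a e)"
  unfolding sigma_pred_def
  by (rule exI[of _ "\<lambda>e. R (e 0) (\<lambda>n. e (Suc n))"]) simp

lemma sigma_Sigma1:
  assumes "sigma_pred (\<lambda>e. P (e 0))"
  obtains \<theta> E c where "range E \<subseteq> Sets M" "\<And>n j. P n \<longleftrightarrow> Sigma1_pred M E (interleave e c j) 3 0 \<theta> n"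
proof -
  obtain B where "bounded_pred B" and B: "(\<lambda>e. P (e 0)) = (\<lambda>e. \<exists>m. B (case_nat m e))"
    using assms unfolding sigma_pred_def by blast
  then obtain \<theta> E c where *: "range E \<subseteq> Sets M" "pred_rep B \<theta> E c"
    using bounded_pred_rep by blast
  \<comment> \<open>\<open>P\<close> looks at variable \<open>0\<close> only, so the rest of the
    environment may be filled by any \<open>e\<close>.\<close>
  have "P n \<longleftrightarrow> (\<exists>m. B (case_nat m (case_nat n (\<lambda>k. e (Suc (Suc k))))))" for n
    using B[THEN fun_cong, of "case_nat n (\<lambda>k. e (Suc (Suc k)))"] by simp
  then have "P n \<longleftrightarrow> Sigma1_pred M E (interleave e c j) 3 0 \<theta> n" for n j
    using *(2) unfolding Sigma1_pred_def interleave_upd pred_rep_def by blast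
  with *(1) show thesis by (rule that)
qed

theorem sigma_induct:
  assumes "sigma_pred (\<lambda>e. P (e 0))" "P \<zero>" "\<And>n. P n \<Longrightarrow> P (n \<oplus> \<one>)"
  shows "P n"
proof -
  obtain \<theta> E c where *: "range E \<subseteq> Sets M"
    "\<And>n j. P n \<longleftrightarrow> Sigma1_pred M E (interleave undefined c j) 3 0 \<theta> n"
    by (rule sigma_Sigma1[OF assms(1), where e = undefined], rule that)
  from *(2)[of _ undefined] have P: "P = Sigma1_pred M E (interleave undefined c undefined) 3 0 \<theta>"
    by (intro ext)
  have "Sigma1_induction M" using model unfolding RCA0_model_def by (elim conjE)
  from this[unfolded Sigma1_induction_def, rule_format, OF *(1), of
      "interleave undefined c undefined" 3 0 \<theta>]
  show ?thesis
    unfolding P[symmetric] using assms(2,3) by blast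
qed

theorem delta_comprehension:
  assumes "sigma_pred (\<lambda>e. P (e 0))" "sigma_pred (\<lambda>e. \<not> P (e 0))"
  shows "{n. P n} \<in> Sets M"
proof -
  obtain B C where BC: "bounded_pred B" "bounded_pred C"
    "(\<lambda>e. P (e 0)) = (\<lambda>e. \<exists>m. B (case_nat m e))" "(\<lambda>e. \<not> P (e 0)) = (\<lambda>e. \<exists>m. C (case_nat m e))"
    using assms unfolding sigma_pred_def by (elim exE conjE)
  from bounded_pred_rep[OF BC(1)] bounded_pred_rep[OF BC(2)]
  obtain \<theta> E c \<eta> F d where *: "range E \<subseteq> Sets M" "pred_rep B \<theta> E c"
    "range F \<subseteq> Sets M" "pred_rep C \<eta> F d"
    by (elim exE conjE)
  define e :: "nat \<Rightarrow> 'a" where "e = interleave undefined (join c d) undefined"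
  \<comment> \<open>Comprehension wants both formulas over the same parameters, hence the renaming
    into joined lists. \<open>FNot\<close> turns the matrix of the Sigma-0-1 complement into a
    Pi-0-1 matrix of \<open>P\<close> itself.\<close>
  let ?\<theta> = "rename_fm params_left (\<lambda>k. 2 * k) \<theta>"
    and ?\<eta> = "FNot (rename_fm params_right (\<lambda>k. 2 * k + 1) \<eta>)"
  have B: "P n \<longleftrightarrow> (\<exists>m. B (case_nat m (case_nat n (\<lambda>k. undefined (Suc (Suc k))))))"
    and C: "\<not> P n \<longleftrightarrow> (\<exists>m. C (case_nat m (case_nat n (\<lambda>k. undefined (Suc (Suc k))))))" for n
    using BC(3)[THEN fun_cong, of "case_nat n (\<lambda>k. undefined (Suc (Suc k)))"]
      BC(4)[THEN fun_cong, of "case_nat n (\<lambda>k. undefined (Suc (Suc k)))"] by simp_all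
  have 1: "P n \<longleftrightarrow> Sigma1_pred M (join E F) e 3 0 ?\<theta> n" for n
    using pred_rep_join(1)[OF *(2), of F d]
    unfolding Sigma1_pred_def e_def interleave_upd pred_rep_def by (simp add: B)
  have 2: "P n \<longleftrightarrow> Pi1_pred M (join E F) e 3 0 ?\<eta> n" for n
    using pred_rep_join(2)[OF *(4), of E c] C[of n]
    unfolding Pi1_pred_def e_def interleave_upd pred_rep_def bounded_sat.simps by metis
  have "Delta1_comprehension M" using model unfolding RCA0_model_def by (elim conjE)
  from this[unfolded Delta1_comprehension_def, rule_format, OF range_join[OF *(1,3)], of e 3 0 ?\<theta> 0 ?\<eta>]
  have "{n. Sigma1_pred M (join E F) e 3 0 ?\<theta> n} \<in> Sets M"
    unfolding 1[symmetric] 2[symmetric] by simp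
  then show ?thesis by (simp only: 1)
qed

section \<open>Arithmetic\<close>

lemmas term_intros = term_var term_const term_add term_mul
lemmas bounded_intros = bounded_eq bounded_less bounded_mem bounded_not bounded_and bounded_or

lemma bounded_induct:
  assumes "bounded_pred (\<lambda>e. P (e 0))" "P \<zero>" "\<And>n. P n \<Longrightarrow> P (n \<oplus> \<one>)"
  shows "P n"
  using sigma_induct[OF bounded_sigma[OF assms(1)]] assms(2,3) by blast

lemma
  succ_neq_zero [simp]: "n \<oplus> \<one> \<noteq> \<zero>" and
  succ_inject: "m \<oplus> \<one> = n \<oplus> \<one> \<Longrightarrow> m = n" and
  add_zero: "m \<oplus> \<zero> = m" and
  add_succ: "m \<oplus> (n \<oplus> \<one>) = (m \<oplus> n) \<oplus> \<one>" and
  mul_zero: "m \<otimes> \<zero> = \<zero>" and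
  mul_succ: "m \<otimes> (n \<oplus> \<one>) = (m \<otimes> n) \<oplus> m" and
  not_less_zero: "\<not> m \<lhd> \<zero>" and
  less_succ: "m \<lhd> n \<oplus> \<one> \<longleftrightarrow> m \<lhd> n \<or> m = n"
  using model unfolding RCA0_model_def basic_axioms_def by metis+

lemma zero_add: "\<zero> \<oplus> n = n"
  by (rule bounded_induct[where n = n]; (intro bounded_intros term_intros)?)
    (simp_all add: add_zero add_succ)

lemma add_assoc: "(a \<oplus> b) \<oplus> c = a \<oplus> (b \<oplus> c)"
  by (rule bounded_induct[where n = c]; (intro bounded_intros term_intros)?)
    (simp_all add: add_zero add_succ)

lemma succ_add: "(m \<oplus> \<one>) \<oplus> n = (m \<oplus> n) \<oplus> \<one>"
  by (rule bounded_induct[where n = n]; (intro bounded_intros term_intros)?)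
    (simp_all add: add_zero add_succ)

lemma add_commute: "m \<oplus> n = n \<oplus> m"
  by (rule bounded_induct[where n = n]; (intro bounded_intros term_intros)?)
    (simp_all add: add_zero zero_add add_succ succ_add)

lemma zero_mul: "\<zero> \<otimes> n = \<zero>"
  by (rule bounded_induct[where n = n]; (intro bounded_intros term_intros)?)
    (simp_all add: mul_zero add_zero mul_succ)

lemma add_left_commute: "a \<oplus> (b \<oplus> c) = b \<oplus> (a \<oplus> c)"
  by (metis add_assoc add_commute)

lemma succ_mul: "(m \<oplus> \<one>) \<otimes> n = (m \<otimes> n) \<oplus> n"
proof (rule bounded_induct[where n = n]; (intro bounded_intros term_intros)?)
  fix n assume *: "(m \<oplus> \<one>) \<otimes> n = (m \<otimes> n) \<oplus> n"
  have "(m \<oplus> \<one>) \<otimes> (n \<oplus> \<one>) = ((m \<otimes> n) \<oplus> n) \<oplus> (m \<oplus> \<one>)"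
    by (simp only: mul_succ *)
  also have "\<dots> = ((m \<otimes> n) \<oplus> m) \<oplus> (n \<oplus> \<one>)"
    by (simp only: add_assoc add_commute add_left_commute)
  finally show "(m \<oplus> \<one>) \<otimes> (n \<oplus> \<one>) = (m \<otimes> (n \<oplus> \<one>)) \<oplus> (n \<oplus> \<one>)"
    by (simp only: mul_succ)
qed (simp add: mul_zero add_zero)

lemma mul_commute: "m \<otimes> n = n \<otimes> m"
  by (rule bounded_induct[where n = n]; (intro bounded_intros term_intros)?)
    (simp_all add: mul_zero zero_mul mul_succ succ_mul)

lemma add_mul: "(a \<oplus> b) \<otimes> c = (a \<otimes> c) \<oplus> (b \<otimes> c)"
proof (rule bounded_induct[where n = c]; (intro bounded_intros term_intros)?)
  fix n assume *: "(a \<oplus> b) \<otimes> n = (a \<otimes> n) \<oplus> (b \<otimes> n)"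
  then show "(a \<oplus> b) \<otimes> (n \<oplus> \<one>) = (a \<otimes> (n \<oplus> \<one>)) \<oplus> (b \<otimes> (n \<oplus> \<one>))"
    by (simp only: mul_succ add_assoc add_commute add_left_commute)
qed (simp add: mul_zero add_zero)

lemma mul_add: "c \<otimes> (a \<oplus> b) = (c \<otimes> a) \<oplus> (c \<otimes> b)"
  using add_mul mul_commute by simp

lemma mul_assoc: "(a \<otimes> b) \<otimes> c = a \<otimes> (b \<otimes> c)"
proof (rule bounded_induct[where n = c]; (intro bounded_intros term_intros)?)
  fix n assume *: "(a \<otimes> b) \<otimes> n = a \<otimes> (b \<otimes> n)"
  have "a \<otimes> ((b \<otimes> n) \<oplus> b) = (a \<otimes> (b \<otimes> n)) \<oplus> (a \<otimes> b)"
    by (rule mul_add)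
  with * show "(a \<otimes> b) \<otimes> (n \<oplus> \<one>) = a \<otimes> (b \<otimes> (n \<oplus> \<one>))"
    by (simp only: mul_succ)
qed (simp add: mul_zero)

lemma one_mul: "\<one> \<otimes> n = n"
  using succ_mul[of \<zero> n] by (simp add: zero_mul zero_add)

lemma mul_one: "n \<otimes> \<one> = n"
  using one_mul mul_commute by simp

lemma add_left_cancel: "a \<oplus> b = a \<oplus> c \<Longrightarrow> b = c"
proof -
  have "a \<oplus> b \<noteq> a \<oplus> c \<or> b = c"
    by (rule bounded_induct[where n = a]; (intro bounded_intros term_intros)?)
      (auto simp: zero_add succ_add dest: succ_inject)
  then show "a \<oplus> b = a \<oplus> c \<Longrightarrow> b = c" by blast
qed

lemma zero_or_succ: "n = \<zero> \<or> (\<exists>m. n = m \<oplus> \<one>)"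
proof (rule sigma_induct[where n = n])
  have "sigma_pred (\<lambda>e. \<exists>m. e 0 = \<zero> \<or> e 0 = m \<oplus> \<one>)"
    by (rule sigma_exI, intro bounded_intros term_intros)
  then show "sigma_pred (\<lambda>e. e 0 = \<zero> \<or> (\<exists>m. e 0 = m \<oplus> \<one>))" by simp
qed auto

lemma add_eq_zero: "a \<oplus> b = \<zero> \<Longrightarrow> b = \<zero>"
  using zero_or_succ[of b] by (auto simp: add_succ)

lemma less_add_succ: "m \<lhd> m \<oplus> (k \<oplus> \<one>)"
  by (rule bounded_induct[where n = k]; (intro bounded_intros term_intros)?)
    (simp_all add: add_zero add_succ less_succ)

text \<open>The axioms describe \<open>\<lhd>\<close> only at zero and at successors. Expressing it
  by addition is what makes linearity, transitivity and monotonicity accessible.\<close>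

lemma less_iff: "m \<lhd> n \<longleftrightarrow> (\<exists>k. n = m \<oplus> (k \<oplus> \<one>))"
proof
  have "\<not> m \<lhd> n \<or> (\<exists>k. n = m \<oplus> (k \<oplus> \<one>))"
  proof (rule sigma_induct[where n = n])
    have "sigma_pred (\<lambda>e. \<exists>k. \<not> m \<lhd> e 0 \<or> e 0 = m \<oplus> (k \<oplus> \<one>))"
      by (rule sigma_exI, intro bounded_intros term_intros)
    then show "sigma_pred (\<lambda>e. \<not> m \<lhd> e 0 \<or> (\<exists>k. e 0 = m \<oplus> (k \<oplus> \<one>)))" by simp
  next
    fix n assume *: "\<not> m \<lhd> n \<or> (\<exists>k. n = m \<oplus> (k \<oplus> \<one>))"
    show "\<not> m \<lhd> n \<oplus> \<one> \<or> (\<exists>k. n \<oplus> \<one> = m \<oplus> (k \<oplus> \<one>))"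
      using * unfolding less_succ by (metis add_succ add_zero zero_add)
  qed (simp add: not_less_zero)
  then show "m \<lhd> n \<Longrightarrow> \<exists>k. n = m \<oplus> (k \<oplus> \<one>)" by blast
qed (auto simp: less_add_succ)

definition le :: "'a \<Rightarrow> 'a \<Rightarrow> bool" (infix "\<unlhd>" 50) where
  "a \<unlhd> b \<longleftrightarrow> a \<lhd> b \<or> a = b"

lemma le_iff: "a \<unlhd> b \<longleftrightarrow> (\<exists>k. b = a \<oplus> k)"
  unfolding le_def less_iff using zero_or_succ by (metis add_zero)

lemma le_linear: "a \<unlhd> b \<or> b \<unlhd> a"
proof -
  have "a \<lhd> b \<or> a = b \<or> b \<lhd> a"
  proof (rule bounded_induct[where n = b]; (intro bounded_intros term_intros)?)
    show "a \<lhd> \<zero> \<or> a = \<zero> \<or> \<zero> \<lhd> a"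
      using zero_or_succ[of a] less_iff[of \<zero> a] by (auto simp: zero_add)
  next
    fix n assume "a \<lhd> n \<or> a = n \<or> n \<lhd> a"
    moreover have "a = n \<oplus> \<one> \<or> n \<oplus> \<one> \<lhd> a" if "n \<lhd> a"
    proof -
      from that obtain k where "a = n \<oplus> (k \<oplus> \<one>)" unfolding less_iff by blast
      then have "a = (n \<oplus> \<one>) \<oplus> k" by (simp add: succ_add add_succ)
      then show ?thesis using le_iff[of "n \<oplus> \<one>" a] by (auto simp: le_def)
    qed
    ultimately show "a \<lhd> n \<oplus> \<one> \<or> a = n \<oplus> \<one> \<or> n \<oplus> \<one> \<lhd> a"
      unfolding less_succ by blast
  qed
  then show ?thesis by (auto simp: le_def)
qed

text \<open>Truncated subtraction is introduced because the library structure
  \<open>linordered_semidom\<close>, interpreted below, includes a minus operation.\<close>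

definition monus :: "'a \<Rightarrow> 'a \<Rightarrow> 'a" (infixl "\<ominus>" 65) where
  "a \<ominus> b = (if b \<unlhd> a then THE c. a = b \<oplus> c else \<zero>)"

lemma add_monus: "(b \<oplus> c) \<ominus> b = c"
  unfolding monus_def le_iff by (auto intro!: the_equality dest: add_left_cancel)

lemma monus_eq_zero: "\<not> b \<unlhd> a \<Longrightarrow> a \<ominus> b = \<zero>"
  by (simp add: monus_def)

lemma le_antisym: "a \<unlhd> b \<Longrightarrow> b \<unlhd> a \<Longrightarrow> a = b"
proof -
  assume "a \<unlhd> b" "b \<unlhd> a"
  then obtain k l where kl: "b = a \<oplus> k" "a = b \<oplus> l" unfolding le_iff by blast
  then have "a \<oplus> (k \<oplus> l) = a \<oplus> \<zero>" by (simp add: add_zero flip: add_assoc)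
  then have "l = \<zero>" using add_left_cancel add_eq_zero by blast
  then show "a = b" using kl(2) by (simp add: add_zero)
qed

lemma less_le_not_le: "a \<lhd> b \<longleftrightarrow> a \<unlhd> b \<and> \<not> b \<unlhd> a"
proof -
  have "\<not> b \<unlhd> a" if "a \<lhd> b"
  proof -
    from that obtain k where k: "b = a \<oplus> (k \<oplus> \<one>)" unfolding less_iff by blast
    show ?thesis
    proof
      assume "b \<unlhd> a"
      then obtain l where "a = b \<oplus> l" using le_iff by blast
      with k have "b \<oplus> \<zero> = b \<oplus> (l \<oplus> (k \<oplus> \<one>))"
        by (simp add: add_zero flip: add_assoc)
      then show False
        using add_left_cancel add_eq_zero succ_neq_zero by metis
    qed
  qed
  then show ?thesis using le_def le_antisym by blast
qed

text \<open>Makes the library facts on ordered semirings available for the numbers of the structure,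
  under the prefix \<open>N\<close>.\<close>

sublocale N: linordered_semidom "(\<oplus>)" "(\<ominus>)" "(\<unlhd>)" "(\<lhd>)" \<zero> "(\<otimes>)" \<one>
proof unfold_locales
  show "a \<ominus> b \<ominus> c = a \<ominus> (b \<oplus> c)" for a b c
  proof (cases "b \<unlhd> a")
    case True
    then obtain k where k: "a = b \<oplus> k" using le_iff by blast
    show ?thesis
    proof (cases "c \<unlhd> k")
      case True
      then obtain l where "k = c \<oplus> l" using le_iff by blast
      then show ?thesis using k by (metis add_monus add_assoc)
    next
      case False
      then have "\<not> b \<oplus> c \<unlhd> a" unfolding k le_iff by (metis add_assoc add_left_cancel)
      then show ?thesis using False k by (simp add: monus_eq_zero add_monus)
    qed
  next
    case False
    then have "\<not> b \<oplus> c \<unlhd> a" unfolding le_iff by (metis add_assoc)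
    moreover have "\<zero> \<ominus> c = \<zero>"
      using add_monus[of \<zero> \<zero>] monus_eq_zero le_iff by (metis add_eq_zero add_zero add_commute)
    ultimately show ?thesis using False by (simp add: monus_eq_zero)
  qed
  show "a \<otimes> (b \<ominus> c) = a \<otimes> b \<ominus> a \<otimes> c" for a b c
  proof (cases "c \<unlhd> b")
    case True
    then obtain k where k: "b = c \<oplus> k" using le_iff by blast
    show ?thesis unfolding k by (simp add: add_monus mul_add)
  next
    case False
    then obtain k where k: "c = b \<oplus> k" using le_iff le_linear by blast
    show ?thesis
    proof (cases "a \<otimes> c \<unlhd> a \<otimes> b")
      case True
      moreover have "a \<otimes> b \<unlhd> a \<otimes> c" unfolding k le_iff by (auto simp: mul_add)
      ultimately have "a \<otimes> b = a \<otimes> c" using le_antisym by blast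
      then show ?thesis using False by (metis add_monus add_zero monus_eq_zero mul_zero)
    next
      case False
      then show ?thesis using \<open>\<not> c \<unlhd> b\<close> by (simp add: monus_eq_zero mul_zero)
    qed
  qed
  show "c \<otimes> a \<lhd> c \<otimes> b" if "a \<lhd> b" "\<zero> \<lhd> c" for a b c
  proof -
    from that obtain k where "b = a \<oplus> (k \<oplus> \<one>)" unfolding less_iff by blast
    moreover from that obtain l where "c = l \<oplus> \<one>"
        using zero_or_succ[of c] not_less_zero[of \<zero>] by auto
    ultimately have "c \<otimes> b = c \<otimes> a \<oplus> ((c \<otimes> k \<oplus> l) \<oplus> \<one>)"
      by (simp add: mul_add mul_one add_assoc)
    then show ?thesis using less_add_succ by simp
  qed
  show "a \<otimes> b \<noteq> \<zero>" if "a \<noteq> \<zero>" "b \<noteq> \<zero>" for a b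
    using that zero_or_succ[of a] zero_or_succ[of b] by (auto simp: mul_succ add_succ)
  show "\<zero> \<lhd> \<one>" using less_succ[of \<zero> \<zero>] by (simp add: zero_add)
  show "\<one> \<otimes> a = a" for a by (rule one_mul)
  show "a \<unlhd> c" if "a \<unlhd> b" "b \<unlhd> c" for a b c
    using that unfolding le_iff by (auto simp: add_assoc)
  show "c \<oplus> a \<unlhd> c \<oplus> b" if "a \<unlhd> b" for a b c
    using that unfolding le_iff by (auto simp: add_assoc)
  show "a \<ominus> b \<oplus> b = a" if "b \<unlhd> a" for a b
    using that unfolding le_iff by (auto simp: add_monus intro: add_commute)
  show "\<zero> \<noteq> \<one>" using succ_neq_zero[of \<zero>] by (metis zero_add)
qed (rule mul_add add_assoc add_commute mul_assoc mul_commute add_mul zero_add add_zero add_monus zero_mul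
    mul_zero one_mul less_le_not_le le_linear le_antisym | (simp add: le_def; fail) | assumption)+

section \<open>Sigma-0-1 and Delta-0-1 predicates\<close>

text \<open>Closure under substitution is built in, so that a matrix can be reused in whatever
  larger environment the surrounding quantifiers create.\<close>

definition bounded_matrix :: "('a \<Rightarrow> (nat \<Rightarrow> 'a) \<Rightarrow> bool) \<Rightarrow> bool" where
  "bounded_matrix B \<longleftrightarrow> (\<forall>F T. term_fn F \<longrightarrow> (\<forall>n. term_fn (T n))
      \<longrightarrow> bounded_pred (\<lambda>e. B (F e) (\<lambda>n. T n e)))"

lemma bounded_matrixD:
  "bounded_matrix B \<Longrightarrow> term_fn F \<Longrightarrow> (\<And>n. term_fn (T n)) \<Longrightarrow> bounded_pred (\<lambda>e. B (F e) (\<lambda>n. T n e))"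
  by (simp add: bounded_matrix_def)

lemma sigmaE:
  assumes "sigma_pred R"
  obtains B where "R = (\<lambda>e. \<exists>m. B m e)" "bounded_matrix B"
proof -
  obtain B where B: "bounded_pred B" "R = (\<lambda>e. \<exists>m. B (case_nat m e))"
    using assms unfolding sigma_pred_def by blast
  have "bounded_pred (\<lambda>e. B (case_nat (F e) (\<lambda>n. T n e)))"
    if "term_fn F" "\<And>n. term_fn (T n)" for F T
  proof -
    have "bounded_pred (\<lambda>e. B (\<lambda>n. case_nat F T n e))"
      by (rule bounded_pred_subst[OF B(1)]) (use that in \<open>auto split: nat.split\<close>)
    moreover have "(\<lambda>n. case_nat F T n e) = case_nat (F e) (\<lambda>n. T n e)" for e
      by (auto split: nat.split)
    ultimately show ?thesis by simp
  qed
  then show thesis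
    using that[of "\<lambda>m e. B (case_nat m e)"] B(2) by (simp add: bounded_matrix_def)
qed

lemma sigma_subst:
  assumes "sigma_pred R" "\<And>n. term_fn (T n)"
  shows "sigma_pred (\<lambda>e. R (\<lambda>n. T n e))"
proof -
  obtain B where B: "R = (\<lambda>e. \<exists>m. B m e)"
    "bounded_matrix B"
    by (rule sigmaE[OF assms(1)])
  have "bounded_pred (\<lambda>e. B (e 0) (\<lambda>n. T n (\<lambda>k. e (Suc k))))"
    by (intro bounded_matrixD[OF B(2)] term_fn_subst[OF assms(2)] term_var)
  then show ?thesis unfolding B(1) by (rule sigma_exI)
qed

text \<open>The two unbounded witnesses are replaced by one common strict bound \<open>k\<close>,
  below which both are sought. This merges quantifiers before any pairing function is
  available.\<close>

lemma sigma_and: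
  assumes "sigma_pred R" "sigma_pred Q"
  shows "sigma_pred (\<lambda>e. R e \<and> Q e)"
proof -
  obtain B where B: "R = (\<lambda>e. \<exists>m. B m e)"
    "bounded_matrix B"
    by (rule sigmaE[OF assms(1)])
  obtain C where C: "Q = (\<lambda>e. \<exists>m. C m e)"
    "bounded_matrix C"
    by (rule sigmaE[OF assms(2)])
  have "sigma_pred (\<lambda>e. \<exists>k. (\<exists>m. m \<lhd> k \<and> B m e) \<and> (\<exists>m. m \<lhd> k \<and> C m e))"
    by (intro sigma_exI bounded_and bounded_ex' bounded_matrixD[OF B(2)] bounded_matrixD[OF C(2)] term_var)
  moreover have "(\<exists>k. (\<exists>m. m \<lhd> k \<and> B m e) \<and> (\<exists>m. m \<lhd> k \<and> C m e)) \<longleftrightarrow> R e \<and> Q e" for e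
  proof
    assume "R e \<and> Q e"
    then obtain m n where "B m e" "C n e" unfolding B(1) C(1) by blast
    moreover have "m \<lhd> (m \<oplus> n) \<oplus> \<one>" "n \<lhd> (m \<oplus> n) \<oplus> \<one>"
      unfolding less_iff by (auto simp: ac_simps)
    ultimately show "\<exists>k. (\<exists>m. m \<lhd> k \<and> B m e) \<and> (\<exists>m. m \<lhd> k \<and> C m e)" by blast
  qed (auto simp: B(1) C(1))
  ultimately show ?thesis by simp
qed

lemma sigma_or:
  assumes "sigma_pred R" "sigma_pred Q"
  shows "sigma_pred (\<lambda>e. R e \<or> Q e)"
proof -
  obtain B where B: "R = (\<lambda>e. \<exists>m. B m e)" "bounded_matrix B"
    by (rule sigmaE[OF assms(1)])
  obtain C where C: "Q = (\<lambda>e. \<exists>m. C m e)" "bounded_matrix C"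
    by (rule sigmaE[OF assms(2)])
  have "sigma_pred (\<lambda>e. \<exists>m. B m e \<or> C m e)"
    by (intro sigma_exI bounded_or bounded_matrixD[OF B(2)] bounded_matrixD[OF C(2)] term_var)
  then show ?thesis unfolding B(1) C(1) by (simp add: ex_disj_distrib)
qed

lemma sigma_ex:
  assumes "sigma_pred (\<lambda>e. R (e 0) (\<lambda>n. e (Suc n)))"
  shows "sigma_pred (\<lambda>e. \<exists>a. R a e)"
proof -
  obtain B where B: "(\<lambda>e. R (e 0) (\<lambda>n. e (Suc n))) = (\<lambda>e. \<exists>m. B m e)"
    "bounded_matrix B"
    by (rule sigmaE[OF assms])
  have R: "R a e \<longleftrightarrow> (\<exists>m. B m (case_nat a e))" for a e
    using B(1)[THEN fun_cong, of "case_nat a e"] by simp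
  \<comment> \<open>Under both bounded quantifiers the variables \<open>0\<close>, \<open>1\<close>,
    \<open>2\<close> are the witness \<open>m\<close>, the value \<open>a\<close> and the bound
    \<open>k\<close>. \<open>T\<close> rebuilds the environment of the matrix from \<open>a\<close>
    and the variables beyond \<open>k\<close>; \<open>m\<close> is passed separately.\<close>
  define T :: "nat \<Rightarrow> (nat \<Rightarrow> 'a) \<Rightarrow> 'a" where
    "T = case_nat (\<lambda>e. e 1) (\<lambda>n e. e (Suc (Suc (Suc n))))"
  have T: "(\<lambda>n. T n e) = case_nat (e 1) (\<lambda>n. e (Suc (Suc (Suc n))))" for e
    by (auto simp: T_def split: nat.split)
  have "term_fn (T n)" for n by (auto simp: T_def term_var split: nat.split)
  then have "bounded_pred (\<lambda>e. B (e 0) (case_nat (e (Suc 0)) (\<lambda>n. e (Suc (Suc (Suc n))))))"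
    using bounded_matrixD[OF B(2) term_var, of T] by (simp add: T)
  then have "sigma_pred (\<lambda>e. \<exists>k a. a \<lhd> k \<and> (\<exists>m. m \<lhd> k \<and> B m (case_nat a e)))"
    by (intro sigma_exI bounded_ex' term_var)
  moreover have "(\<exists>k a. a \<lhd> k \<and> (\<exists>m. m \<lhd> k \<and> B m (case_nat a e))) \<longleftrightarrow> (\<exists>a. R a e)" for e
  proof
    assume "\<exists>a. R a e"
    then obtain a m where "B m (case_nat a e)" unfolding R by blast
    moreover have "m \<lhd> (m \<oplus> a) \<oplus> \<one>" "a \<lhd> (m \<oplus> a) \<oplus> \<one>"
      unfolding less_iff by (auto simp: ac_simps)
    ultimately show "\<exists>k a. a \<lhd> k \<and> (\<exists>m. m \<lhd> k \<and> B m (case_nat a e))" by blast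
  qed (auto simp: R)
  ultimately show ?thesis by simp
qed

text \<open>This is Sigma-0-1 collection: the witnesses for all \<open>a\<close> below the bound
  have a common bound \<open>k\<close>, obtained by Sigma-0-1 induction on the part \<open>c\<close>
  of the range already treated.\<close>

lemma sigma_all_less_term:
  assumes "term_fn F" "sigma_pred (\<lambda>e. R (e 0) (\<lambda>n. e (Suc n)))"
  shows "sigma_pred (\<lambda>e. \<forall>a. a \<lhd> F e \<longrightarrow> R a e)"
proof -
  obtain B where B: "(\<lambda>e. R (e 0) (\<lambda>n. e (Suc n))) = (\<lambda>e. \<exists>m. B m e)"
    "bounded_matrix B"
    by (rule sigmaE[OF assms(2)])
  have R: "R a e \<longleftrightarrow> (\<exists>m. B m (case_nat a e))" for a e
    using B(1)[THEN fun_cong, of "case_nat a e"] by simp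
  have case_B: "bounded_pred (\<lambda>e. B (G e) (case_nat (H e) (\<lambda>n. T n e)))"
    if "term_fn G" "term_fn H" "\<And>n. term_fn (T n)" for G H T
  proof -
    have "bounded_pred (\<lambda>e. B (G e) (\<lambda>n. case_nat H T n e))"
      by (rule bounded_matrixD[OF B(2)]) (use that in \<open>auto split: nat.split\<close>)
    moreover have "(\<lambda>n. case_nat H T n e) = case_nat (H e) (\<lambda>n. T n e)" for e
      by (auto split: nat.split)
    ultimately show ?thesis by simp
  qed
  have "sigma_pred (\<lambda>e. \<exists>k. \<forall>a. a \<lhd> F e \<longrightarrow> (\<exists>m. m \<lhd> k \<and> B m (case_nat a e)))"
    by (intro sigma_exI bounded_all' bounded_ex' case_B term_var term_fn_subst[OF assms(1)])
  moreover have "(\<exists>k. \<forall>a. a \<lhd> b \<longrightarrow> (\<exists>m. m \<lhd> k \<and> B m (case_nat a e))) \<longleftrightarrow> (\<forall>a. a \<lhd> b \<longrightarrow> R a e)" for e b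
  proof
    assume all: "\<forall>a. a \<lhd> b \<longrightarrow> R a e"
    \<comment> \<open>The disjunct \<open>b \<lhd> c\<close> makes the claim trivial beyond
      \<open>b\<close>, where nothing is known of \<open>R\<close>. At \<open>c = b\<close> it is
      false, so the other disjunct remains.\<close>
    have "\<exists>k. b \<lhd> c \<or> (\<forall>a. a \<lhd> c \<longrightarrow> (\<exists>m. m \<lhd> k \<and> B m (case_nat a e)))" for c
    proof (rule sigma_induct[where n = c])
      show "sigma_pred (\<lambda>e'. \<exists>k. b \<lhd> e' 0 \<or> (\<forall>a. a \<lhd> e' 0 \<longrightarrow> (\<exists>m. m \<lhd> k \<and> B m (case_nat a e))))"
        by (intro sigma_exI bounded_or bounded_less bounded_all' bounded_ex' case_B term_var term_const)
    next
      fix c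
      assume "\<exists>k. b \<lhd> c \<or> (\<forall>a. a \<lhd> c \<longrightarrow> (\<exists>m. m \<lhd> k \<and> B m (case_nat a e)))"
      then consider "b \<unlhd> c" | k where "c \<lhd> b" "\<forall>a. a \<lhd> c \<longrightarrow> (\<exists>m. m \<lhd> k \<and> B m (case_nat a e))"
        using N.not_less by (auto simp: le_def)
      then show "\<exists>k. b \<lhd> c \<oplus> \<one> \<or> (\<forall>a. a \<lhd> c \<oplus> \<one> \<longrightarrow> (\<exists>m. m \<lhd> k \<and> B m (case_nat a e)))"
      proof cases
        case 1
        then have "b \<lhd> c \<oplus> \<one>" by (simp add: less_succ le_def)
        then show ?thesis by blast
      next
        case 2
        then obtain l where "B l (case_nat c e)" using all R by blast
        then have "\<exists>m. m \<lhd> k \<oplus> (l \<oplus> \<one>) \<and> B m (case_nat a e)" if "a \<lhd> c \<oplus> \<one>" for a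
        proof -
          have "l \<lhd> k \<oplus> (l \<oplus> \<one>)" unfolding less_iff by (auto simp: ac_simps)
          moreover have "m \<lhd> k \<oplus> (l \<oplus> \<one>)" if "m \<lhd> k" for m
            using that less_add_succ N.less_trans by blast
          ultimately show ?thesis using 2(2) that \<open>B l (case_nat c e)\<close> unfolding less_succ by blast
        qed
        then show ?thesis by blast
      qed
    qed (simp add: not_less_zero)
    then show "\<exists>k. \<forall>a. a \<lhd> b \<longrightarrow> (\<exists>m. m \<lhd> k \<and> B m (case_nat a e))" by blast
  qed (auto simp: R)
  ultimately show ?thesis by simp
qed

text \<open>Since \<open>F\<close> is total, \<open>R (F e) e\<close> can be written with an
  existential value \<open>y = F e\<close>. Applied to \<open>R\<close> and to its negation, this
  lets such functions be substituted into Delta-0-1 predicates as well.\<close>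

definition sigma_fn :: "((nat \<Rightarrow> 'a) \<Rightarrow> 'a) \<Rightarrow> bool" where
  "sigma_fn F \<longleftrightarrow> sigma_pred (\<lambda>e. e 0 = F (\<lambda>n. e (Suc n)))"

definition delta_pred :: "((nat \<Rightarrow> 'a) \<Rightarrow> bool) \<Rightarrow> bool" where
  "delta_pred R \<longleftrightarrow> sigma_pred R \<and> sigma_pred (\<lambda>e. \<not> R e)"

lemma bounded_delta: "bounded_pred R \<Longrightarrow> delta_pred R"
  by (simp add: delta_pred_def bounded_sigma bounded_not)

lemma delta_sigma: "delta_pred R \<Longrightarrow> sigma_pred R"
  by (simp add: delta_pred_def)

lemma delta_subst: "delta_pred R \<Longrightarrow> (\<And>n. term_fn (T n)) \<Longrightarrow> delta_pred (\<lambda>e. R (\<lambda>n. T n e))"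
  using sigma_subst[of "\<lambda>e. \<not> R e"] by (simp add: delta_pred_def sigma_subst)

lemma sigma_graph: "sigma_fn F \<Longrightarrow> sigma_pred (\<lambda>e. e k = F (\<lambda>n. e (l n)))"
  unfolding sigma_fn_def
  by (drule sigma_subst[of _ "case_nat (\<lambda>e. e k) (\<lambda>n e. e (l n))"])
    (auto simp: term_var split: nat.split)

lemma sigma_let:
  assumes "sigma_pred (\<lambda>e. R (e 0) (\<lambda>n. e (Suc n)))" "sigma_fn F"
  shows "sigma_pred (\<lambda>e. R (F e) e)"
proof -
  have "sigma_pred (\<lambda>e. \<exists>y. y = F e \<and> R y e)"
    by (intro sigma_ex sigma_and assms(1) sigma_graph assms(2))
  then show ?thesis by simp
qed

lemma sigma_comp1: "sigma_pred (\<lambda>e. P (e 0)) \<Longrightarrow> sigma_fn F \<Longrightarrow> sigma_pred (\<lambda>e. P (F e))"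
  using sigma_let[of "\<lambda>a e. P a"] by simp

lemma sigma_comp2:
  assumes "sigma_pred (\<lambda>e. P (e 0) (e 1))" "sigma_fn F" "sigma_fn G"
  shows "sigma_pred (\<lambda>e. P (F e) (G e))"
proof -
  have "sigma_pred (\<lambda>e. \<exists>y z. y = F e \<and> z = G e \<and> P y z)"
    using sigma_subst[OF assms(1), of "\<lambda>n. if n = 0 then (\<lambda>e. e 1) else (\<lambda>e. e 0)"]
    by (intro sigma_ex sigma_and sigma_graph assms(2,3)) (simp add: term_var)
  then show ?thesis by simp
qed

lemma sigma_comp3:
  assumes "sigma_pred (\<lambda>e. P (e 0) (e 1) (e 2))" "sigma_fn F" "sigma_fn G" "sigma_fn H"
  shows "sigma_pred (\<lambda>e. P (F e) (G e) (H e))"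
proof -
  have "sigma_pred (\<lambda>e. \<exists>x y z. x = F e \<and> y = G e \<and> z = H e \<and> P x y z)"
    using sigma_subst[OF assms(1), of
        "\<lambda>n. if n = 0 then (\<lambda>e. e 2) else if n = 1 then (\<lambda>e. e 1) else (\<lambda>e. e 0)"]
    by (intro sigma_ex sigma_and sigma_graph assms(2-)) (simp add: term_var numeral_2_eq_2)
  then show ?thesis by simp
qed

lemma delta_comp1: "delta_pred (\<lambda>e. P (e 0)) \<Longrightarrow> sigma_fn F \<Longrightarrow> delta_pred (\<lambda>e. P (F e))"
  using sigma_comp1[of P] sigma_comp1[of "\<lambda>a. \<not> P a"] by (simp add: delta_pred_def)

lemma delta_comp2:
  "delta_pred (\<lambda>e. P (e 0) (e 1)) \<Longrightarrow> sigma_fn F \<Longrightarrow> sigma_fn G \<Longrightarrow> delta_pred (\<lambda>e. P (F e) (G e))"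
  using sigma_comp2[of P] sigma_comp2[of "\<lambda>a b. \<not> P a b"] by (simp add: delta_pred_def)

lemma delta_comp3:
  "delta_pred (\<lambda>e. P (e 0) (e 1) (e 2)) \<Longrightarrow> sigma_fn F \<Longrightarrow> sigma_fn G \<Longrightarrow> sigma_fn H \<Longrightarrow>
    delta_pred (\<lambda>e. P (F e) (G e) (H e))"
  using sigma_comp3[of P] sigma_comp3[of "\<lambda>a b c. \<not> P a b c"] by (simp add: delta_pred_def)

lemma term_sigma_fn: "term_fn F \<Longrightarrow> sigma_fn F"
  unfolding sigma_fn_def
  by (intro bounded_sigma bounded_eq term_var term_fn_subst[of F "\<lambda>n e. e (Suc n)"])

lemma fn_var: "sigma_fn (\<lambda>e. e n)" and fn_const: "sigma_fn (\<lambda>e. a)"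
  by (intro term_sigma_fn term_intros)+

lemma fn_comp1:
  assumes "sigma_fn (\<lambda>e. f (e 0))" "sigma_fn F"
  shows "sigma_fn (\<lambda>e. f (F e))"
  unfolding sigma_fn_def
proof (rule sigma_comp2[of "\<lambda>y x. y = f x"])
  show "sigma_pred (\<lambda>e. e 0 = f (e 1))"
    using assms(1) by (simp add: sigma_fn_def)
  show "sigma_fn (\<lambda>e. F (\<lambda>n. e (Suc n)))"
    using assms(2) unfolding sigma_fn_def[of "\<lambda>e. F (\<lambda>n. e (Suc n))"] by (rule sigma_graph)
qed (rule fn_var)

lemma fn_comp2:
  assumes "sigma_fn (\<lambda>e. f (e 0) (e 1))" "sigma_fn F" "sigma_fn G"
  shows "sigma_fn (\<lambda>e. f (F e) (G e))"
  unfolding sigma_fn_def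
proof (rule sigma_comp3[of "\<lambda>y x z. y = f x z"])
  show "sigma_pred (\<lambda>e. e 0 = f (e 1) (e 2))"
    using assms(1) by (simp add: sigma_fn_def numeral_2_eq_2)
  show "sigma_fn (\<lambda>e. F (\<lambda>n. e (Suc n)))"
    using assms(2) unfolding sigma_fn_def[of "\<lambda>e. F (\<lambda>n. e (Suc n))"] by (rule sigma_graph)
  show "sigma_fn (\<lambda>e. G (\<lambda>n. e (Suc n)))"
    using assms(3) unfolding sigma_fn_def[of "\<lambda>e. G (\<lambda>n. e (Suc n))"] by (rule sigma_graph)
qed (rule fn_var)

lemma fn_add0: "sigma_fn (\<lambda>e. e 0 \<oplus> e 1)" and fn_mul0: "sigma_fn (\<lambda>e. e 0 \<otimes> e 1)"
  by (intro term_sigma_fn term_intros)+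

lemmas fn_add = fn_comp2[OF fn_add0] and fn_mul = fn_comp2[OF fn_mul0]

lemma delta_eq0: "delta_pred (\<lambda>e. e 0 = e 1)" and delta_less0: "delta_pred (\<lambda>e. e 0 \<lhd> e 1)"
  and delta_le0: "delta_pred (\<lambda>e. e 0 \<unlhd> e 1)"
  unfolding le_def by (intro bounded_delta bounded_intros term_intros)+

lemma delta_mem0: "A \<in> Sets M \<Longrightarrow> delta_pred (\<lambda>e. e 0 \<in> A)"
  by (intro bounded_delta bounded_intros term_intros)

lemmas delta_eq = delta_comp2[OF delta_eq0] and delta_less = delta_comp2[OF delta_less0]
  and delta_le = delta_comp2[OF delta_le0] and delta_mem = delta_comp1[OF delta_mem0]

lemma delta_not: "delta_pred R \<Longrightarrow> delta_pred (\<lambda>e. \<not> R e)"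
  by (simp add: delta_pred_def)

lemma delta_and: "delta_pred R \<Longrightarrow> delta_pred Q \<Longrightarrow> delta_pred (\<lambda>e. R e \<and> Q e)"
  unfolding delta_pred_def de_Morgan_conj
      by (intro conjI sigma_and sigma_or; elim conjE; assumption)

lemma delta_or: "delta_pred R \<Longrightarrow> delta_pred Q \<Longrightarrow> delta_pred (\<lambda>e. R e \<or> Q e)"
  unfolding delta_pred_def de_Morgan_disj
      by (intro conjI sigma_and sigma_or; elim conjE; assumption)

lemma delta_imp: "delta_pred R \<Longrightarrow> delta_pred Q \<Longrightarrow> delta_pred (\<lambda>e. R e \<longrightarrow> Q e)"
  unfolding imp_conv_disj by (intro delta_or delta_not)

lemma delta_iff: "delta_pred R \<Longrightarrow> delta_pred Q \<Longrightarrow> delta_pred (\<lambda>e. R e \<longleftrightarrow> Q e)"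
  unfolding iff_conv_conj_imp by (intro delta_and delta_imp)

lemma delta_const: "delta_pred (\<lambda>e. P)"
  using delta_eq[OF fn_const fn_const, of \<zero> \<zero>] delta_not[OF delta_eq[OF fn_const fn_const, of \<zero> \<zero>]]
  by (cases P) simp_all

lemma sigma_all_less:
  assumes "sigma_fn F" "sigma_pred (\<lambda>e. R (e 0) (\<lambda>n. e (Suc n)))"
  shows "sigma_pred (\<lambda>e. \<forall>a. a \<lhd> F e \<longrightarrow> R a e)"
proof (rule sigma_let[OF _ assms(1)])
  show "sigma_pred (\<lambda>e. \<forall>a. a \<lhd> e 0 \<longrightarrow> R a (\<lambda>n. e (Suc n)))"
    using sigma_subst[OF assms(2), of "case_nat (\<lambda>e. e 0) (\<lambda>n e. e (Suc (Suc n)))"]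
    by (intro sigma_all_less_term term_var) (auto simp: term_var split: nat.splits)
qed

lemma sigma_less: "sigma_fn F \<Longrightarrow> sigma_fn G \<Longrightarrow> sigma_pred (\<lambda>e. F e \<lhd> G e)"
  using delta_less delta_sigma by blast

lemma fn_weaken: "sigma_fn F \<Longrightarrow> sigma_fn (\<lambda>e. F (\<lambda>n. e (Suc n)))"
  unfolding sigma_fn_def[of "\<lambda>e. F (\<lambda>n. e (Suc n))"] by (rule sigma_graph)

lemma sigma_ex_less:
  assumes "sigma_fn F" "sigma_pred (\<lambda>e. R (e 0) (\<lambda>n. e (Suc n)))"
  shows "sigma_pred (\<lambda>e. \<exists>a. a \<lhd> F e \<and> R a e)"
  by (intro sigma_ex sigma_and sigma_less fn_var assms(2) fn_weaken[OF assms(1)])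

lemma delta_ex_less:
  assumes "sigma_fn F" "delta_pred (\<lambda>e. R (e 0) (\<lambda>n. e (Suc n)))"
  shows "delta_pred (\<lambda>e. \<exists>a. a \<lhd> F e \<and> R a e)"
  using sigma_ex_less[OF assms(1), of R] sigma_all_less[OF assms(1), of "\<lambda>a e. \<not> R a e"] assms(2)
  by (simp add: delta_pred_def)

lemma delta_all_less:
  assumes "sigma_fn F" "delta_pred (\<lambda>e. R (e 0) (\<lambda>n. e (Suc n)))"
  shows "delta_pred (\<lambda>e. \<forall>a. a \<lhd> F e \<longrightarrow> R a e)"
  using delta_not[OF delta_ex_less[OF assms(1), of "\<lambda>a e. \<not> R a e"]] delta_not[OF assms(2)] by simp

lemma fn_if:
  assumes "delta_pred P" "sigma_fn F" "sigma_fn G"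
  shows "sigma_fn (\<lambda>e. if P e then F e else G e)"
proof -
  have "sigma_pred (\<lambda>e. (P (\<lambda>n. e (Suc n)) \<and> e 0 = F (\<lambda>n. e (Suc n)))
      \<or> (\<not> P (\<lambda>n. e (Suc n)) \<and> e 0 = G (\<lambda>n. e (Suc n))))"
    using delta_subst[OF assms(1), of "\<lambda>n e. e (Suc n)"]
    by (intro sigma_or sigma_and sigma_graph assms(2,3)) (auto simp: delta_pred_def term_var)
  moreover have "(P e \<and> a = F e \<or> \<not> P e \<and> a = G e) \<longleftrightarrow> a = (if P e then F e else G e)" for a e
    by simp
  ultimately show ?thesis unfolding sigma_fn_def by simp
qed

lemmas fn_intros = fn_var fn_const fn_add fn_mul
lemmas delta_intros = delta_eq delta_less delta_le delta_mem delta_not delta_and delta_or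
    delta_imp delta_iff
  delta_ex_less delta_all_less
lemmas sigma_intros = sigma_and sigma_or sigma_ex sigma_all_less

lemma delta_set: "delta_pred (\<lambda>e. P (e 0)) \<Longrightarrow> {n. P n} \<in> Sets M"
  by (simp add: delta_pred_def delta_comprehension)

lemma delta_induct:
  assumes "delta_pred (\<lambda>e. P (e 0))" "P \<zero>" "\<And>n. P n \<Longrightarrow> P (n \<oplus> \<one>)"
  shows "P n"
  using sigma_induct[OF delta_sigma[OF assms(1)]] assms(2,3) by blast

lemma delta_less_induct:
  assumes "delta_pred (\<lambda>e. P (e 0))" "\<And>n. (\<And>m. m \<lhd> n \<Longrightarrow> P m) \<Longrightarrow> P n"
  shows "P n"
proof -
  have "\<forall>m. m \<lhd> n \<longrightarrow> P m" for n
    by (rule delta_induct[where n = n]; (intro delta_all_less fn_intros delta_comp1[OF assms(1)])?)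
      (auto simp: not_less_zero less_succ intro: assms(2))
  then show ?thesis using assms(2) by blast
qed

lemma delta_least:
  assumes "delta_pred (\<lambda>e. P (e 0))" "P n"
  shows "\<exists>m. P m \<and> (\<forall>k. k \<lhd> m \<longrightarrow> \<not> P k)"
  using delta_less_induct[of "\<lambda>n. \<not> P n" n, OF delta_not[OF assms(1)]] assms(2) by blast

section \<open>Coding of finite sets and sequences\<close>

lemmas semiring_simps = mul_add add_mul mul_one one_mul add_assoc add_commute add_left_commute
  N.mult.assoc N.mult.commute N.mult.left_commute

lemma zero_neq_succ [simp]: "\<zero> \<noteq> n \<oplus> \<one>"
  using succ_neq_zero[of n] by metis

lemma zero_le [simp]: "\<zero> \<unlhd> a"
  unfolding le_iff by simp

lemma less_succ_le: "a \<lhd> b \<oplus> \<one> \<longleftrightarrow> a \<unlhd> b"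
  by (simp add: less_succ le_def)

lemma succ_le: "a \<oplus> \<one> \<unlhd> b \<longleftrightarrow> a \<lhd> b"
  unfolding less_iff le_iff by (auto simp: ac_simps)

lemma le_add [simp]: "a \<unlhd> a \<oplus> b" "a \<unlhd> b \<oplus> a"
  unfolding le_iff by (auto simp: ac_simps)

lemma delta_ex_le:
  assumes "sigma_fn F" "delta_pred (\<lambda>e. R (e 0) (\<lambda>n. e (Suc n)))"
  shows "delta_pred (\<lambda>e. \<exists>a. a \<unlhd> F e \<and> R a e)"
  unfolding less_succ_le[symmetric] by (intro delta_ex_less fn_intros assms)

text \<open>Quantifiers over the components of a pair can be bounded by the pair itself, which keeps
  all decoding Delta-0-1.\<close>

lemma pair_bounds [simp]: "i \<unlhd> pair M i j" "j \<unlhd> pair M i j"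
proof -
  have "j \<unlhd> (i \<oplus> j) \<otimes> (i \<oplus> j)"
  proof (cases "i \<oplus> j = \<zero>")
    case True
    then show ?thesis using add_eq_zero[of i j] by simp
  next
    case False
    then have "\<one> \<unlhd> i \<oplus> j" using succ_le[of \<zero> "i \<oplus> j"] zero_le[of "i \<oplus> j"] by (auto simp: le_def)
    then have "(i \<oplus> j) \<otimes> \<one> \<unlhd> (i \<oplus> j) \<otimes> (i \<oplus> j)" by (intro N.mult_left_mono) auto
    then show ?thesis using N.order_trans[OF le_add(2)] by simp
  qed
  then show "i \<unlhd> pair M i j" "j \<unlhd> pair M i j"
    unfolding pair_def using N.order_trans le_add by blast+
qed

lemma pair_mono: "i \<unlhd> k \<Longrightarrow> j \<unlhd> l \<Longrightarrow> pair M i j \<unlhd> pair M k l"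
  unfolding pair_def by (intro N.add_mono N.mult_mono) auto

text \<open>Pairs with component sum \<open>s\<close> have values between
  \<open>s \<otimes> s\<close> and \<open>s \<otimes> s \<oplus> s\<close>, and the square of
  \<open>s \<oplus> \<one>\<close> lies above this block. Different sums thus give disjoint
  blocks.\<close>

lemma pair_less_sum: "i \<oplus> j \<lhd> k \<oplus> l \<Longrightarrow> pair M i j \<lhd> pair M k l"
proof -
  assume "i \<oplus> j \<lhd> k \<oplus> l"
  then have "((i \<oplus> j) \<oplus> \<one>) \<otimes> ((i \<oplus> j) \<oplus> \<one>) \<unlhd> (k \<oplus> l) \<otimes> (k \<oplus> l)"
    by (intro N.mult_mono) (auto simp: succ_le)
  moreover have "((i \<oplus> j) \<oplus> \<one>) \<otimes> ((i \<oplus> j) \<oplus> \<one>) = (pair M i j \<oplus> (i \<oplus> j \<oplus> j)) \<oplus> \<one>"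
    unfolding pair_def by (simp add: algebra_simps)
  moreover have "pair M i j \<lhd> (pair M i j \<oplus> (i \<oplus> j \<oplus> j)) \<oplus> \<one>"
    by (simp add: less_succ_le)
  moreover have "(k \<oplus> l) \<otimes> (k \<oplus> l) \<unlhd> pair M k l"
    unfolding pair_def by simp
  ultimately show ?thesis by (metis N.less_le_trans)
qed

lemma pair_inject [simp]: "pair M i j = pair M k l \<longleftrightarrow> i = k \<and> j = l"
proof
  assume eq: "pair M i j = pair M k l"
  then have "i \<oplus> j = k \<oplus> l"
    using pair_less_sum[of i j k l] pair_less_sum[of k l i j] N.less_linear[of "i \<oplus> j"
        "k \<oplus> l"] by auto
  moreover from this eq have "i = k" by (simp add: pair_def)
  ultimately show "i = k \<and> j = l" by simp
qed simp

lemma fn_pair0: "sigma_fn (\<lambda>e. pair M (e 0) (e 1))"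
  unfolding pair_def by (intro fn_intros)

lemmas fn_pair = fn_comp2[OF fn_pair0]

section \<open>Codes of finite sets by divisibility, after Goedel's beta function\<close>

definition divides :: "'a \<Rightarrow> 'a \<Rightarrow> bool" where
  "divides a b \<longleftrightarrow> (\<exists>q. b = a \<otimes> q)"

lemma divides_mult: "divides a b \<Longrightarrow> divides a (b \<otimes> c)"
  unfolding divides_def using mul_assoc by blast

lemma divides_add_cancel:
  assumes "divides a b" "divides a (b \<oplus> c)"
  shows "divides a c"
proof (cases "a = \<zero>")
  case True
  then show ?thesis using assms by (auto simp: divides_def)
next
  case False
  obtain p q where pq: "b = a \<otimes> p" "b \<oplus> c = a \<otimes> q" using assms unfolding divides_def by blast
  then have "a \<otimes> p \<unlhd> a \<otimes> q" by (metis le_add(1))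
  then have "p \<unlhd> q" using False N.mult_strict_left_mono[of q p a] N.not_le zero_le[of a]
    by (metis le_def)
  then obtain r where "q = p \<oplus> r" unfolding le_iff by blast
  then have "c = a \<otimes> r" using pq by (simp add: mul_add)
  then show ?thesis unfolding divides_def by blast
qed

text \<open>Goedel's moduli: if all nonzero numbers below \<open>k\<close> divide \<open>m\<close>,
  those with \<open>i \<lhd> k\<close> are pairwise coprime.\<close>

definition modulus :: "'a \<Rightarrow> 'a \<Rightarrow> 'a" where
  "modulus m i = m \<otimes> (i \<oplus> \<one>) \<oplus> \<one>"

text \<open>\<open>x \<otimes> modulus m i\<close> is \<open>x\<close> plus a multiple of
  \<open>x \<otimes> m\<close>. This is coprimality of \<open>modulus m i\<close> and
  \<open>m\<close> in cancellation form, without greatest common divisors.\<close>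

lemma modulus_coprime: "divides (modulus m i) (x \<otimes> m) \<Longrightarrow> divides (modulus m i) x"
proof -
  assume *: "divides (modulus m i) (x \<otimes> m)"
  have "x \<otimes> modulus m i = (x \<otimes> m) \<otimes> (i \<oplus> \<one>) \<oplus> x"
    by (simp add: modulus_def algebra_simps)
  moreover have "divides (modulus m i) (x \<otimes> modulus m i)"
    unfolding divides_def by (auto simp: ac_simps)
  ultimately show ?thesis using divides_add_cancel[OF divides_mult[OF *, of "i \<oplus> \<one>"]] by simp
qed

text \<open>Subtracting the multiple \<open>n \<otimes> modulus m i\<close> leaves
  \<open>n \<otimes> d \<otimes> m\<close>, up to sign, where \<open>d\<close> is the distance of
  \<open>i\<close> and \<open>j\<close>. Coprimality removes \<open>m\<close>; as \<open>d\<close>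
  is below \<open>k\<close> and so divides \<open>m\<close>, the remaining
  \<open>n \<otimes> d\<close> can be multiplied up to \<open>n \<otimes> m\<close>, and
  \<open>m\<close> is removed once more.\<close>

lemma modulus_divides_cancel:
  assumes "i \<lhd> k" "j \<lhd> k" "i \<noteq> j" and m: "\<And>d. \<zero> \<lhd> d \<Longrightarrow> d \<lhd> k \<Longrightarrow> divides d m"
    and div: "divides (modulus m i) (n \<otimes> modulus m j)"
  shows "divides (modulus m i) n"
proof -
  have self: "divides (modulus m i) (n \<otimes> modulus m i)"
    unfolding divides_def by (auto simp: ac_simps)
  have "\<exists>d. \<zero> \<lhd> d \<and> d \<lhd> k \<and> divides (modulus m i) (n \<otimes> d \<otimes> m)"
  proof (cases "i \<lhd> j")
    case True
    then obtain d where d: "j = i \<oplus> (d \<oplus> \<one>)" unfolding less_iff by blast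
    then have "n \<otimes> modulus m j = n \<otimes> modulus m i \<oplus> n \<otimes> (d \<oplus> \<one>) \<otimes> m"
      by (simp only: modulus_def semiring_simps)
    then have "divides (modulus m i) (n \<otimes> (d \<oplus> \<one>) \<otimes> m)"
      using divides_add_cancel[OF self] div by simp
    moreover have "\<zero> \<lhd> d \<oplus> \<one>" "d \<oplus> \<one> \<lhd> k"
      using N.le_less_trans[OF le_add(2) assms(2)[unfolded d]] by (simp_all add: less_succ_le)
    ultimately show ?thesis by blast
  next
    case False
    then have "j \<lhd> i" using assms(3) N.less_linear by blast
    then obtain d where d: "i = j \<oplus> (d \<oplus> \<one>)" unfolding less_iff by blast
    then have "n \<otimes> modulus m i = n \<otimes> modulus m j \<oplus> n \<otimes> (d \<oplus> \<one>) \<otimes> m"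
      by (simp only: modulus_def semiring_simps)
    then have "divides (modulus m i) (n \<otimes> (d \<oplus> \<one>) \<otimes> m)"
      using divides_add_cancel[OF div] self by simp
    moreover have "\<zero> \<lhd> d \<oplus> \<one>" "d \<oplus> \<one> \<lhd> k"
      using N.le_less_trans[OF le_add(2) assms(1)[unfolded d]] by (simp_all add: less_succ_le)
    ultimately show ?thesis by blast
  qed
  then obtain d where d: "\<zero> \<lhd> d" "d \<lhd> k" "divides (modulus m i) (n \<otimes> d)"
    using modulus_coprime by blast
  then obtain q where "m = d \<otimes> q" using m unfolding divides_def by blast
  then have "divides (modulus m i) (n \<otimes> m)"
    using divides_mult[OF d(3), of q] by (simp add: ac_simps)
  then show ?thesis by (rule modulus_coprime)
qed

lemma divides_bounded: "\<zero> \<lhd> a \<Longrightarrow> divides a b \<longleftrightarrow> (\<exists>q. q \<unlhd> b \<and> b = a \<otimes> q)"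
proof -
  assume "\<zero> \<lhd> a"
  then have "\<one> \<unlhd> a" using succ_le[of \<zero> a] by simp
  then have "q \<unlhd> a \<otimes> q" for q using N.mult_right_mono[of \<one> a q] by simp
  then show ?thesis unfolding divides_def by blast
qed

lemma fn_modulus0: "sigma_fn (\<lambda>e. modulus (e 0) (e 1))"
  unfolding modulus_def by (intro fn_intros)

lemmas fn_modulus = fn_comp2[OF fn_modulus0]

lemma delta_divides0: "delta_pred (\<lambda>e. divides (e 0) (e 1))"
proof -
  have "divides a b \<longleftrightarrow> (\<exists>q. q \<unlhd> b \<and> b = a \<otimes> q)" for a b
    using divides_bounded[of a b] zero_le[of a] unfolding le_def by (auto simp: divides_def)
  then show ?thesis by (simp only:) (intro delta_ex_le delta_intros fn_intros)
qed

lemmas delta_divides = delta_comp2[OF delta_divides0]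

text \<open>Takes the place of a factorial, whose definition would need recursion and hence the
  coding that is being built here.\<close>

lemma ex_common_multiple: "\<exists>m. m \<noteq> \<zero> \<and> (\<forall>d. d \<lhd> k \<longrightarrow> \<zero> \<lhd> d \<longrightarrow> divides d m)"
proof (rule sigma_induct[where n = k])
  show "sigma_pred (\<lambda>e. \<exists>m. m \<noteq> \<zero> \<and> (\<forall>d. d \<lhd> e 0 \<longrightarrow> \<zero> \<lhd> d \<longrightarrow> divides d m))"
    by (intro sigma_ex delta_sigma delta_intros delta_divides fn_intros)
  show "\<exists>m. m \<noteq> \<zero> \<and> (\<forall>d. d \<lhd> \<zero> \<longrightarrow> \<zero> \<lhd> d \<longrightarrow> divides d m)"
    by (rule exI[of _ \<one>]) (simp add: not_less_zero)
next
  fix k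
  assume "\<exists>m. m \<noteq> \<zero> \<and> (\<forall>d. d \<lhd> k \<longrightarrow> \<zero> \<lhd> d \<longrightarrow> divides d m)"
  then obtain m where m: "m \<noteq> \<zero>" "\<And>d. d \<lhd> k \<Longrightarrow> \<zero> \<lhd> d \<Longrightarrow> divides d m" by blast
  show "\<exists>m. m \<noteq> \<zero> \<and> (\<forall>d. d \<lhd> k \<oplus> \<one> \<longrightarrow> \<zero> \<lhd> d \<longrightarrow> divides d m)"
  \<comment> \<open>Multiplying by \<open>k\<close> would destroy \<open>m \<noteq> \<zero>\<close>
    if \<open>k\<close> were zero; in that case there is no new divisor to treat.\<close>
  proof (cases "k = \<zero>")
    case True
    show ?thesis unfolding True less_succ using m(1) by (auto simp: not_less_zero)
  next
    case False
    have "divides k (m \<otimes> k)" unfolding divides_def by (auto simp: ac_simps)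
    then show ?thesis
      using m False by (intro exI[of _ "m \<otimes> k"]) (auto simp: less_succ divides_mult)
  qed
qed

lemma elems_pair: "elems M (pair M k (pair M m n)) = {i. i \<lhd> k \<and> divides (modulus m i) n}"
  unfolding elems_def divides_def modulus_def by auto

lemma elems_less: "i \<in> elems M c \<Longrightarrow> i \<lhd> c"
  unfolding elems_def by (auto intro: N.less_le_trans)

lemma pair_elems_less: "pair M i j \<in> elems M c \<Longrightarrow> i \<lhd> c" "pair M i j \<in> elems M c \<Longrightarrow> j \<lhd> c"
  using elems_less N.le_less_trans pair_bounds by blast+

text \<open>At stage \<open>j\<close> the number \<open>n\<close> is the product of the moduli of
  the elements of \<open>A\<close> below both \<open>j\<close> and \<open>k\<close>; by coprimality,
  multiplying by \<open>modulus m j\<close> affects membership of \<open>j\<close> only.\<close>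

lemma ex_finite_code:
  assumes A: "delta_pred (\<lambda>e. e 0 \<in> A)"
  shows "\<exists>c. is_triple M c \<and> elems M c = {i. i \<lhd> k \<and> i \<in> A}"
proof -
  obtain m where m: "m \<noteq> \<zero>" "\<And>d. d \<lhd> k \<Longrightarrow> \<zero> \<lhd> d \<Longrightarrow> divides d m"
    using ex_common_multiple by blast
  have "\<exists>n. \<forall>i. i \<lhd> k \<longrightarrow> (divides (modulus m i) n \<longleftrightarrow> i \<lhd> j \<and> i \<in> A)" for j
  proof (rule sigma_induct[where n = j])
    show "sigma_pred (\<lambda>e. \<exists>n. \<forall>i. i \<lhd> k \<longrightarrow> (divides (modulus m i) n \<longleftrightarrow> i \<lhd> e 0 \<and> i \<in> A))"
      by (intro sigma_ex delta_sigma delta_intros delta_divides delta_comp1[OF A]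
          fn_intros fn_modulus)
    \<comment> \<open>The product starts as \<open>\<one>\<close>; \<open>m \<noteq> \<zero>\<close>
      makes every modulus larger, so no index is a member yet.\<close>
    have "\<not> divides (modulus m i) \<one>" for i
    proof
      assume "divides (modulus m i) \<one>"
      then obtain q where q: "\<one> = modulus m i \<otimes> q" unfolding divides_def by blast
      then have "q \<noteq> \<zero>" by auto
      then have "\<one> \<unlhd> q" using succ_le[of \<zero> q] zero_le[of q] by (auto simp: le_def)
      then have "modulus m i \<otimes> \<one> \<unlhd> modulus m i \<otimes> q" by (rule N.mult_left_mono) simp
      then have "modulus m i \<unlhd> \<one>" unfolding q[symmetric] mul_one .
      moreover have "m \<unlhd> m \<otimes> (i \<oplus> \<one>)" by (simp add: mul_add)
      moreover have "\<zero> \<lhd> m" using m(1) zero_le[of m] by (auto simp: le_def)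
      ultimately show False
        using N.add_less_cancel_right[of \<zero> \<one> "m \<otimes> (i \<oplus> \<one>)"] unfolding modulus_def
        by (metis N.add_0_left N.less_le_trans N.not_le N.add.commute N.add_strict_right_mono)
    qed
    then show "\<exists>n. \<forall>i. i \<lhd> k \<longrightarrow> (divides (modulus m i) n \<longleftrightarrow> i \<lhd> \<zero> \<and> i \<in> A)"
      by (auto simp: not_less_zero)
  next
    fix j
    assume "\<exists>n. \<forall>i. i \<lhd> k \<longrightarrow> (divides (modulus m i) n \<longleftrightarrow> i \<lhd> j \<and> i \<in> A)"
    then obtain n where n: "\<And>i. i \<lhd> k \<Longrightarrow> (divides (modulus m i) n \<longleftrightarrow> i \<lhd> j \<and> i \<in> A)" by blast
    show "\<exists>n. \<forall>i. i \<lhd> k \<longrightarrow> (divides (modulus m i) n \<longleftrightarrow> i \<lhd> j \<oplus> \<one> \<and> i \<in> A)"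
    proof (cases "j \<lhd> k \<and> j \<in> A")
      case True
      have "divides (modulus m i) (n \<otimes> modulus m j) \<longleftrightarrow> i \<lhd> j \<oplus> \<one> \<and> i \<in> A" if i: "i \<lhd> k" for i
      proof (cases "i = j")
        case True
        then show ?thesis using \<open>j \<lhd> k \<and> j \<in> A\<close> unfolding divides_def less_succ
            by (auto simp: ac_simps)
      next
        case False
        have "divides (modulus m i) (n \<otimes> modulus m j) \<longleftrightarrow> divides (modulus m i) n"
          using modulus_divides_cancel[OF i _ False, of m n] True m(2) divides_mult by blast
        then show ?thesis using n[OF i] False by (simp add: less_succ)
      qed
      then show ?thesis by blast
    next
      case False
      then show ?thesis using n by (intro exI[of _ n]) (auto simp: less_succ)
    qed
  qed
  from this[of k] obtain n where "\<And>i. i \<lhd> k \<Longrightarrow> (divides (modulus m i) n \<longleftrightarrow> i \<lhd> k \<and> i \<in> A)" by blast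
  then have "elems M (pair M k (pair M m n)) = {i. i \<lhd> k \<and> i \<in> A}"
    unfolding elems_pair by blast
  then show ?thesis unfolding is_triple_def by blast
qed

lemma delta_is_triple0: "delta_pred (\<lambda>e. is_triple M (e 0))"
proof -
  have "is_triple M c \<longleftrightarrow> (\<exists>k. k \<unlhd> c \<and> (\<exists>m. m \<unlhd> c \<and> (\<exists>n. n \<unlhd> c \<and> c = pair M k (pair M m n))))" for c
    unfolding is_triple_def using N.order_trans[OF pair_bounds(1) pair_bounds(2)]
      N.order_trans[OF pair_bounds(2) pair_bounds(2)] by auto
  then show ?thesis by (simp only:) (intro delta_ex_le delta_intros fn_intros fn_pair)
qed

lemma delta_elems0: "delta_pred (\<lambda>e. e 0 \<in> elems M (e 1))"
proof -
  have "i \<in> elems M c \<longleftrightarrow> (\<exists>k. k \<unlhd> c \<and> (\<exists>m. m \<unlhd> c \<and> (\<exists>n. n \<unlhd> c \<and> c = pair M k (pair M m n)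
      \<and> i \<lhd> k \<and> divides (modulus m i) n)))" for i c
    unfolding elems_def divides_def modulus_def using
        N.order_trans[OF pair_bounds(1) pair_bounds(2)]
      N.order_trans[OF pair_bounds(2) pair_bounds(2)] by auto
  then show ?thesis by (simp only:) (intro delta_ex_le delta_intros delta_divides
      fn_intros fn_pair fn_modulus)
qed

lemmas delta_is_triple = delta_comp1[OF delta_is_triple0] and delta_elems = delta_comp2[OF
    delta_elems0]

text \<open>Elements are smaller than their code, so comparing two element sets below
  \<open>c\<close> compares them entirely.\<close>

lemma delta_finite_code0: "delta_pred (\<lambda>e. finite_code M (e 0))"
proof -
  have "finite_code M c \<longleftrightarrow> is_triple M c \<and> (\<forall>d. d \<lhd> c \<longrightarrow> is_triple M d \<longrightarrow>
      \<not> (\<forall>i. i \<lhd> c \<longrightarrow> (i \<in> elems M d \<longleftrightarrow> i \<in> elems M c)))" for c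
    unfolding finite_code_def set_eq_iff using elems_less N.less_trans by blast
  then show ?thesis by (simp only:) (intro delta_intros delta_is_triple delta_elems fn_intros)
qed

lemmas delta_finite_code = delta_comp1[OF delta_finite_code0]

lemma finite_code_unique: "finite_code M c \<Longrightarrow> finite_code M d \<Longrightarrow> elems M c = elems M d \<Longrightarrow> c = d"
  using N.less_linear[of c d] unfolding finite_code_def by auto

lemma code_of_elems [simp]: "finite_code M c \<Longrightarrow> code_of M (elems M c) = c"
  unfolding code_of_def by (rule the_equality) (auto intro: finite_code_unique)

text \<open>Agreement of a code with \<open>B\<close> needs testing only below
  \<open>c \<oplus> k\<close>, which exceeds all elements of both sides. The property is then
  Delta-0-1 and has a least instance, as \<open>finite_code\<close> requires.\<close>

lemma code_of:
  assumes B: "delta_pred (\<lambda>e. e 0 \<in> B)" and bound: "\<forall>i \<in> B. i \<lhd> k"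
  shows "finite_code M (code_of M B)" "elems M (code_of M B) = B"
proof -
  let ?P = "\<lambda>c. is_triple M c \<and> (\<forall>i. i \<lhd> c \<oplus> k \<longrightarrow> (i \<in> elems M c \<longleftrightarrow> i \<in> B))"
  have P: "?P c \<longleftrightarrow> is_triple M c \<and> elems M c = B" for c
  proof -
    have "i \<lhd> c \<oplus> k" if "i \<in> elems M c \<or> i \<in> B" for i
      using that elems_less bound N.less_le_trans le_add by blast
    then show ?thesis by blast
  qed
  have "delta_pred (\<lambda>e. ?P (e 0))"
    by (intro delta_intros delta_is_triple delta_elems delta_comp1[OF B] fn_intros)
  moreover have "{i. i \<lhd> k \<and> i \<in> B} = B" using bound by blast
  with ex_finite_code[OF B, of k] obtain c where "?P c" unfolding P by auto
  ultimately have "\<exists>c. ?P c \<and> (\<forall>d. d \<lhd> c \<longrightarrow> \<not> ?P d)"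
    by (rule delta_least)
  then obtain c where c: "?P c" "\<And>d. d \<lhd> c \<Longrightarrow> \<not> ?P d" by blast
  then have "finite_code M c" "elems M c = B" unfolding P finite_code_def by auto
  then show "finite_code M (code_of M B)" "elems M (code_of M B) = B" by auto
qed

text \<open>The uniform version for a family \<open>B a\<close>: the bound must be a definable
  function \<open>F\<close> of the index for the graph of the code function to be Delta-0-1.\<close>

lemma fn_code_of:
  assumes B: "delta_pred (\<lambda>e. e 0 \<in> B (e 1))" and F: "sigma_fn (\<lambda>e. F (e 0))"
    and bound: "\<And>a i. i \<in> B a \<Longrightarrow> i \<lhd> F a"
  shows "sigma_fn (\<lambda>e. code_of M (B (e 0)))"
proof -
  have "c = code_of M (B a) \<longleftrightarrow> finite_code M c \<and> (\<forall>i. i \<lhd> c \<oplus> F a \<longrightarrow> (i \<in> elems M c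
      \<longleftrightarrow> i \<in> B a))" for c a
  proof -
    have i: "i \<lhd> c \<oplus> F a" if "i \<in> elems M c \<or> i \<in> B a" for i
      using that elems_less bound N.less_le_trans le_add by blast
    have "delta_pred (\<lambda>e. e 0 \<in> B a)"
      by (intro delta_comp2[OF B] fn_intros)
    note code = code_of[OF this ballI[OF bound]]
    have "c = code_of M (B a)" if "finite_code M c" "\<forall>i. i \<lhd> c \<oplus> F a \<longrightarrow> (i \<in> elems M c \<longleftrightarrow> i \<in> B a)"
    proof -
      have "elems M c = B a" using that(2) i by blast
      then show ?thesis using code_of_elems[OF that(1)] by simp
    qed
    with code show ?thesis by auto
  qed
  moreover have "delta_pred (\<lambda>e. finite_code M (e 0) \<and> (\<forall>i. i \<lhd> e 0 \<oplus> F (e 1) \<longrightarrow> (i \<in> elems M (e 0)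
      \<longleftrightarrow> i \<in> B (e 1))))"
    by (intro delta_intros delta_finite_code delta_elems delta_comp2[OF B] fn_intros fn_comp1[OF F])
  ultimately show ?thesis unfolding sigma_fn_def by (simp add: delta_pred_def)
qed

section \<open>Finite sequences: length, appending, removing and prefixing an entry\<close>

definition has_length :: "'a \<Rightarrow> 'a \<Rightarrow> bool" where
  "has_length s l \<longleftrightarrow> (\<forall>i. i \<lhd> l \<longleftrightarrow> (\<exists>j. pair M i j \<in> elems M s))"

lemma has_length_unique: "has_length s l \<Longrightarrow> has_length s k \<Longrightarrow> l = k"
  unfolding has_length_def using N.less_linear[of l k] N.less_irrefl by blast

lemma seq_has_length: "seq M s \<Longrightarrow> has_length s (seq_length M s)"
proof -
  assume "seq M s"
  then obtain l where "has_length s l" unfolding seq_def has_length_def by blast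
  then show ?thesis
    unfolding seq_length_def has_length_def[symmetric]
    using theI[of "has_length s" l] has_length_unique by blast
qed

lemma has_length_seq_length: "has_length s l \<Longrightarrow> seq_length M s = l"
  unfolding seq_length_def has_length_def[symmetric]
      by (rule the_equality) (auto intro: has_length_unique)

lemma seqI:
  assumes "finite_code M s" "\<And>z. z \<in> elems M s \<Longrightarrow> \<exists>i j. z = pair M i j"
    "\<And>i j k. pair M i j \<in> elems M s \<Longrightarrow> pair M i k \<in> elems M s \<Longrightarrow> j = k" "has_length s l"
  shows "seq M s"
  using assms unfolding seq_def has_length_def by blast

lemma
  assumes "seq M s"
  shows seq_finite_code: "finite_code M s"
    and seq_pairs: "\<And>z. z \<in> elems M s \<Longrightarrow> \<exists>i j. z = pair M i j"
    and seq_unique: "\<And>i j k. pair M i j \<in> elems M s \<Longrightarrow> pair M i k \<in> elems M s \<Longrightarrow> j = k"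
  using assms unfolding seq_def by blast+

lemma seq_subset:
  assumes "seq M s" "\<And>i j. pair M i j \<in> elems M s \<Longrightarrow> pair M i j \<in> A"
  shows "elems M s \<subseteq> A"
  using assms seq_pairs by blast

lemma seq_ext: "seq M s \<Longrightarrow> seq M t \<Longrightarrow> elems M s = elems M t \<Longrightarrow> s = t"
  by (simp add: finite_code_unique seq_finite_code)

lemma delta_has_length0: "delta_pred (\<lambda>e. has_length (e 0) (e 1))"
proof -
  have "has_length s l \<longleftrightarrow> l \<unlhd> s \<and> (\<forall>i. i \<lhd> s \<longrightarrow> (i \<lhd> l \<longleftrightarrow> (\<exists>j. j \<lhd> s
      \<and> pair M i j \<in> elems M s)))" for s l
  proof
    assume s: "has_length s l"
    then have "\<not> s \<lhd> l" using pair_elems_less(1) N.less_irrefl unfolding has_length_def by blast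
    with s show "l \<unlhd> s \<and> (\<forall>i. i \<lhd> s \<longrightarrow> (i \<lhd> l \<longleftrightarrow> (\<exists>j. j \<lhd> s \<and> pair M i j \<in> elems M s)))"
      using pair_elems_less(2) N.not_less unfolding has_length_def by blast
  next
    assume "l \<unlhd> s \<and> (\<forall>i. i \<lhd> s \<longrightarrow> (i \<lhd> l \<longleftrightarrow> (\<exists>j. j \<lhd> s \<and> pair M i j \<in> elems M s)))"
    then show "has_length s l"
      using pair_elems_less N.less_le_trans unfolding has_length_def by blast
  qed
  then show ?thesis by (simp only:) (intro delta_intros delta_elems fn_intros fn_pair)
qed

lemmas delta_has_length = delta_comp2[OF delta_has_length0]

lemma delta_seq0: "delta_pred (\<lambda>e. seq M (e 0))"
proof -
  have "seq M s \<longleftrightarrow> finite_code M s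
      \<and> (\<forall>z. z \<lhd> s \<longrightarrow> z \<in> elems M s \<longrightarrow> (\<exists>i. i \<unlhd> z \<and> (\<exists>j. j \<unlhd> z \<and> z = pair M i j)))
      \<and> (\<forall>i. i \<lhd> s \<longrightarrow> (\<forall>j. j \<lhd> s \<longrightarrow> (\<forall>k. k \<lhd> s \<longrightarrow>
          pair M i j \<in> elems M s \<and> pair M i k \<in> elems M s \<longrightarrow> j = k)))
      \<and> (\<exists>l. l \<unlhd> s \<and> has_length s l)" for s
  proof -
    have 1: "(\<forall>z \<in> elems M s. \<exists>i j. z = pair M i j) \<longleftrightarrow>
       (\<forall>z. z \<lhd> s \<longrightarrow> z \<in> elems M s \<longrightarrow> (\<exists>i. i \<unlhd> z \<and> (\<exists>j. j \<unlhd> z \<and> z = pair M i j)))"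
      using elems_less by (metis pair_bounds)
    have 2: "(\<forall>i j k. pair M i j \<in> elems M s \<and> pair M i k \<in> elems M s \<longrightarrow> j = k) \<longleftrightarrow>
      (\<forall>i. i \<lhd> s \<longrightarrow> (\<forall>j. j \<lhd> s \<longrightarrow> (\<forall>k. k \<lhd> s \<longrightarrow>
          pair M i j \<in> elems M s \<and> pair M i k \<in> elems M s \<longrightarrow> j = k)))"
      using pair_elems_less by blast
    have "\<not> s \<lhd> l" if "has_length s l" for l
      using that pair_elems_less(1) N.less_irrefl unfolding has_length_def by blast
    then have 3: "(\<exists>l. has_length s l) \<longleftrightarrow> (\<exists>l. l \<unlhd> s \<and> has_length s l)"
      using N.not_less by blast
    show ?thesis unfolding seq_def has_length_def[symmetric] 1 2 3 ..
  qed
  then show ?thesis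
    by (simp only:) (intro delta_ex_le delta_intros delta_elems delta_finite_code delta_has_length
        fn_intros fn_pair)
qed

lemmas delta_seq = delta_comp1[OF delta_seq0]

lemma delta_subset_elems0: "delta_pred (\<lambda>e. elems M (e 0) \<subseteq> elems M (e 1))"
proof -
  have "elems M s \<subseteq> elems M t \<longleftrightarrow> (\<forall>z. z \<lhd> s \<longrightarrow> z \<in> elems M s \<longrightarrow> z \<in> elems M t)" for s t
    using elems_less by blast
  then show ?thesis by (simp only:) (intro delta_intros delta_elems fn_intros)
qed

lemmas delta_subset_elems = delta_comp2[OF delta_subset_elems0]

lemma elems_empty_seq: "elems M (empty_seq M) = {}" and seq_empty_seq: "seq M (empty_seq M)"
proof -
  have "finite_code M (code_of M {})" "elems M (code_of M {}) = {}"
    by (rule code_of[where k = \<zero>]; simp add: delta_const)+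
  moreover from this have "has_length (code_of M {}) \<zero>"
    by (simp add: has_length_def not_less_zero)
  ultimately show "elems M (empty_seq M) = {}" "seq M (empty_seq M)"
    unfolding empty_seq_def by (auto intro: seqI)
qed

lemma seq_eq_empty_seq: "seq M s \<Longrightarrow> elems M s = {} \<Longrightarrow> s = empty_seq M"
  using seq_ext seq_empty_seq elems_empty_seq by simp

lemma seq_dom_less: "seq M s \<Longrightarrow> pair M i j \<in> elems M s \<Longrightarrow> i \<lhd> seq_length M s"
  using seq_has_length has_length_def by blast

lemma seq_ex_nth: "seq M s \<Longrightarrow> i \<lhd> seq_length M s \<Longrightarrow> \<exists>j. pair M i j \<in> elems M s"
  using seq_has_length has_length_def by blast

lemma nonempty_seq:
  assumes "seq M s" "s \<noteq> empty_seq M"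
  shows "\<exists>i. pair M \<zero> i \<in> elems M s"
proof -
  obtain z where "z \<in> elems M s" using seq_eq_empty_seq assms by blast
  then obtain i j where "pair M i j \<in> elems M s" using seq_pairs assms(1) by blast
  then have "i \<lhd> seq_length M s" using seq_dom_less assms(1) by blast
  then have "\<zero> \<lhd> seq_length M s" using N.le_less_trans zero_le by blast
  then show ?thesis using seq_ex_nth assms(1) by blast
qed

lemma nth_neq_empty: "pair M i j \<in> elems M s \<Longrightarrow> s \<noteq> empty_seq M"
  using elems_empty_seq by auto

lemma elems_snoc: "elems M (snoc M s n) = insert (pair M (seq_length M s) n) (elems M s)"
  and finite_code_snoc: "finite_code M (snoc M s n)"
proof -
  let ?B = "insert (pair M (seq_length M s) n) (elems M s)"
  have B: "delta_pred (\<lambda>e. e 0 \<in> ?B)"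
    unfolding insert_iff by (intro delta_intros delta_elems fn_intros)
  have "\<forall>i \<in> ?B. i \<lhd> s \<oplus> pair M (seq_length M s) n \<oplus> \<one>"
    using N.order_trans[OF N.less_imp_le[OF elems_less] le_add(1)] unfolding less_succ_le by auto
  from code_of[OF B this] show "finite_code M (snoc M s n)" "elems M (snoc M s n) = ?B"
    unfolding snoc_def .
qed

lemma has_length_snoc: "seq M s \<Longrightarrow> has_length (snoc M s n) (seq_length M s \<oplus> \<one>)"
  using seq_has_length[of s] unfolding has_length_def elems_snoc by (auto simp: less_succ)

lemma seq_snoc:
  assumes "seq M s" shows "seq M (snoc M s n)"
proof (rule seqI[OF finite_code_snoc _ _ has_length_snoc[OF assms]])
  show "\<exists>i j. z = pair M i j" if "z \<in> elems M (snoc M s n)" for z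
    using that seq_pairs[OF assms] by (auto simp: elems_snoc)
  show "j = k" if "pair M i j \<in> elems M (snoc M s n)" "pair M i k \<in> elems M (snoc M s n)" for i j k
    using that seq_unique[OF assms, of i j k] seq_dom_less[OF assms] N.less_irrefl
    by (auto simp: elems_snoc)
qed

text \<open>Used to strip the formula index, kept as first entry, from a node of the joint
  tree.\<close>

definition seq_tail :: "'a \<Rightarrow> 'a" where
  "seq_tail s = code_of M {z. \<exists>i j. z = pair M i j \<and> pair M (i \<oplus> \<one>) j \<in> elems M s}"

lemma delta_tail: "delta_pred (\<lambda>e. e 0 \<in> {z. \<exists>i j. z = pair M i j
    \<and> pair M (i \<oplus> \<one>) j \<in> elems M (e 1)})"
proof -
  have "z \<in> {z. \<exists>i j. z = pair M i j \<and> pair M (i \<oplus> \<one>) j \<in> elems M s}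
      \<longleftrightarrow> (\<exists>i. i \<unlhd> z \<and> (\<exists>j. j \<unlhd> z \<and> z = pair M i j \<and> pair M (i \<oplus> \<one>) j \<in> elems M s))" for z s
    by auto
  then show ?thesis by (simp only:) (intro delta_ex_le delta_intros delta_elems fn_intros fn_pair)
qed

lemma tail_less: "pair M (i \<oplus> \<one>) j \<in> elems M s \<Longrightarrow> pair M i j \<lhd> s"
  using elems_less[of "pair M (i \<oplus> \<one>) j" s] pair_mono[of i "i \<oplus> \<one>" j j] N.le_less_trans by auto

lemma fn_seq_tail0: "sigma_fn (\<lambda>e. seq_tail (e 0))"
  unfolding seq_tail_def using tail_less
  by (intro fn_code_of[OF delta_tail, where F = "\<lambda>s. s"] fn_intros) auto

lemmas fn_seq_tail = fn_comp1[OF fn_seq_tail0]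

lemma elems_seq_tail: "pair M i j \<in> elems M (seq_tail s) \<longleftrightarrow> pair M (i \<oplus> \<one>) j \<in> elems M s"
  and finite_code_seq_tail: "finite_code M (seq_tail s)"
  and seq_tail_pairs: "z \<in> elems M (seq_tail s) \<Longrightarrow> \<exists>i j. z = pair M i j"
proof -
  have "delta_pred (\<lambda>e. e 0 \<in> {z. \<exists>i j. z = pair M i j \<and> pair M (i \<oplus> \<one>) j \<in> elems M s})"
    using delta_comp2[OF delta_tail fn_var fn_const] .
  from code_of[OF this, of s] tail_less
  have *: "finite_code M (seq_tail s)"
    "elems M (seq_tail s) = {z. \<exists>i j. z = pair M i j \<and> pair M (i \<oplus> \<one>) j \<in> elems M s}"
    unfolding seq_tail_def by blast+
  then show "pair M i j \<in> elems M (seq_tail s) \<longleftrightarrow> pair M (i \<oplus> \<one>) j \<in> elems M s"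
    "finite_code M (seq_tail s)" "z \<in> elems M (seq_tail s) \<Longrightarrow> \<exists>i j. z = pair M i j"
    by auto
qed

lemma has_length_seq_tail: "has_length s (l \<oplus> \<one>) \<Longrightarrow> has_length (seq_tail s) l"
  unfolding has_length_def elems_seq_tail
  by (metis N.add_less_cancel_right)

lemma nonempty_length:
  assumes "seq M s" "s \<noteq> empty_seq M"
  obtains l where "seq_length M s = l \<oplus> \<one>"
  using nonempty_seq[OF assms] seq_dom_less[OF assms(1)] zero_or_succ not_less_zero by metis

lemma seq_seq_tail:
  assumes "seq M s" "s \<noteq> empty_seq M"
  shows "seq M (seq_tail s)"
proof -
  obtain l where "has_length s (l \<oplus> \<one>)"
    using nonempty_length[OF assms] seq_has_length[OF assms(1)] by metis
  then show ?thesis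
    using finite_code_seq_tail seq_tail_pairs has_length_seq_tail seq_unique[OF assms(1)] elems_seq_tail
    by (metis seqI)
qed

text \<open>Makes children in the joint tree correspond to children in the summand. An entry
  appended to the empty sequence would sit at position zero and be dropped, so \<open>s\<close> must
  be nonempty.\<close>

lemma seq_tail_snoc:
  assumes "seq M s" "s \<noteq> empty_seq M"
  shows "seq_tail (snoc M s n) = snoc M (seq_tail s) n"
proof (rule finite_code_unique[OF finite_code_seq_tail finite_code_snoc])
  obtain l where l: "seq_length M s = l \<oplus> \<one>" by (rule nonempty_length[OF assms])
  then have "seq_length M (seq_tail s) = l"
    using has_length_seq_tail has_length_seq_length seq_has_length[OF assms(1)] by metis
  then have "pair M i j \<in> elems M (seq_tail (snoc M s n))
      \<longleftrightarrow> pair M i j \<in> elems M (snoc M (seq_tail s) n)" for i j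
    by (auto simp: elems_seq_tail elems_snoc l)
  then show "elems M (seq_tail (snoc M s n)) = elems M (snoc M (seq_tail s) n)"
    using seq_tail_pairs[of _ "snoc M s n"] seq_tail_pairs[of _ s] unfolding elems_snoc[of
        "seq_tail s"] by blast
qed

lemma seq_tail_singleton: "seq_tail (snoc M (empty_seq M) i) = empty_seq M"
proof -
  have "seq_length M (empty_seq M) = \<zero>"
    by (rule has_length_seq_length) (simp add: has_length_def elems_empty_seq not_less_zero)
  then have "elems M (seq_tail (snoc M (empty_seq M) i)) = {}"
    using seq_tail_pairs elems_seq_tail by (fastforce simp: elems_snoc elems_empty_seq)
  then show ?thesis
    using finite_code_unique finite_code_seq_tail seq_finite_code[OF seq_empty_seq] elems_empty_seq by metis
qed

text \<open>Mere existence is enough: it serves to lift initial segments of a path through one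
  summand to the joint tree, where no definability is asked.\<close>

lemma ex_seq_cons:
  assumes "seq M s"
  obtains t where "seq M t" "seq_tail t = s" "pair M \<zero> i \<in> elems M t"
    "\<And>z. z \<in> elems M t \<Longrightarrow> z = pair M \<zero> i \<or> (\<exists>a b. z = pair M (a \<oplus> \<one>) b \<and> pair M a b \<in> elems M s)"
proof -
  let ?B = "{z. z = pair M \<zero> i \<or> (\<exists>a b. z = pair M (a \<oplus> \<one>) b \<and> pair M a b \<in> elems M s)}"
  have "?B = {z. z = pair M \<zero> i \<or> (\<exists>a. a \<lhd> s \<and> (\<exists>b. b \<lhd> s \<and> z = pair M (a \<oplus> \<one>) b
      \<and> pair M a b \<in> elems M s))}"
    using pair_elems_less by blast
  then have B: "delta_pred (\<lambda>e. e 0 \<in> ?B)"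
    by (simp only: mem_Collect_eq) (intro delta_intros delta_elems fn_intros fn_pair)
  have "\<forall>z \<in> ?B. z \<lhd> pair M \<zero> i \<oplus> pair M s s \<oplus> \<one>"
  proof -
    have "pair M (a \<oplus> \<one>) b \<unlhd> pair M s s" if "pair M a b \<in> elems M s" for a b
      using pair_elems_less[OF that] by (intro pair_mono) (simp_all add: succ_le N.less_imp_le)
    then show ?thesis
      using N.order_trans[OF _ le_add(2)] unfolding less_succ_le by auto
  qed
  note t = code_of[OF B this]
  define t where "t = code_of M ?B"
  have pairs: "pair M a b \<in> elems M t \<longleftrightarrow> (a = \<zero> \<and> b = i) \<or> (\<exists>c. a = c \<oplus> \<one>
      \<and> pair M c b \<in> elems M s)" for a b
    unfolding t_def t(2) by auto
  have "has_length t (seq_length M s \<oplus> \<one>)"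
    unfolding has_length_def
  proof
    fix a
    show "a \<lhd> seq_length M s \<oplus> \<one> \<longleftrightarrow> (\<exists>j. pair M a j \<in> elems M t)"
    proof (cases "a = \<zero>")
      case True
      then show ?thesis using pairs by (auto simp: less_succ_le)
    next
      case False
      then obtain c where "a = c \<oplus> \<one>" using zero_or_succ by blast
      moreover from this have "(\<exists>j. pair M a j \<in> elems M t) \<longleftrightarrow> (\<exists>j. pair M c j \<in> elems M s)"
        using pairs by auto
      ultimately show ?thesis using seq_has_length[OF assms] by (simp add: has_length_def)
    qed
  qed
  moreover have "\<exists>a b. z = pair M a b" if "z \<in> elems M t" for z
    using that unfolding t_def t(2) by blast
  ultimately have "seq M t"
    using t(1) seq_unique[OF assms] by (intro seqI) (auto simp: pairs t_def[symmetric])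
  moreover have "seq_tail t = s"
  proof (rule finite_code_unique[OF finite_code_seq_tail seq_finite_code[OF assms]])
    show "elems M (seq_tail t) = elems M s"
      using seq_tail_pairs[of _ t] seq_pairs[OF assms]
          by (auto simp: elems_seq_tail pairs) (metis elems_seq_tail pairs succ_inject succ_neq_zero)+
  qed
  moreover have "elems M t = ?B" unfolding t_def by (rule t(2))
  ultimately show thesis using that[of t] by blast
qed

section \<open>Recursion and paths through trees\<close>

lemma fun_on_ex1: "fun_on M A B f \<Longrightarrow> x \<in> A \<Longrightarrow> \<exists>!y. pair M x y \<in> f"
  by (simp add: fun_on_def)

lemma fun_on_pairD:
  assumes "fun_on M A B f" "pair M x y \<in> f"
  shows "x \<in> A" "y \<in> B"
proof -
  have "\<exists>x'\<in>A. \<exists>y'\<in>B. pair M x y = pair M x' y'"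
    using assms unfolding fun_on_def by blast
  then show "x \<in> A" "y \<in> B" by auto
qed

lemma app_eq: "fun_on M A B f \<Longrightarrow> pair M x y \<in> f \<Longrightarrow> app M f x = y"
  unfolding app_def by (rule the1_equality[OF fun_on_ex1[OF _ fun_on_pairD(1)]])

lemma pair_app: "fun_on M A B f \<Longrightarrow> x \<in> A \<Longrightarrow> pair M x (app M f x) \<in> f"
  unfolding app_def by (rule theI'[OF fun_on_ex1])

lemma fn_app0:
  assumes "fun_on M UNIV B f"
  shows "sigma_fn (\<lambda>e. app M f (e 0))"
proof -
  have "y = app M f x \<longleftrightarrow> pair M x y \<in> f" for x y
    using app_eq[OF assms] pair_app[OF assms] by auto
  moreover have "f \<in> Sets M" using assms by (simp add: fun_on_def)
  then have "sigma_pred (\<lambda>e. pair M (e 1) (e 0) \<in> f)"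
    by (intro delta_sigma delta_mem fn_pair fn_intros)
  ultimately show ?thesis by (simp add: sigma_fn_def)
qed

text \<open>\<open>S\<close> is functional but may be partial. The Sigma-0-1 invariant
  \<open>Q\<close> guarantees a next value, and is therefore carried through the induction together
  with the computation \<open>c\<close>.\<close>

lemma recursion:
  assumes S: "delta_pred (\<lambda>e. S (e 0) (e 1) (e 2))" and Q: "sigma_pred (\<lambda>e. Q (e 0))" "Q z"
    and functional: "\<And>n x y y'. S n x y \<Longrightarrow> S n x y' \<Longrightarrow> y = y'"
    and step: "\<And>n x. Q x \<Longrightarrow> \<exists>y. Q y \<and> S n x y"
  obtains F where "fun_on M UNIV UNIV F" "app M F \<zero> = z"
    "\<And>n. Q (app M F n)" "\<And>n. S n (app M F n) (app M F (n \<oplus> \<one>))"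
proof -
  \<comment> \<open>\<open>comp c\<close>: every pair in \<open>c\<close> is justified by its predecessor in \<open>c\<close>. Any two such finite sets agree
    wherever both are defined, so their union is the function sought.\<close>
  define just where "just c p \<longleftrightarrow> (p = pair M \<zero> z \<or> (\<exists>k. k \<lhd> c \<and> (\<exists>x. x \<lhd> c \<and> (\<exists>y. y \<lhd> c \<and>
      p = pair M (k \<oplus> \<one>) y \<and> pair M k x \<in> elems M c \<and> S k x y))))" for c p
  define comp where "comp c \<longleftrightarrow> (\<forall>p. p \<lhd> c \<longrightarrow> p \<in> elems M c \<longrightarrow> just c p)" for c
  have delta_comp0: "delta_pred (\<lambda>e. comp (e 0))"
    unfolding comp_def just_def by (intro delta_intros delta_elems delta_comp3[OF S]
        fn_intros fn_pair)
  note delta_comp = delta_comp1[OF delta_comp0]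
  have compD: "(k = \<zero> \<and> y = z) \<or> (\<exists>l x. k = l \<oplus> \<one> \<and> pair M l x \<in> elems M c \<and> S l x y)"
    if "comp c" "pair M k y \<in> elems M c" for c k y
  proof -
    have "just c (pair M k y)" using that elems_less unfolding comp_def by blast
    then show ?thesis unfolding just_def by auto
  qed
  have compI: "comp c"
    if "\<And>p. p \<in> elems M c \<Longrightarrow> p = pair M \<zero> z \<or> (\<exists>k x y. p = pair M (k \<oplus> \<one>) y
        \<and> pair M k x \<in> elems M c \<and> S k x y)" for c
    unfolding comp_def
  proof (intro allI impI)
    fix p assume p: "p \<in> elems M c"
    then consider "p = pair M \<zero> z" | k x y where "p = pair M (k \<oplus> \<one>) y" "pair M k x \<in> elems M c"
        "S k x y"
      using \<open>\<And>p. p \<in> elems M c \<Longrightarrow> _\<close> by blast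
    then show "just c p"
    proof cases
      case 2
      moreover have "k \<lhd> c" "x \<lhd> c" "y \<lhd> c" using 2 p pair_elems_less by blast+
      ultimately show ?thesis unfolding just_def by blast
    qed (simp add: just_def)
  qed
  have unique: "x = y" if "comp c" "comp d" "pair M k x \<in> elems M c"
      "pair M k y \<in> elems M d" for c d k x y
  proof -
    have "\<forall>x. x \<lhd> c \<longrightarrow> (\<forall>y. y \<lhd> d \<longrightarrow> pair M k x \<in> elems M c \<and> pair M k y \<in> elems M d \<longrightarrow> x = y)"
    proof (rule delta_induct[where n = k])
      show "delta_pred (\<lambda>e. \<forall>x. x \<lhd> c \<longrightarrow> (\<forall>y. y \<lhd> d \<longrightarrow>
          pair M (e 0) x \<in> elems M c \<and> pair M (e 0) y \<in> elems M d \<longrightarrow> x = y))"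
        by (intro delta_intros delta_elems fn_intros fn_pair)
      show "\<forall>x. x \<lhd> c \<longrightarrow> (\<forall>y. y \<lhd> d \<longrightarrow> pair M \<zero> x \<in> elems M c \<and> pair M \<zero> y \<in> elems M d \<longrightarrow> x = y)"
        using compD[OF that(1), of \<zero>] compD[OF that(2), of \<zero>] by auto
    next
      fix k
      assume IH: "\<forall>x. x \<lhd> c \<longrightarrow> (\<forall>y. y \<lhd> d \<longrightarrow> pair M k x \<in> elems M c \<and> pair M k y \<in> elems M d \<longrightarrow> x = y)"
      then have IH: "x = y" if "pair M k x \<in> elems M c" "pair M k y \<in> elems M d" for x y
        using that pair_elems_less(2) by blast
      have "x = y" if xy: "pair M (k \<oplus> \<one>) x \<in> elems M c" "pair M (k \<oplus> \<one>) y \<in> elems M d" for x y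
      proof -
        obtain u v where "pair M k u \<in> elems M c" "S k u x" "pair M k v \<in> elems M d" "S k v y"
          using compD[OF \<open>comp c\<close> xy(1)] compD[OF \<open>comp d\<close> xy(2)] by auto
        then show ?thesis using IH[of u v] functional[of k u x y] by blast
      qed
      then show "\<forall>x. x \<lhd> c \<longrightarrow> (\<forall>y. y \<lhd> d \<longrightarrow>
          pair M (k \<oplus> \<one>) x \<in> elems M c \<and> pair M (k \<oplus> \<one>) y \<in> elems M d \<longrightarrow> x = y)" by blast
    qed
    then show ?thesis using that pair_elems_less(2) by blast
  qed
  have ex: "\<exists>x c. comp c \<and> pair M n x \<in> elems M c \<and> Q x" for n
  proof (rule sigma_induct[where n = n])
    show "sigma_pred (\<lambda>e. \<exists>x c. comp c \<and> pair M (e 0) x \<in> elems M c \<and> Q x)"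
      by (intro sigma_intros delta_sigma[OF delta_comp] delta_sigma[OF
          delta_elems] sigma_comp1[OF Q(1)]
          fn_intros fn_pair)
    have "delta_pred (\<lambda>e. e 0 \<in> {pair M \<zero> z})"
      unfolding insert_iff empty_iff by (intro delta_intros delta_const fn_intros)
    moreover have "\<forall>i \<in> {pair M \<zero> z}. i \<lhd> pair M \<zero> z \<oplus> \<one>" by (simp add: less_succ_le)
    ultimately have c: "elems M (code_of M {pair M \<zero> z}) = {pair M \<zero> z}" by (rule code_of(2))
    then have "comp (code_of M {pair M \<zero> z})" by (intro compI) auto
    then show "\<exists>x c. comp c \<and> pair M \<zero> x \<in> elems M c \<and> Q x" using c Q(2) by blast
  next
    fix n
    assume "\<exists>x c. comp c \<and> pair M n x \<in> elems M c \<and> Q x"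
    then obtain x c where c: "comp c" "pair M n x \<in> elems M c" "Q x" by blast
    then obtain y where y: "Q y" "S n x y" using step by blast
    let ?B = "insert (pair M (n \<oplus> \<one>) y) (elems M c)"
    have B: "delta_pred (\<lambda>e. e 0 \<in> ?B)"
      unfolding insert_iff by (intro delta_intros delta_elems fn_intros)
    have "\<forall>i \<in> ?B. i \<lhd> (c \<oplus> pair M (n \<oplus> \<one>) y) \<oplus> \<one>"
      using N.order_trans[OF N.less_imp_le[OF elems_less] le_add(1)] unfolding less_succ_le by auto
    then have d: "elems M (code_of M ?B) = ?B" by (rule code_of(2)[OF B])
    have "comp (code_of M ?B)"
    proof (rule compI, unfold d)
      fix p
      assume "p \<in> ?B"
      then show "p = pair M \<zero> z \<or> (\<exists>k x y. p = pair M (k \<oplus> \<one>) y \<and> pair M k x \<in> ?B \<and> S k x y)"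
        using c(1) elems_less c(2) y(2) unfolding comp_def just_def by blast
    qed
    then show "\<exists>x c. comp c \<and> pair M (n \<oplus> \<one>) x \<in> elems M c \<and> Q x"
      using d y(1) by blast
  qed
  \<comment> \<open>The graph is Sigma-0-1 through the existence of a computation. Its complement is
    so too: that \<open>x\<close> is not the value at \<open>n\<close> is witnessed by a computation
    of another value.\<close>
  define P where "P p \<longleftrightarrow> (\<exists>n. n \<unlhd> p \<and> (\<exists>x. x \<unlhd> p \<and> p = pair M n x \<and> (\<exists>c. comp c
      \<and> pair M n x \<in> elems M c)))" for p
  define P' where "P' p \<longleftrightarrow> (\<forall>n. n \<lhd> p \<oplus> \<one> \<longrightarrow> (\<forall>x. x \<lhd> p \<oplus> \<one> \<longrightarrow> p \<noteq> pair M n x \<or>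
      (\<exists>y c. comp c \<and> pair M n y \<in> elems M c \<and> y \<noteq> x)))" for p
  have "\<not> P p \<longleftrightarrow> P' p" for p
    unfolding P_def P'_def less_succ_le using ex unique by blast
  then have eq: "(\<lambda>e. \<not> P (e 0)) = (\<lambda>e. P' (e 0))" by blast
  have "{p. P p} \<in> Sets M"
  proof (rule delta_comprehension, unfold eq)
    show "sigma_pred (\<lambda>e. P (e 0))" unfolding P_def
      by (intro sigma_intros delta_sigma[OF delta_comp] delta_sigma[OF delta_elems] delta_sigma[OF
          delta_le]
          delta_sigma[OF delta_eq] fn_intros fn_pair)
    show "sigma_pred (\<lambda>e. P' (e 0))" unfolding P'_def
      by (intro sigma_intros sigma_or delta_sigma[OF delta_comp] delta_sigma[OF delta_elems]
          delta_sigma[OF delta_not[OF delta_eq]] fn_intros fn_pair)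
  qed
  moreover have P_pair: "P (pair M n x) \<longleftrightarrow> (\<exists>c. comp c \<and> pair M n x \<in> elems M c)" for n x
    unfolding P_def by auto
  moreover have "\<exists>!y. P (pair M n y)" for n
  proof -
    obtain x c where "comp c" "pair M n x \<in> elems M c" using ex by blast
    then show ?thesis unfolding P_pair using unique by (intro ex1I[of _ x]) blast+
  qed
  ultimately have F: "fun_on M UNIV UNIV {p. P p}"
    unfolding fun_on_def using P_def by blast
  have app: "app M {p. P p} n = x" if "comp c" "pair M n x \<in> elems M c" for n x c
    by (rule app_eq[OF F]) (use that in \<open>auto simp: P_pair\<close>)
  have ex_app: "\<exists>c. comp c \<and> pair M n (app M {p. P p} n) \<in> elems M c \<and> Q (app M {p. P p} n)" for n
    using ex app by metis
  have "app M {p. P p} \<zero> = z"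
    using ex_app[of \<zero>] compD by fastforce
  moreover have "S n (app M {p. P p} n) (app M {p. P p} (n \<oplus> \<one>))" for n
    using ex_app[of "n \<oplus> \<one>"] compD[of _ "n \<oplus> \<one>"] app succ_inject by (metis succ_neq_zero)
  ultimately show thesis using that[OF F] ex_app by blast
qed

text \<open>Exposes a Delta-0-1 matrix, so that witnesses can be carried along as data and
  minimized.\<close>

lemma sigma_matrix3:
  assumes "sigma_pred (\<lambda>e. R (e 0) (e 1) (e 2))"
  obtains B where "\<And>n x y. R n x y \<longleftrightarrow> (\<exists>v. B v n x y)"
    "\<And>a b c d. delta_pred (\<lambda>e. B (e a) (e b) (e c) (e d))"
proof -
  obtain B where B: "(\<lambda>e. R (e 0) (e 1) (e 2)) = (\<lambda>e. \<exists>m. B m e)" "bounded_matrix B"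
    by (rule sigmaE[OF assms])
  define B' where "B' v n x y = B v (\<lambda>i. if i = 0 then n else if i = 1 then x else y)" for v n x y
  have 1: "R n x y \<longleftrightarrow> (\<exists>v. B' v n x y)" for n x y
    using B(1)[THEN fun_cong, of "\<lambda>i. if i = 0 then n else if i = 1 then x else y"]
        by (simp add: B'_def)
  have "delta_pred (\<lambda>e. B' (e a) (e b) (e c) (e d))" for a b c d
  proof -
    have "term_fn (\<lambda>e. if i = 0 then e b else if i = 1 then e c else e d)" for i :: nat
      by (cases "i = 0"; cases "i = 1") (simp_all add: term_var)
    from bounded_matrixD[OF B(2) term_var this] show ?thesis
      unfolding B'_def by (rule bounded_delta)
  qed
  with 1 show thesis by (rule that)
qed

text \<open>A least \<open>y\<close> with \<open>Q y\<close> and \<open>R n x y\<close> need not be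
  definable, since these conditions are only Sigma-0-1. Choosing instead the least pair of
  \<open>y\<close> and a witness \<open>v\<close> involves a Delta-0-1 condition, is functional, and
  so falls under \<open>recursion\<close>; the first components are the sequence sought.\<close>

theorem dependent_choice:
  assumes R: "sigma_pred (\<lambda>e. R (e 0) (e 1) (e 2))" and Q: "sigma_pred (\<lambda>e. Q (e 0))" "Q z"
    and step: "\<And>n x. Q x \<Longrightarrow> \<exists>y. Q y \<and> R n x y"
  obtains F where "fun_on M UNIV UNIV F" "app M F \<zero> = z"
    "\<And>n. Q (app M F n)" "\<And>n. R n (app M F n) (app M F (n \<oplus> \<one>))"
proof -
  have "sigma_pred (\<lambda>e. Q (e 2) \<and> R (e 0) (e 1) (e 2))"
    by (intro sigma_and R sigma_comp1[OF Q(1)] fn_intros)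
  then obtain B where B: "\<And>n x y. Q y \<and> R n x y \<longleftrightarrow> (\<exists>v. B v n x y)"
    and dB: "\<And>a b c d. delta_pred (\<lambda>e. B (e a) (e b) (e c) (e d))"
    by (rule sigma_matrix3) blast
  define G where "G n p q \<longleftrightarrow> (\<exists>x. x \<unlhd> p \<and> (\<exists>u. u \<unlhd> p \<and> (\<exists>y. y \<unlhd> q \<and> (\<exists>v. v \<unlhd> q \<and>
    p = pair M x u \<and> q = pair M y v \<and> B v n x y))))" for n p q
  have dG0: "delta_pred (\<lambda>e. G (e 0) (e 1) (e 2))"
    unfolding G_def by (intro delta_ex_le delta_intros dB fn_intros fn_pair)
  define S where "S n p q \<longleftrightarrow> G n p q \<and> (\<forall>r. r \<lhd> q \<longrightarrow> \<not> G n p r)" for n p q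
  have dS: "delta_pred (\<lambda>e. S (e 0) (e 1) (e 2))"
    unfolding S_def by (intro delta_intros delta_comp3[OF dG0] fn_intros)
  have G_pair: "G n (pair M x u) (pair M y v) \<longleftrightarrow> B v n x y" for n x u y v
    unfolding G_def by auto
  define Q' where "Q' p \<longleftrightarrow> (\<exists>x u. p = pair M x u \<and> Q x)" for p
  have dQ': "sigma_pred (\<lambda>e. Q' (e 0))" unfolding Q'_def
    by (intro sigma_intros delta_sigma[OF delta_eq] sigma_comp1[OF Q(1)] fn_intros fn_pair)
  have step': "\<exists>q. Q' q \<and> S n p q" if "Q' p" for n p
  proof -
    obtain x u where x: "p = pair M x u" "Q x" using \<open>Q' p\<close> unfolding Q'_def by blast
    obtain y where "Q y \<and> R n x y" using step x(2) by blast
    then obtain v where "G n p (pair M y v)" using x(1) B G_pair by blast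
    moreover have "delta_pred (\<lambda>e. G n p (e 0))"
      by (intro delta_comp3[OF dG0] fn_intros)
    ultimately obtain q where q: "S n p q"
      using delta_least[of "G n p"] unfolding S_def by blast
    then obtain y v where "q = pair M y v" "B v n x y"
      unfolding S_def G_def x by auto
    then show ?thesis using q B unfolding Q'_def by blast
  qed
  \<comment> \<open>The start has no predecessor to be justified by, so its witness component is an
    arbitrary filler, which \<open>S\<close> never inspects.\<close>
  have "Q' (pair M z \<zero>)" using Q(2) unfolding Q'_def by blast
  moreover have "q = q'" if "S n p q" "S n p q'" for n p q q'
    using that N.less_linear[of q q'] unfolding S_def by blast
  ultimately obtain F where F: "fun_on M UNIV UNIV F" "app M F \<zero> = pair M z \<zero>"
    "\<And>n. Q' (app M F n)" "\<And>n. S n (app M F n) (app M F (n \<oplus> \<one>))"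
    by (rule recursion[OF dS dQ']) (use step' in auto)
  \<comment> \<open>Projection to the first components, with all quantifiers bounded to keep it
    Delta-0-1.\<close>
  define H where "H = {p. \<exists>n. n \<unlhd> p \<and> (\<exists>y. y \<unlhd> p \<and> p = pair M n y \<and> (\<exists>v. v \<unlhd> app M F n
      \<and> app M F n = pair M y v))}"
  have "H \<in> Sets M" unfolding H_def
    by (intro delta_set delta_ex_le delta_intros fn_intros fn_pair fn_comp1[OF fn_app0[OF F(1)]])
  moreover have H: "pair M n y \<in> H \<longleftrightarrow> (\<exists>v. app M F n = pair M y v)" for n y
    unfolding H_def by auto
  ultimately have "fun_on M UNIV UNIV H"
    unfolding fun_on_def using F(3) unfolding Q'_def
        by (auto simp: H) (auto simp: H_def, metis pair_inject)
  moreover from app_eq[OF this] have app: "app M H n = y" if "app M F n = pair M y v" for n y v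
    using that H by blast
  have app': "\<exists>v. app M F n = pair M (app M H n) v" for n
    using F(3) app unfolding Q'_def by metis
  have "app M H \<zero> = z" using app F(2) by blast
  moreover have "Q (app M H n)" for n
    using F(3)[of n] app' app unfolding Q'_def by metis
  moreover have "R n (app M H n) (app M H (n \<oplus> \<one>))" for n
    using F(4)[of n] app'[of n] app'[of "n \<oplus> \<one>"] B G_pair unfolding S_def by metis
  ultimately show thesis by (rule that)
qed

text \<open>Common core of the generic point and of the path through a tree: requirement
  \<open>R n\<close> is met at stage \<open>n \<oplus> \<one>\<close>, and strict growth makes the
  union a total function.\<close>

theorem increasing_seqs_union:
  assumes R: "sigma_pred (\<lambda>e. R (e 0) (e 1))" and Q: "sigma_pred (\<lambda>e. Q (e 0))" "Q s"
    and Q_seq: "\<And>t. Q t \<Longrightarrow> seq M t"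
    and step: "\<And>n t. Q t \<Longrightarrow> \<exists>u. Q u \<and> elems M t \<subset> elems M u \<and> R n u"
  obtains h where "fun_on M UNIV UNIV h" "elems M s \<subseteq> h" "\<And>n. \<exists>t. R n t \<and> elems M t \<subseteq> h"
    "\<And>z. z \<in> h \<Longrightarrow> \<exists>t. Q t \<and> z \<in> elems M t"
    "\<And>t. seq M t \<Longrightarrow> elems M t \<subseteq> h \<Longrightarrow> \<exists>u. Q u \<and> elems M t \<subseteq> elems M u"
proof -
  have "sigma_pred (\<lambda>e. elems M (e 1) \<subseteq> elems M (e 2) \<and> \<not> elems M (e 2) \<subseteq> elems M (e 1)
      \<and> R (e 0) (e 2))"
    by (intro sigma_and delta_sigma[OF delta_subset_elems] delta_sigma[OF delta_not[OF
        delta_subset_elems]]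
        sigma_comp2[OF R] fn_intros)
  from dependent_choice[OF this Q] step obtain F where F: "fun_on M UNIV UNIV F" "app M F \<zero> = s"
    "\<And>n. Q (app M F n)" "\<And>n. elems M (app M F n) \<subseteq> elems M (app M F (n \<oplus> \<one>))"
    "\<And>n. \<not> elems M (app M F (n \<oplus> \<one>)) \<subseteq> elems M (app M F n)" "\<And>n. R n (app M F (n \<oplus> \<one>))"
    by (metis (no_types, lifting) psubset_eq subset_antisym)
  note fn_F = fn_comp1[OF fn_app0[OF F(1)]]
  have seq_F: "seq M (app M F n)" for n using F(3) Q_seq by blast
  have "elems M (app M F m) \<subseteq> elems M (app M F (m \<oplus> k))" for m k
    by (rule delta_induct[where n = k]; (intro delta_subset_elems fn_F fn_intros)?)
      (use F(4) in \<open>auto simp flip: add_assoc\<close>)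
  then have mono: "elems M (app M F m) \<subseteq> elems M (app M F n)" if "m \<unlhd> n" for m n
    using that unfolding le_iff by blast
  \<comment> \<open>Each stage adds a pair, which by uniqueness of values cannot sit at a position
    already filled. Hence the first \<open>n\<close> positions are filled at stage
    \<open>n\<close>.\<close>
  have length: "\<forall>i. i \<lhd> n \<longrightarrow> (\<exists>j. j \<lhd> app M F n \<and> pair M i j \<in> elems M (app M F n))" for n
  proof (rule delta_induct[where n = n])
    show "delta_pred (\<lambda>e. \<forall>i. i \<lhd> e 0 \<longrightarrow> (\<exists>j. j \<lhd> app M F (e 0)
        \<and> pair M i j \<in> elems M (app M F (e 0))))"
      by (intro delta_intros delta_elems fn_pair fn_F fn_intros)
  next
    fix n
    assume IH: "\<forall>i. i \<lhd> n \<longrightarrow> (\<exists>j. j \<lhd> app M F n \<and> pair M i j \<in> elems M (app M F n))"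
    obtain z where z: "z \<in> elems M (app M F (n \<oplus> \<one>))" "z \<notin> elems M (app M F n)" using F(5) by blast
    then obtain a b where ab: "z = pair M a b" using seq_pairs[OF seq_F] by blast
    have "\<not> a \<lhd> n"
    proof
      assume "a \<lhd> n"
      then obtain j where "pair M a j \<in> elems M (app M F n)" using IH by blast
      moreover from this have "j = b" using F(4) z(1) seq_unique[OF seq_F] unfolding ab by blast
      ultimately show False using z(2) ab by blast
    qed
    then have "n \<lhd> seq_length M (app M F (n \<oplus> \<one>))"
      using seq_dom_less[OF seq_F] z(1) N.le_less_trans N.not_less unfolding ab by blast
    then show "\<forall>i. i \<lhd> n \<oplus> \<one> \<longrightarrow> (\<exists>j. j \<lhd> app M F (n \<oplus> \<one>) \<and> pair M i j \<in> elems M (app M F (n \<oplus> \<one>)))"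
      using seq_ex_nth[OF seq_F] pair_elems_less(2) N.le_less_trans unfolding less_succ_le by blast
  qed (simp add: not_less_zero)
  \<comment> \<open>Position \<open>i\<close> is read at stage \<open>i \<oplus> \<one>\<close>,
    where it is already filled. This makes the union Delta-0-1, hence a set of the
    structure.\<close>
  define h where "h = {z. \<exists>i. i \<unlhd> z \<and> (\<exists>j. j \<unlhd> z \<and> z = pair M i j \<and> z \<in> elems M (app M F (i \<oplus> \<one>)))}"
  have h_pair: "pair M i j \<in> h \<longleftrightarrow> pair M i j \<in> elems M (app M F (i \<oplus> \<one>))" for i j
    unfolding h_def by auto
  have h: "elems M (app M F n) \<subseteq> h" for n
  proof (rule seq_subset[OF seq_F])
    fix i j assume ij: "pair M i j \<in> elems M (app M F n)"
    show "pair M i j \<in> h"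
    proof (cases "n \<unlhd> i \<oplus> \<one>")
      case True
      then show ?thesis using ij mono h_pair by blast
    next
      case False
      then have "i \<oplus> \<one> \<unlhd> n" using le_linear by blast
      moreover obtain k where "pair M i k \<in> elems M (app M F (i \<oplus> \<one>))"
        using length[of "i \<oplus> \<one>"] by (auto simp: less_succ)
      ultimately show ?thesis using ij mono seq_unique[OF seq_F] h_pair by blast
    qed
  qed
  have "h \<in> Sets M" unfolding h_def
    by (intro delta_set delta_ex_le delta_intros delta_elems fn_pair fn_F fn_intros)
  moreover have "\<exists>!j. pair M i j \<in> h" for i
    using length[of "i \<oplus> \<one>"] seq_unique[OF seq_F] unfolding h_pair less_succ by blast
  ultimately have "fun_on M UNIV UNIV h"
    unfolding fun_on_def by (auto simp: h_def)
  moreover have "elems M s \<subseteq> h" using h F(2) by metis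
  moreover have "\<exists>t. R n t \<and> elems M t \<subseteq> h" for n using F(6) h by blast
  moreover have "\<exists>t. Q t \<and> z \<in> elems M t" if "z \<in> h" for z
    using that F(3) unfolding h_def by blast
  moreover have "\<exists>u. Q u \<and> elems M t \<subseteq> elems M u" if t: "seq M t" "elems M t \<subseteq> h" for t
  proof -
    have "elems M t \<subseteq> elems M (app M F (seq_length M t))"
    proof (rule seq_subset[OF t(1)])
      fix i j assume ij: "pair M i j \<in> elems M t"
      then have "i \<oplus> \<one> \<unlhd> seq_length M t" using seq_dom_less[OF t(1)] succ_le by blast
      then show "pair M i j \<in> elems M (app M F (seq_length M t))"
        using ij t(2) h_pair mono by blast
    qed
    then show ?thesis using F(3) by blast
  qed
  ultimately show thesis by (rule that)
qed

section \<open>Induction along well-founded trees and uniqueness of evaluation maps\<close>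

lemma elems_psubset_snoc: "seq M s \<Longrightarrow> elems M s \<subset> elems M (snoc M s n)"
  using seq_dom_less[of s "seq_length M s" n] N.less_irrefl by (auto simp: elems_snoc)

lemma wf_treeD:
  assumes "wf_tree M T"
  shows "T \<in> Sets M" "\<And>s. s \<in> T \<Longrightarrow> seq M s" "empty_seq M \<in> T"
    "\<And>s t. s \<in> T \<Longrightarrow> seq M t \<Longrightarrow> elems M t \<subseteq> elems M s \<Longrightarrow> t \<in> T"
    "\<And>f. fun_on M UNIV UNIV f \<Longrightarrow> (\<And>t. seq M t \<Longrightarrow> elems M t \<subseteq> f \<Longrightarrow> t \<in> T) \<Longrightarrow> False"
  using assms unfolding wf_tree_def by blast+

text \<open>A node where \<open>P\<close> fails has a child where \<open>P\<close> fails. Choosing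
  such children again and again yields a path through \<open>T\<close>; the choice is available
  because failure is Sigma-0-1. Well-foundedness only excludes paths that are sets of the structure,
  so the path must be built inside it.\<close>

theorem wf_tree_induct:
  assumes T: "wf_tree M T" and P: "sigma_pred (\<lambda>e. \<not> P (e 0))"
    and step: "\<And>s. s \<in> T \<Longrightarrow> (\<And>n. snoc M s n \<in> T \<Longrightarrow> P (snoc M s n)) \<Longrightarrow> P s"
    and s: "s \<in> T"
  shows "P s"
proof (rule ccontr)
  assume "\<not> P s"
  with s have Qs: "s \<in> T \<and> \<not> P s" by blast
  have Q: "sigma_pred (\<lambda>e. e 0 \<in> T \<and> \<not> P (e 0))"
    by (intro sigma_and P delta_sigma[OF delta_mem0] wf_treeD(1)[OF T])
  have ex: "\<exists>u. (u \<in> T \<and> \<not> P u) \<and> elems M t \<subset> elems M u \<and> True" if "t \<in> T \<and> \<not> P t" for n :: 'a and t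
  proof -
    obtain k where "snoc M t k \<in> T \<and> \<not> P (snoc M t k)" using \<open>t \<in> T \<and> \<not> P t\<close> step by blast
    moreover have "elems M t \<subset> elems M (snoc M t k)"
      using that wf_treeD(2)[OF T] by (intro elems_psubset_snoc) blast
    ultimately show ?thesis by blast
  qed
  obtain h where "fun_on M UNIV UNIV h"
    "\<And>t. seq M t \<Longrightarrow> elems M t \<subseteq> h \<Longrightarrow> \<exists>u. (u \<in> T \<and> \<not> P u) \<and> elems M t \<subseteq> elems M u"
    by (rule increasing_seqs_union[where R = "\<lambda>_ _. True", OF delta_sigma[OF
        delta_const] Q Qs _ ex])
      (use wf_treeD(2)[OF T] in auto)
  then show False using wf_treeD(4,5)[OF T] by metis
qed

lemma leaf_or_interior: "s \<in> T \<Longrightarrow> leaf M T s \<or> interior_node M T s"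
  by (auto simp: leaf_def interior_node_def)

text \<open>Replaces \<open>app\<close>, unspecified outside \<open>T\<close>, by membership in a
  set, which is visibly Delta-0-1.\<close>

lemma app_eq_one:
  assumes "fun_on M T {\<zero>, \<one>} f" "s \<in> T"
  shows "app M f s = \<one> \<longleftrightarrow> pair M s \<one> \<in> f"
proof
  show "app M f s = \<one> \<Longrightarrow> pair M s \<one> \<in> f" using pair_app[OF assms] by simp
qed (rule app_eq[OF assms(1)])

text \<open>The flag \<open>b\<close> treats agreement (\<open>True\<close>) and opposition
  (\<open>False\<close>) of two maps in one induction.\<close>

lemma evaluations_agree:
  assumes T: "wf_tree M T" and f: "fun_on M T {\<zero>, \<one>} f" and g: "fun_on M T {\<zero>, \<one>} g"
    and step: "\<And>s. s \<in> T \<Longrightarrow>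
      (\<And>n. snoc M s n \<in> T \<Longrightarrow> app M f (snoc M s n) = \<one> \<longleftrightarrow> (app M g (snoc M s n) = \<one>) = b) \<Longrightarrow>
      app M f s = \<one> \<longleftrightarrow> (app M g s = \<one>) = b"
    and s: "s \<in> T"
  shows "app M f s = \<one> \<longleftrightarrow> (app M g s = \<one>) = b"
proof -
  have "pair M s \<one> \<in> f \<longleftrightarrow> (pair M s \<one> \<in> g) = b"
  proof (rule wf_tree_induct[OF T _ _ s])
    have "f \<in> Sets M" "g \<in> Sets M" using f g by (auto simp: fun_on_def)
    then show "sigma_pred (\<lambda>e. \<not> (pair M (e 0) \<one> \<in> f \<longleftrightarrow> (pair M (e 0) \<one> \<in> g) = b))"
      by (intro delta_sigma delta_not delta_iff delta_mem delta_const fn_pair fn_intros)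
  qed (use step app_eq_one[OF f] app_eq_one[OF g] in metis)
  then show ?thesis using app_eq_one[OF f s] app_eq_one[OF g s] by simp
qed

lemma labeled_tree_cases:
  assumes "labeled_tree M A T L" "s \<in> T"
  obtains a where "leaf M T s" "a \<in> A" "app M L s = leaf_label M a"
  | "interior_node M T s" "app M L s = union_label M"
  | "interior_node M T s" "app M L s = inter_label M"
  using assms leaf_or_interior[of s T] unfolding labeled_tree_def by blast

lemma evaluation_mapD:
  assumes "evaluation_map M P T L f"
  shows "fun_on M T {\<zero>, \<one>} f"
    "\<And>s a. leaf M T s \<Longrightarrow> app M L s = leaf_label M a \<Longrightarrow> app M f s = \<one> \<longleftrightarrow> P a"
    "\<And>s. interior_node M T s \<Longrightarrow> app M L s = union_label M \<Longrightarrow>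
      app M f s = \<one> \<longleftrightarrow> (\<exists>n. snoc M s n \<in> T \<and> app M f (snoc M s n) = \<one>)"
    "\<And>s. interior_node M T s \<Longrightarrow> app M L s = inter_label M \<Longrightarrow>
      app M f s = \<one> \<longleftrightarrow> (\<forall>n. snoc M s n \<in> T \<longrightarrow> app M f (snoc M s n) = \<one>)"
  using assms unfolding evaluation_map_def by blast+

lemma evaluation_map_unique:
  assumes T: "labeled_tree M A T L" and f: "evaluation_map M P T L f" and g:
      "evaluation_map M P T L g"
    and s: "s \<in> T"
  shows "app M f s = \<one> \<longleftrightarrow> app M g s = \<one>"
proof -
  have "wf_tree M T" using T by (simp add: labeled_tree_def)
  then have "app M f s = \<one> \<longleftrightarrow> (app M g s = \<one>) = True"
  proof (rule evaluations_agree[OF _ evaluation_mapD(1)[OF f] evaluation_mapD(1)[OF g] _ s])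
    fix s assume "s \<in> T"
      and IH: "\<And>n. snoc M s n \<in> T \<Longrightarrow> app M f (snoc M s n) = \<one> \<longleftrightarrow> (app M g (snoc M s n) = \<one>) = True"
    from T this(1) show "app M f s = \<one> \<longleftrightarrow> (app M g s = \<one>) = True"
    proof (cases rule: labeled_tree_cases)
      case 1
      then show ?thesis using evaluation_mapD(2)[OF f] evaluation_mapD(2)[OF g] by simp
    next
      case 2
      then show ?thesis using evaluation_mapD(3)[OF f] evaluation_mapD(3)[OF g] IH by auto
    next
      case 3
      then show ?thesis using evaluation_mapD(4)[OF f] evaluation_mapD(4)[OF g] IH by auto
    qed
  qed
  then show ?thesis by simp
qed

text \<open>Membership in the complement provides a map for the swapped labeling only. By De Morgan
  along the tree it takes the opposite values of a map for \<open>L\<close>.\<close>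

lemma complement_evaluation:
  assumes T: "borel_code M T L" and L': "complement_labeling M T L L'"
    and X: "X \<in> cantor_space M" and f: "borel_evaluation M X T L f" and g:
        "borel_evaluation M X T L' g"
    and s: "s \<in> T"
  shows "app M f s = \<one> \<longleftrightarrow> app M g s \<noteq> \<one>"
proof -
  note f = f[unfolded borel_evaluation_def] and g = g[unfolded borel_evaluation_def]
  have T: "labeled_tree M {c. clopen_code M c} T L" using T by (simp add: borel_code_def)
  then have "wf_tree M T" by (simp add: labeled_tree_def)
  then have "app M f s = \<one> \<longleftrightarrow> (app M g s = \<one>) = False"
  proof (rule evaluations_agree[OF _ evaluation_mapD(1)[OF f] evaluation_mapD(1)[OF g] _ s])
    fix s assume s: "s \<in> T"
      and IH: "\<And>n. snoc M s n \<in> T \<Longrightarrow> app M f (snoc M s n) = \<one> \<longleftrightarrow> (app M g (snoc M s n) = \<one>) = False"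
    note L' = L'[unfolded complement_labeling_def, THEN conjunct2, rule_format, OF s]
    from T s show "app M f s = \<one> \<longleftrightarrow> (app M g s = \<one>) = False"
    proof (cases rule: labeled_tree_cases)
      case (1 c)
      then obtain d where "app M L' s = leaf_label M d" "in_clopen M X d \<longleftrightarrow> \<not> in_clopen M X c"
        using L' X by blast
      with 1 show ?thesis using evaluation_mapD(2)[OF f] evaluation_mapD(2)[OF g] by simp
    next
      case 2
      then have "app M L' s = inter_label M" using L' by blast
      with 2 show ?thesis using evaluation_mapD(3)[OF f] evaluation_mapD(4)[OF g] IH by auto
    next
      case 3
      then have "app M L' s = union_label M" using L' by blast
      with 3 show ?thesis using evaluation_mapD(4)[OF f] evaluation_mapD(3)[OF g] IH by auto
    qed
  qed
  then show ?thesis by simp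
qed

section \<open>The Baire category theorem\<close>

text \<open>Domains are initial segments of the numbers, so agreement on common positions puts the
  shorter sequence inside the longer.\<close>

lemma seqs_comparable:
  assumes s: "seq M s" and t: "seq M t"
    and eq: "\<And>i a b. pair M i a \<in> elems M s \<Longrightarrow> pair M i b \<in> elems M t \<Longrightarrow> a = b"
  shows "elems M s \<subseteq> elems M t \<or> elems M t \<subseteq> elems M s"
proof -
  have "elems M s \<subseteq> elems M t" if "seq_length M s \<unlhd> seq_length M t"
  proof (rule seq_subset[OF s])
    fix i j assume ij: "pair M i j \<in> elems M s"
    then have "i \<lhd> seq_length M t" using that seq_dom_less[OF s] N.less_le_trans by blast
    then show "pair M i j \<in> elems M t" using seq_ex_nth[OF t] eq ij by blast
  qed
  moreover have "elems M t \<subseteq> elems M s" if "seq_length M t \<unlhd> seq_length M s"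
  proof (rule seq_subset[OF t])
    fix i j assume ij: "pair M i j \<in> elems M t"
    then have "i \<lhd> seq_length M s" using that seq_dom_less[OF t] N.less_le_trans by blast
    then show "pair M i j \<in> elems M s" using seq_ex_nth[OF s] eq ij by blast
  qed
  ultimately show ?thesis using le_linear by blast
qed

lemma fun_on_unique: "fun_on M A B f \<Longrightarrow> pair M i a \<in> f \<Longrightarrow> pair M i b \<in> f \<Longrightarrow> a = b"
  using app_eq by blast

lemma delta_binary_string0: "delta_pred (\<lambda>e. binary_string M (e 0))"
proof -
  have "binary_string M p \<longleftrightarrow> seq M p \<and>
    (\<forall>i. i \<lhd> p \<longrightarrow> (\<forall>j. j \<lhd> p \<longrightarrow> pair M i j \<in> elems M p \<longrightarrow> j = \<zero> \<or> j = \<one>))" for p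
    unfolding binary_string_def using pair_elems_less by blast
  then show ?thesis by (simp only:) (intro delta_intros delta_seq delta_elems fn_pair fn_intros)
qed

lemma binary_string_snoc: "binary_string M p \<Longrightarrow> j = \<zero> \<or> j = \<one> \<Longrightarrow> binary_string M (snoc M p j)"
  unfolding binary_string_def by (auto simp: seq_snoc elems_snoc)

text \<open>Needed inside the structure, whose points are only those in \<open>Sets M\<close>.
  Requirement \<open>n\<close> asks for an extension of some string in the \<open>n\<close>-th dense
  set, a Sigma-0-1 condition.\<close>

theorem baire_category:
  assumes D: "D \<in> Sets M" "\<And>n. open_code M (nth_set M D n)" "\<And>n. dense_open M (nth_set M D n)"
    and p: "binary_string M p"
  shows "\<exists>X \<in> cantor_space M. elems M p \<subseteq> X \<and> (\<forall>n. in_open M X (nth_set M D n))"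
proof -
  define R where "R n t \<longleftrightarrow> (\<exists>q. pair M q n \<in> D \<and> elems M q \<subseteq> elems M t)" for n t
  have R: "sigma_pred (\<lambda>e. R (e 0) (e 1))" unfolding R_def
    by (intro sigma_intros delta_sigma[OF delta_mem[OF D(1)]] delta_sigma[OF
        delta_subset_elems] fn_pair fn_intros)
  have step: "\<exists>u. binary_string M u \<and> elems M t \<subset> elems M u \<and> R n u" if t:
      "binary_string M t" for n t
  proof -
    obtain X q where X: "X \<in> cantor_space M" "elems M t \<subseteq> X" "q \<in> nth_set M D n" "elems M q \<subseteq> X"
      using D(3)[of n] t unfolding dense_open_def in_open_def by blast
    have q: "binary_string M q" using D(2)[of n] X(3) unfolding open_code_def by blast
    \<comment> \<open>Density provides a point, not a string. Both \<open>t\<close> and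
      \<open>q\<close> are initial segments of it, so the longer one extends both.\<close>
    have "elems M t \<subseteq> elems M q \<or> elems M q \<subseteq> elems M t"
      using t q X(1,2,4) fun_on_unique unfolding binary_string_def cantor_space_def
      by (intro seqs_comparable) blast+
    then obtain r where r: "binary_string M r" "elems M t \<subseteq> elems M r" "elems M q \<subseteq> elems M r"
      using t q by blast
    \<comment> \<open>A further digit makes the extension proper even if \<open>r\<close> equals
      \<open>t\<close>.\<close>
    moreover have "elems M r \<subset> elems M (snoc M r \<zero>)"
      using r(1) elems_psubset_snoc unfolding binary_string_def by blast
    ultimately show ?thesis
      using binary_string_snoc[OF r(1)] X(3) unfolding R_def nth_set_def by blast
  qed
  obtain h where h: "fun_on M UNIV UNIV h" "elems M p \<subseteq> h" "\<And>n. \<exists>t. R n t \<and> elems M t \<subseteq> h"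
    "\<And>z. z \<in> h \<Longrightarrow> \<exists>t. binary_string M t \<and> z \<in> elems M t"
    by (rule increasing_seqs_union[OF R delta_sigma[OF delta_binary_string0] p])
      (use step in \<open>auto simp: binary_string_def\<close>)
  have "j = \<zero> \<or> j = \<one>" if "pair M i j \<in> h" for i j
    using h(4)[OF that] unfolding binary_string_def by blast
  then have "h \<in> cantor_space M"
    using h(1) unfolding cantor_space_def fun_on_def by fast
  moreover have "in_open M h (nth_set M D n)" for n
    using h(3)[of n] unfolding R_def in_open_def nth_set_def by blast
  ultimately show ?thesis using h(2) by blast
qed

section \<open>The Borel code of a sequence of formulas\<close>

text \<open>\<open>marker i\<close> is the string \<open>0\<^sup>i 1\<close>.\<close>

definition marker :: "'a \<Rightarrow> 'a" where
  "marker i = code_of M {z. (\<exists>a. a \<lhd> i \<and> z = pair M a \<zero>) \<or> z = pair M i \<one>}"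

lemma one_neq_zero [simp]: "\<one> \<noteq> \<zero>"
  using N.zero_neq_one by auto

lemma delta_marker_set: "delta_pred (\<lambda>e. e 0 \<in> {z. (\<exists>a. a \<lhd> e 1 \<and> z = pair M a \<zero>)
    \<or> z = pair M (e 1) \<one>})"
  unfolding mem_Collect_eq by (intro delta_intros fn_pair fn_intros)

lemma marker_bound:
  "z \<in> {z. (\<exists>a. a \<lhd> i \<and> z = pair M a \<zero>) \<or> z = pair M i \<one>} \<Longrightarrow> z \<lhd> pair M i \<zero> \<oplus> pair M i \<one> \<oplus> \<one>"
  using N.order_trans[OF pair_mono[of _ i \<zero> \<zero>] le_add(1)] N.less_imp_le
  unfolding less_succ_le by auto

lemma fn_marker0: "sigma_fn (\<lambda>e. marker (e 0))"
proof -
  have "sigma_fn (\<lambda>e. pair M (e 0) \<zero> \<oplus> pair M (e 0) \<one> \<oplus> \<one>)"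
    by (intro fn_pair fn_intros)
  from fn_code_of[OF delta_marker_set this marker_bound] show ?thesis unfolding marker_def .
qed

lemmas fn_marker = fn_comp1[OF fn_marker0]

lemma finite_code_marker: "finite_code M (marker i)"
  and elems_marker: "elems M (marker i) = {z. (\<exists>a. a \<lhd> i \<and> z = pair M a \<zero>) \<or> z = pair M i \<one>}"
proof -
  have "delta_pred (\<lambda>e. e 0 \<in> {z. (\<exists>a. a \<lhd> i \<and> z = pair M a \<zero>) \<or> z = pair M i \<one>})"
    unfolding mem_Collect_eq by (intro delta_intros fn_pair fn_intros)
  moreover have "\<forall>z \<in> {z. (\<exists>a. a \<lhd> i \<and> z = pair M a \<zero>) \<or> z = pair M i \<one>}.
      z \<lhd> pair M i \<zero> \<oplus> pair M i \<one> \<oplus> \<one>"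
    using marker_bound by (rule ballI)
  ultimately show "finite_code M (marker i)"
    "elems M (marker i) = {z. (\<exists>a. a \<lhd> i \<and> z = pair M a \<zero>) \<or> z = pair M i \<one>}"
    unfolding marker_def by (fact code_of)+
qed

lemma binary_string_marker: "binary_string M (marker i)"
proof -
  have "has_length (marker i) (i \<oplus> \<one>)"
    unfolding has_length_def elems_marker less_succ by auto
  then have "seq M (marker i)"
    by (intro seqI[OF finite_code_marker]) (auto simp: elems_marker)
  then show ?thesis unfolding binary_string_def by (auto simp: elems_marker)
qed

text \<open>The end of the marker is the position of the first \<open>\<one>\<close> in
  \<open>X\<close>. This is why a single evaluation map suffices at each point.\<close>

lemma marker_unique:
  assumes "X \<in> cantor_space M" "elems M (marker i) \<subseteq> X" "elems M (marker j) \<subseteq> X"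
  shows "i = j"
proof -
  have "\<not> i \<lhd> j" if "elems M (marker i) \<subseteq> X" "elems M (marker j) \<subseteq> X" for i j
  proof
    assume "i \<lhd> j"
    then have "pair M i \<zero> \<in> X" "pair M i \<one> \<in> X" using that unfolding elems_marker by auto
    then have "\<zero> = \<one>" using assms(1) fun_on_unique unfolding cantor_space_def by blast
    then show False by simp
  qed
  then show ?thesis using assms(2,3) N.less_linear by blast
qed

definition marker_clopen :: "'a \<Rightarrow> 'a" where
  "marker_clopen i = code_of M {marker i}"

lemma fn_marker_clopen0: "sigma_fn (\<lambda>e. marker_clopen (e 0))"
  unfolding marker_clopen_def
proof (rule fn_code_of)
  show "delta_pred (\<lambda>e. e 0 \<in> {marker (e 1)})"
    unfolding insert_iff empty_iff by (intro delta_intros delta_const fn_marker fn_intros)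
  show "sigma_fn (\<lambda>e. marker (e 0) \<oplus> \<one>)"
    by (intro fn_marker fn_intros)
qed (simp add: less_succ_le)

lemmas fn_marker_clopen = fn_comp1[OF fn_marker_clopen0]

lemma finite_code_marker_clopen: "finite_code M (marker_clopen i)"
  and elems_marker_clopen: "elems M (marker_clopen i) = {marker i}"
proof -
  have "delta_pred (\<lambda>e. e 0 \<in> {marker i})"
    unfolding insert_iff empty_iff by (intro delta_intros delta_const fn_intros)
  moreover have "\<forall>z \<in> {marker i}. z \<lhd> marker i \<oplus> \<one>" by (simp add: less_succ_le)
  ultimately show "finite_code M (marker_clopen i)" "elems M (marker_clopen i) = {marker i}"
    unfolding marker_clopen_def by (fact code_of)+
qed

lemma in_clopen_marker: "in_clopen M X (marker_clopen i) \<longleftrightarrow> elems M (marker i) \<subseteq> X"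
  by (simp add: in_clopen_def in_open_def elems_marker_clopen)

text \<open>The empty string is by definition the code of the empty finite set, and so also a code
  of the empty clopen set.\<close>

lemma not_in_clopen_empty: "\<not> in_clopen M X (empty_seq M)"
  by (simp add: in_clopen_def in_open_def elems_empty_seq)

lemma label_simps [simp]:
  "union_label M \<noteq> inter_label M" "inter_label M \<noteq> union_label M"
  "leaf_label M a \<noteq> union_label M" "union_label M \<noteq> leaf_label M a"
  "leaf_label M a \<noteq> inter_label M" "inter_label M \<noteq> leaf_label M a"
  "leaf_label M a = leaf_label M b \<longleftrightarrow> a = b"
  by (simp_all add: union_label_def inter_label_def leaf_label_def)

definition relabel :: "'a \<Rightarrow> 'a \<Rightarrow> 'a" where
  "relabel i a = (if a = leaf_label M \<one> then leaf_label M (marker_clopen i)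
     else if a = leaf_label M \<zero> then leaf_label M (empty_seq M) else a)"

lemma fn_relabel0: "sigma_fn (\<lambda>e. relabel (e 0) (e 1))"
  unfolding relabel_def leaf_label_def
  by (intro fn_if delta_intros fn_pair fn_marker_clopen fn_intros)

lemmas fn_relabel = fn_comp2[OF fn_relabel0]

definition index :: "'a \<Rightarrow> 'a \<Rightarrow> bool" where
  "index t i \<longleftrightarrow> pair M \<zero> i \<in> elems M t"

lemma delta_index0: "delta_pred (\<lambda>e. index (e 0) (e 1))"
  unfolding index_def by (intro delta_elems fn_pair fn_intros)

lemmas delta_index = delta_comp2[OF delta_index0]

lemma index_less: "index t i \<Longrightarrow> i \<lhd> t"
  unfolding index_def by (rule pair_elems_less(2))

lemma index_unique: "seq M t \<Longrightarrow> index t i \<Longrightarrow> index t j \<Longrightarrow> i = j"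
  unfolding index_def by (rule seq_unique)

lemma index_nonempty: "index t i \<Longrightarrow> t \<noteq> empty_seq M"
  unfolding index_def by (rule nth_neq_empty)

lemma index_snoc: "index t i \<Longrightarrow> index (snoc M t n) i"
  unfolding index_def elems_snoc by simp

lemma index_singleton: "index (snoc M (empty_seq M) i) i"
proof -
  have "seq_length M (empty_seq M) = \<zero>"
    by (rule has_length_seq_length) (simp add: has_length_def elems_empty_seq not_less_zero)
  then show ?thesis by (simp add: index_def elems_snoc)
qed

text \<open>A nonempty node of \<open>sum_tree T\<close> is a node of the \<open>i\<close>-th tree preceded by its index \<open>i\<close>.\<close>

definition sum_tree :: "'a set \<Rightarrow> 'a set" where
  "sum_tree T = {t. seq M t \<and> (t = empty_seq M \<or>
     (\<exists>i. i \<lhd> t \<and> index t i \<and> seq_tail t \<in> nth_set M T i))}"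

text \<open>All quantifiers are bounded to make the set Delta-0-1. The old label \<open>a\<close>
  can exceed the new label \<open>y\<close> only if it is a leaf label, which explains the two
  summands added to the bound.\<close>

definition sum_labeling :: "'a set \<Rightarrow> 'a set \<Rightarrow> 'a set" where
  "sum_labeling T L = {z. \<exists>t. t \<unlhd> z \<and> (\<exists>y. y \<unlhd> z \<and> z = pair M t y \<and> t \<in> sum_tree T \<and>
     ((t = empty_seq M \<and> y = union_label M) \<or> (\<exists>i. i \<lhd> t \<and> index t i \<and>
        (\<exists>a. a \<unlhd> y \<oplus> leaf_label M \<zero> \<oplus> leaf_label M \<one> \<and>
           pair M (seq_tail t) a \<in> nth_set M L i \<and> y = relabel i a))))}"

lemma sum_tree_index: "seq M t \<Longrightarrow> index t i \<Longrightarrow> t \<in> sum_tree T \<longleftrightarrow> seq_tail t \<in> nth_set M T i"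
  unfolding sum_tree_def using index_unique index_nonempty index_less by blast

lemma sum_tree_cases:
  assumes "t \<in> sum_tree T"
  obtains "t = empty_seq M" | i where "seq M t" "index t i" "t \<noteq> empty_seq M"
      "seq_tail t \<in> nth_set M T i"
  using assms index_nonempty unfolding sum_tree_def by blast

lemma empty_in_sum_tree: "empty_seq M \<in> sum_tree T"
  unfolding sum_tree_def by (simp add: seq_empty_seq)

lemma delta_sum_tree0: "T \<in> Sets M \<Longrightarrow> delta_pred (\<lambda>e. e 0 \<in> sum_tree T)"
  unfolding sum_tree_def nth_set_def mem_Collect_eq
  by (intro delta_intros delta_seq delta_index delta_mem fn_pair fn_seq_tail fn_intros)

lemma snoc_in_sum_tree:
  assumes "seq M t" "index t i"
  shows "snoc M t n \<in> sum_tree T \<longleftrightarrow> snoc M (seq_tail t) n \<in> nth_set M T i"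
  using sum_tree_index[OF seq_snoc[OF assms(1)] index_snoc[OF assms(2)]]
    seq_tail_snoc[OF assms(1) index_nonempty[OF assms(2)]] by simp

lemma singleton_in_sum_tree:
  assumes "wf_tree M (nth_set M T i)"
  shows "snoc M (empty_seq M) i \<in> sum_tree T"
  using sum_tree_index[OF seq_snoc[OF seq_empty_seq] index_singleton] wf_treeD(3)[OF assms]
  by (simp add: seq_tail_singleton)

text \<open>The first value of a path through the sum fixes an index \<open>i\<close>, and the path
  shifted by one position runs through the \<open>i\<close>-th tree.\<close>

lemma wf_sum_tree:
  assumes T: "T \<in> Sets M" "\<And>i. wf_tree M (nth_set M T i)"
  shows "wf_tree M (sum_tree T)"
  unfolding wf_tree_def
proof (intro conjI ballI allI impI notI)
  show "sum_tree T \<in> Sets M"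
    using delta_set[OF delta_sum_tree0[OF T(1)]] by simp
  show "empty_seq M \<in> sum_tree T" by (rule empty_in_sum_tree)
next
  fix s t assume s: "s \<in> sum_tree T" and "seq M t \<and> elems M t \<subseteq> elems M s"
  then have t: "seq M t" "elems M t \<subseteq> elems M s" by auto
  show "t \<in> sum_tree T"
  proof (cases "t = empty_seq M")
    case True
    then show ?thesis by (simp add: empty_in_sum_tree)
  next
    case False
    then obtain i where i: "index t i" using nonempty_seq t(1) unfolding index_def by blast
    then have si: "index s i" using t(2) unfolding index_def by blast
    have "seq M s" using s unfolding sum_tree_def by blast
    then have "seq_tail s \<in> nth_set M T i" using sum_tree_index si s by blast
    moreover have tail: "seq M (seq_tail t)" using seq_seq_tail t(1) False by blast
    moreover have "elems M (seq_tail t) \<subseteq> elems M (seq_tail s)"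
      using t(2) by (intro seq_subset[OF tail]) (auto simp: elems_seq_tail)
    ultimately have "seq_tail t \<in> nth_set M T i" using wf_treeD(4)[OF T(2)] by blast
    then show ?thesis using sum_tree_index[OF t(1) i] by blast
  qed
next
  assume "\<exists>f. fun_on M UNIV UNIV f \<and> (\<forall>t. seq M t \<and> elems M t \<subseteq> f \<longrightarrow> t \<in> sum_tree T)"
  then obtain f where f: "fun_on M UNIV UNIV f"
    "\<And>t. seq M t \<Longrightarrow> elems M t \<subseteq> f \<Longrightarrow> t \<in> sum_tree T" by blast
  define i where "i = app M f \<zero>"
  have i: "pair M \<zero> i \<in> f" unfolding i_def by (rule pair_app[OF f(1) UNIV_I])
  define g where "g = {z. \<exists>a. a \<unlhd> z \<and> (\<exists>b. b \<unlhd> z \<and> z = pair M a b \<and> pair M (a \<oplus> \<one>) b \<in> f)}"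
  have g: "pair M a b \<in> g \<longleftrightarrow> pair M (a \<oplus> \<one>) b \<in> f" for a b
    unfolding g_def by auto
  have "f \<in> Sets M" using f(1) by (simp add: fun_on_def)
  then have "g \<in> Sets M" unfolding g_def
    by (intro delta_set delta_ex_le delta_intros delta_mem fn_pair fn_intros)
  moreover have "\<exists>!b. pair M a b \<in> g" for a
    unfolding g by (rule fun_on_ex1[OF f(1) UNIV_I])
  ultimately have "fun_on M UNIV UNIV g"
    unfolding fun_on_def by (auto simp: g_def)
  moreover have "s \<in> nth_set M T i" if s: "seq M s" "elems M s \<subseteq> g" for s
  proof -
    obtain t where t: "seq M t" "seq_tail t = s" "pair M \<zero> i \<in> elems M t"
      "\<And>z. z \<in> elems M t \<Longrightarrow> z = pair M \<zero> i \<or> (\<exists>a b. z = pair M (a \<oplus> \<one>) b \<and> pair M a b \<in> elems M s)"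
      by (rule ex_seq_cons[OF s(1), where i = i], rule that; blast)
    have "elems M t \<subseteq> f" using t(4) i s(2) g by blast
    then have "t \<in> sum_tree T" using f(2) t(1) by blast
    then show ?thesis using sum_tree_index[of t i T] t by (simp add: index_def)
  qed
  ultimately show False using wf_treeD(5)[OF T(2)] by blast
qed (auto simp: sum_tree_def)

lemma leaf_sum_tree:
  assumes "seq M t" "index t i"
  shows "leaf M (sum_tree T) t \<longleftrightarrow> leaf M (nth_set M T i) (seq_tail t)"
    "interior_node M (sum_tree T) t \<longleftrightarrow> interior_node M (nth_set M T i) (seq_tail t)"
  unfolding leaf_def interior_node_def snoc_in_sum_tree[OF assms] sum_tree_index[OF assms] by auto

lemma interior_root:
  assumes "\<And>i. wf_tree M (nth_set M T i)"
  shows "interior_node M (sum_tree T) (empty_seq M)"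
  using singleton_in_sum_tree[OF assms] empty_in_sum_tree unfolding interior_node_def by blast

context
  fixes T L :: "'a set"
  assumes TL: "T \<in> Sets M" "L \<in> Sets M"
    and formulas: "\<And>i. Lw1w_formula M (nth_set M T i) (nth_set M L i)"
begin

lemma wf_nth: "wf_tree M (nth_set M T i)"
  using formulas[of i] by (simp add: Lw1w_formula_def labeled_tree_def)

lemma fun_on_nth: "fun_on M (nth_set M T i) UNIV (nth_set M L i)"
  using formulas[of i] by (simp add: Lw1w_formula_def labeled_tree_def)

lemma nth_cases:
  assumes "s \<in> nth_set M T i"
  obtains a where "leaf M (nth_set M T i) s" "a = \<zero> \<or> a = \<one>"
      "app M (nth_set M L i) s = leaf_label M a"
  | "interior_node M (nth_set M T i) s" "app M (nth_set M L i) s = union_label M"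
  | "interior_node M (nth_set M T i) s" "app M (nth_set M L i) s = inter_label M"
  by (rule labeled_tree_cases[OF formulas[of i, unfolded Lw1w_formula_def] assms]) auto

lemma sum_labeling_pair:
  "pair M t y \<in> sum_labeling T L \<longleftrightarrow> t \<in> sum_tree T \<and>
     ((t = empty_seq M \<and> y = union_label M) \<or>
      (\<exists>i. index t i \<and> y = relabel i (app M (nth_set M L i) (seq_tail t))))"
proof -
  have bound: "a \<unlhd> relabel i a \<oplus> leaf_label M \<zero> \<oplus> leaf_label M \<one>" for a i
    unfolding relabel_def using N.order_trans[OF le_add(2) le_add(1)] le_add
        N.order_trans[OF le_add(1) le_add(1)] by auto
  have *: "(\<exists>i. i \<lhd> t \<and> index t i \<and>
        (\<exists>a. a \<unlhd> y \<oplus> leaf_label M \<zero> \<oplus> leaf_label M \<one> \<and>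
           pair M (seq_tail t) a \<in> nth_set M L i \<and> y = relabel i a))
     \<longleftrightarrow> (\<exists>i. index t i \<and> y = relabel i (app M (nth_set M L i) (seq_tail t)))" if t: "t \<in> sum_tree T"
  proof
    assume "\<exists>i. index t i \<and> y = relabel i (app M (nth_set M L i) (seq_tail t))"
    then obtain i where i: "index t i" "y = relabel i (app M (nth_set M L i) (seq_tail t))" by blast
    have "seq M t" using t unfolding sum_tree_def by blast
    then have "seq_tail t \<in> nth_set M T i" using sum_tree_index i(1) t by blast
    then have "pair M (seq_tail t) (app M (nth_set M L i) (seq_tail t)) \<in> nth_set M L i"
      by (rule pair_app[OF fun_on_nth])
    then show "\<exists>i. i \<lhd> t \<and> index t i \<and>
        (\<exists>a. a \<unlhd> y \<oplus> leaf_label M \<zero> \<oplus> leaf_label M \<one> \<and>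
           pair M (seq_tail t) a \<in> nth_set M L i \<and> y = relabel i a)"
      using i index_less bound by blast
  qed (use app_eq[OF fun_on_nth] in blast)
  have "pair M t y \<in> sum_labeling T L \<longleftrightarrow> t \<in> sum_tree T \<and>
     ((t = empty_seq M \<and> y = union_label M) \<or> (\<exists>i. i \<lhd> t \<and> index t i \<and>
        (\<exists>a. a \<unlhd> y \<oplus> leaf_label M \<zero> \<oplus> leaf_label M \<one> \<and>
           pair M (seq_tail t) a \<in> nth_set M L i \<and> y = relabel i a)))"
    unfolding sum_labeling_def by auto
  then show ?thesis using * by blast
qed

lemma sum_labeling_in_Sets: "sum_labeling T L \<in> Sets M"
  unfolding sum_labeling_def union_label_def leaf_label_def nth_set_def mem_Collect_eq
  by (intro delta_set delta_ex_le delta_intros delta_mem[OF TL(2)] delta_comp1[OF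
      delta_sum_tree0[OF TL(1)]]
      delta_index fn_relabel fn_pair fn_seq_tail fn_intros)

lemma fun_on_sum_labeling: "fun_on M (sum_tree T) UNIV (sum_labeling T L)"
  unfolding fun_on_def
proof (intro conjI ballI sum_labeling_in_Sets)
  fix z assume "z \<in> sum_labeling T L"
  then show "\<exists>x\<in>sum_tree T. \<exists>y\<in>UNIV. z = pair M x y" unfolding sum_labeling_def by blast
next
  fix t assume t: "t \<in> sum_tree T"
  then show "\<exists>!y. pair M t y \<in> sum_labeling T L"
  proof (cases rule: sum_tree_cases)
    case 1
    with t show ?thesis unfolding sum_labeling_pair using index_nonempty by blast
  next
    case (2 i)
    with t show ?thesis unfolding sum_labeling_pair using index_unique by blast
  qed
qed

lemma label_root: "app M (sum_labeling T L) (empty_seq M) = union_label M"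
  by (rule app_eq[OF fun_on_sum_labeling]) (simp add: sum_labeling_pair empty_in_sum_tree)

lemma label_index:
  "t \<in> sum_tree T \<Longrightarrow> index t i \<Longrightarrow>
    app M (sum_labeling T L) t = relabel i (app M (nth_set M L i) (seq_tail t))"
  by (rule app_eq[OF fun_on_sum_labeling]) (auto simp: sum_labeling_pair)

lemma borel_code_sum: "borel_code M (sum_tree T) (sum_labeling T L)"
  unfolding borel_code_def labeled_tree_def
proof (intro conjI allI impI wf_sum_tree[OF TL(1) wf_nth] fun_on_sum_labeling)
  fix t assume t: "interior_node M (sum_tree T) t"
  then have "t \<in> sum_tree T" by (simp add: interior_node_def)
  then show "app M (sum_labeling T L) t = union_label M
      \<or> app M (sum_labeling T L) t = inter_label M"
  proof (cases rule: sum_tree_cases)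
    case 1
    then show ?thesis by (simp add: label_root)
  next
    case (2 i)
    then have "interior_node M (nth_set M T i) (seq_tail t)" using t leaf_sum_tree(2) by blast
    with 2(4) have "app M (nth_set M L i) (seq_tail t) = union_label M
        \<or> app M (nth_set M L i) (seq_tail t) = inter_label M"
      by (cases rule: nth_cases) (auto simp: leaf_def interior_node_def)
    then show ?thesis using label_index[OF \<open>t \<in> sum_tree T\<close> 2(2)] by (auto simp: relabel_def)
  qed
next
  fix t assume t: "leaf M (sum_tree T) t"
  then have "t \<in> sum_tree T" by (simp add: leaf_def)
  then show "\<exists>c\<in>{c. clopen_code M c}. app M (sum_labeling T L) t = leaf_label M c"
  proof (cases rule: sum_tree_cases)
    case 1
    then show ?thesis using t interior_root[OF wf_nth] by (auto simp: leaf_def interior_node_def)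
  next
    case (2 i)
    then have "leaf M (nth_set M T i) (seq_tail t)" using t leaf_sum_tree(1) by blast
    with 2(4) obtain a where "a = \<zero> \<or> a = \<one>" "app M (nth_set M L i) (seq_tail t) = leaf_label M a"
      by (cases rule: nth_cases) (auto simp: leaf_def interior_node_def)
    moreover have "clopen_code M (marker_clopen i)" "clopen_code M (empty_seq M)"
      by (simp_all add: clopen_code_def finite_code_marker_clopen elems_marker_clopen binary_string_marker
          elems_empty_seq seq_finite_code[OF seq_empty_seq])
    ultimately show ?thesis using label_index[OF \<open>t \<in> sum_tree T\<close> 2(2)] by (auto simp: relabel_def)
  qed
qed

lemma characteristic_function:
  assumes A: "delta_pred (\<lambda>e. e 0 \<in> A)" and W: "delta_pred (\<lambda>e. W (e 0))"
  shows "\<exists>f. fun_on M A {\<zero>, \<one>} f \<and> (\<forall>t \<in> A. app M f t = \<one> \<longleftrightarrow> W t)"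
proof -
  define f where "f = {z. \<exists>t. t \<unlhd> z \<and> (\<exists>v. v \<unlhd> z \<and> z = pair M t v \<and> t \<in> A \<and> (v = \<one> \<and> W t \<or> v = \<zero>
      \<and> \<not> W t))}"
  have f_pair: "pair M t v \<in> f \<longleftrightarrow> t \<in> A \<and> (v = \<one> \<and> W t \<or> v = \<zero> \<and> \<not> W t)" for t v
    unfolding f_def by auto
  have "f \<in> Sets M" unfolding f_def
    by (intro delta_set delta_ex_le delta_intros delta_comp1[OF A] delta_comp1[OF W] fn_pair
        fn_intros)
  then have f: "fun_on M A {\<zero>, \<one>} f"
    unfolding fun_on_def by (auto simp: f_pair) (auto simp: f_def)
  moreover have "app M f t = \<one> \<longleftrightarrow> W t" if "t \<in> A" for t
    using app_eq_one[OF f that] that by (simp add: f_pair)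
  ultimately show ?thesis by blast
qed

text \<open>\<open>b\<close> tells whether \<open>X\<close> extends a marker at all, and
  \<open>k\<close> which one. The map copies \<open>f\<close> on the \<open>k\<close>-th summand and
  is zero on the others; if \<open>b\<close> is false it is zero everywhere and \<open>k\<close>,
  \<open>f\<close> are fillers. The root inherits the value of the root of the \<open>k\<close>-th
  formula.\<close>

lemma sum_evaluation:
  assumes X: "\<And>i. elems M (marker i) \<subseteq> X \<longleftrightarrow> b \<and> i = k"
    and f: "formula_evaluation M (nth_set M T k) (nth_set M L k) f"
  obtains g where "borel_evaluation M X (sum_tree T) (sum_labeling T L) g"
    "app M g (empty_seq M) = \<one> \<longleftrightarrow> b \<and> app M f (empty_seq M) = \<one>"
proof -
  note f = f[unfolded formula_evaluation_def]
  note fun_f = evaluation_mapD(1)[OF f]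
  \<comment> \<open>The empty string is the root both of the sum and of the \<open>k\<close>-th
    tree, so \<open>f\<close> can be consulted at the same string.\<close>
  define W where "W t \<longleftrightarrow> b \<and> ((t = empty_seq M \<and> pair M t \<one> \<in> f) \<or>
    (index t k \<and> pair M (seq_tail t) \<one> \<in> f))" for t
  have "f \<in> Sets M" using fun_f by (simp add: fun_on_def)
  then have "delta_pred (\<lambda>e. W (e 0))" unfolding W_def
    by (intro delta_intros delta_const delta_mem delta_index fn_pair fn_seq_tail fn_intros)
  from characteristic_function[OF delta_sum_tree0[OF TL(1)] this]
  obtain g where g: "fun_on M (sum_tree T) {\<zero>, \<one>} g"
    "\<And>t. t \<in> sum_tree T \<Longrightarrow> app M g t = \<one> \<longleftrightarrow> W t"
    by blast
  have W_root: "W (empty_seq M) \<longleftrightarrow> b \<and> app M f (empty_seq M) = \<one>"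
    unfolding W_def using index_nonempty app_eq_one[OF fun_f wf_treeD(3)[OF wf_nth]] by blast
  have W_index: "W t \<longleftrightarrow> b \<and> i = k \<and> app M f (seq_tail t) = \<one>"
    if "t \<in> sum_tree T" "seq M t" "index t i" for t i
  proof (cases "i = k")
    case True
    then have "seq_tail t \<in> nth_set M T k" using sum_tree_index that by blast
    then show ?thesis
      using that index_nonempty[OF that(3)] True app_eq_one[OF fun_f] unfolding W_def by auto
  next
    case False
    then show ?thesis using that index_nonempty[OF that(3)] index_unique[of t i k]
        unfolding W_def by auto
  qed
  have g_snoc: "app M g (snoc M t n) = \<one> \<longleftrightarrow> b \<and> i = k \<and> app M f (snoc M (seq_tail t) n) = \<one>"
    if "seq M t" "index t i" "snoc M (seq_tail t) n \<in> nth_set M T i" for t i n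
  proof -
    have "snoc M t n \<in> sum_tree T" using that snoc_in_sum_tree by blast
    with g(2)[OF this] W_index[OF this seq_snoc[OF that(1)] index_snoc[OF that(2)]] show ?thesis
      by (simp add: seq_tail_snoc[OF that(1) index_nonempty[OF that(2)]])
  qed
  have "borel_evaluation M X (sum_tree T) (sum_labeling T L) g"
    unfolding borel_evaluation_def evaluation_map_def
  proof (intro conjI g(1) allI impI; elim conjE)
    fix t c
    assume t: "leaf M (sum_tree T) t" and c: "app M (sum_labeling T L) t = leaf_label M c"
    then have tT: "t \<in> sum_tree T" by (simp add: leaf_def)
    then show "app M g t = \<one> \<longleftrightarrow> in_clopen M X c"
    proof (cases rule: sum_tree_cases)
      case 1
      then show ?thesis using c by (simp add: label_root)
    next
      case (2 i)
      then have leaf: "leaf M (nth_set M T i) (seq_tail t)" using t leaf_sum_tree(1) by blast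
      with 2(4) obtain a where a: "a = \<zero> \<or> a = \<one>"
          "app M (nth_set M L i) (seq_tail t) = leaf_label M a"
        by (cases rule: nth_cases) (auto simp: leaf_def interior_node_def)
      have "i = k \<Longrightarrow> app M f (seq_tail t) = \<one> \<longleftrightarrow> a = \<one>"
        using evaluation_mapD(2)[OF f] leaf a(2) by blast
      moreover have "in_clopen M X c \<longleftrightarrow> a = \<one> \<and> b \<and> i = k"
        using a c label_index[OF tT 2(2)] X[of i, folded in_clopen_marker] not_in_clopen_empty[of X]
        by (auto simp: relabel_def)
      ultimately show ?thesis using g(2)[OF tT] W_index[OF tT 2(1,2)] by blast
    qed
  next
    fix t
    assume t: "interior_node M (sum_tree T) t" and c: "app M (sum_labeling T L) t = union_label M"
    then have tT: "t \<in> sum_tree T" by (simp add: interior_node_def)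
    then show "app M g t = \<one> \<longleftrightarrow> (\<exists>n. snoc M t n \<in> sum_tree T \<and> app M g (snoc M t n) = \<one>)"
    proof (cases rule: sum_tree_cases)
      case 1
      \<comment> \<open>The children of the root are the roots of the summands; only the
        \<open>k\<close>-th can have value one, so the disjunction at the root has its
        value.\<close>
      have "W (snoc M (empty_seq M) n) \<longleftrightarrow> b \<and> n = k \<and> app M f (empty_seq M) = \<one>" for n
        using W_index[OF singleton_in_sum_tree[OF wf_nth] seq_snoc[OF seq_empty_seq] index_singleton]
        by (simp add: seq_tail_singleton)
      then show ?thesis using g(2) W_root singleton_in_sum_tree[OF wf_nth] tT unfolding 1 by auto
    next
      case (2 i)
      then have "interior_node M (nth_set M T i) (seq_tail t)" using t leaf_sum_tree(2) by blast
      moreover have "app M (nth_set M L i) (seq_tail t) = union_label M"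
        using c label_index[OF tT 2(2)] by (auto simp: relabel_def split: if_splits)
      ultimately have "i = k \<Longrightarrow> app M f (seq_tail t) = \<one> \<longleftrightarrow>
          (\<exists>n. snoc M (seq_tail t) n \<in> nth_set M T i \<and> app M f (snoc M (seq_tail t) n) = \<one>)"
        using evaluation_mapD(3)[OF f] by blast
      then show ?thesis
        using g(2)[OF tT] W_index[OF tT 2(1,2)] g_snoc[OF 2(1,2)]
        unfolding snoc_in_sum_tree[OF 2(1,2)] by blast
    qed
  next
    fix t
    assume t: "interior_node M (sum_tree T) t" and c: "app M (sum_labeling T L) t = inter_label M"
    then have tT: "t \<in> sum_tree T" by (simp add: interior_node_def)
    then show "app M g t = \<one> \<longleftrightarrow> (\<forall>n. snoc M t n \<in> sum_tree T \<longrightarrow> app M g (snoc M t n) = \<one>)"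
    proof (cases rule: sum_tree_cases)
      case 1
      then show ?thesis using c by (simp add: label_root)
    next
      case (2 i)
      then have int: "interior_node M (nth_set M T i) (seq_tail t)" using t leaf_sum_tree(2)
          by blast
      moreover have "app M (nth_set M L i) (seq_tail t) = inter_label M"
        using c label_index[OF tT 2(2)] by (auto simp: relabel_def split: if_splits)
      ultimately have "i = k \<Longrightarrow> app M f (seq_tail t) = \<one> \<longleftrightarrow>
          (\<forall>n. snoc M (seq_tail t) n \<in> nth_set M T i \<longrightarrow> app M f (snoc M (seq_tail t) n) = \<one>)"
        using evaluation_mapD(4)[OF f] by blast
      \<comment> \<open>Where the map is constantly zero, a conjunction is correctly zero only
        because it has some child.\<close>
      moreover have "\<exists>n. snoc M (seq_tail t) n \<in> nth_set M T i"
        using int by (simp add: interior_node_def)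
      ultimately show ?thesis
        using g(2)[OF tT] W_index[OF tT 2(1,2)] g_snoc[OF 2(1,2)]
        unfolding snoc_in_sum_tree[OF 2(1,2)] by blast
    qed
  qed
  moreover have "app M g (empty_seq M) = \<one> \<longleftrightarrow> b \<and> app M f (empty_seq M) = \<one>"
    using g(2)[OF empty_in_sum_tree] W_root by blast
  ultimately show thesis by (rule that)
qed

end

section \<open>Reading truth off the Baire approximation\<close>

definition compatible :: "'a \<Rightarrow> 'a \<Rightarrow> bool" where
  "compatible p q \<longleftrightarrow> (\<forall>i. i \<lhd> p \<longrightarrow> (\<forall>a. a \<lhd> p \<longrightarrow> pair M i a \<in> elems M p \<longrightarrow>
     (\<forall>b. b \<lhd> q \<longrightarrow> pair M i b \<in> elems M q \<longrightarrow> a = b)))"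

lemma delta_compatible0: "delta_pred (\<lambda>e. compatible (e 0) (e 1))"
  unfolding compatible_def by (intro delta_intros delta_elems fn_pair fn_intros)

lemma compatible_iff: "compatible p q \<longleftrightarrow>
    (\<forall>i a b. pair M i a \<in> elems M p \<longrightarrow> pair M i b \<in> elems M q \<longrightarrow> a = b)"
  unfolding compatible_def using pair_elems_less by blast

text \<open>Compatible strings are comparable, so the longer one extends both; a point in all
  \<open>D_n\<close> is then found above it. Only on such points does the approximation say
  anything.\<close>

lemma compatible_generic:
  assumes D: "baire_code M U V D" and p: "binary_string M p" and q: "binary_string M q"
    and "compatible p q"
  obtains X where "X \<in> cantor_space M" "elems M p \<subseteq> X" "elems M q \<subseteq> X"
      "\<And>n. in_open M X (nth_set M D n)"
proof -
  have "elems M p \<subseteq> elems M q \<or> elems M q \<subseteq> elems M p"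
    using assms(4) p q unfolding binary_string_def compatible_iff by (intro seqs_comparable) blast+
  then obtain r where r: "binary_string M r" "elems M p \<subseteq> elems M r" "elems M q \<subseteq> elems M r"
    using p q by blast
  have "\<exists>X\<in>cantor_space M. elems M r \<subseteq> X \<and> (\<forall>n. in_open M X (nth_set M D n))"
    using D unfolding baire_code_def by (intro baire_category r(1)) blast+
  then show thesis using that r(2,3) by blast
qed

text \<open>The conjunct \<open>True\<close> is the value of \<open>b\<close> for which this is the
  premise of \<open>sum_evaluation\<close>.\<close>

lemma marker_iff:
  assumes "X \<in> cantor_space M" "elems M (marker k) \<subseteq> X"
  shows "elems M (marker i) \<subseteq> X \<longleftrightarrow> True \<and> i = k"
  using marker_unique assms by blast

theorem CD_PB_imp_Lw1w_CA:
  assumes "CD_PB M"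
  shows "Lw1w_CA M"
  unfolding Lw1w_CA_def
proof (intro ballI impI)
  fix T L
  assume TL: "T \<in> Sets M" "L \<in> Sets M"
    and cd: "\<forall>i. completely_determined_formula M (nth_set M T i) (nth_set M L i)"
  then have fm: "Lw1w_formula M (nth_set M T i) (nth_set M L i)" for i
    by (simp add: completely_determined_formula_def)
  let ?T = "sum_tree T" and ?L = "sum_labeling T L"
  have code: "borel_code M ?T ?L" by (rule borel_code_sum[OF TL fm])
  have "\<exists>g. borel_evaluation M X ?T ?L g" if X: "X \<in> cantor_space M" for X
  proof -
    \<comment> \<open>If \<open>X\<close> extends no marker, then \<open>b\<close> is false and
      \<open>k\<close> arbitrary; formula \<open>k\<close> is determined in any case and provides
      some \<open>f\<close>.\<close>
    obtain b k where "\<And>i. elems M (marker i) \<subseteq> X \<longleftrightarrow> b \<and> i = k"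
      using marker_unique[OF X] by metis
    moreover obtain f where "formula_evaluation M (nth_set M T k) (nth_set M L k) f"
      using cd unfolding completely_determined_formula_def by blast
    ultimately show ?thesis using sum_evaluation[OF TL fm] by metis
  qed
  with code have "completely_determined_borel_code M ?T ?L"
    by (simp add: completely_determined_borel_code_def)
  then obtain U V D where "baire_approximation M U V D ?T ?L"
    using assms unfolding CD_PB_def by blast
  then have D: "baire_code M U V D"
    and approx: "\<And>X. X \<in> cantor_space M \<Longrightarrow> (\<And>n. in_open M X (nth_set M D n)) \<Longrightarrow>
      (in_open M X U \<longrightarrow> in_borel M X ?T ?L) \<and> (in_open M X V \<longrightarrow> in_borel_complement M X ?T ?L)"
    unfolding baire_approximation_def by blast+
  have UV: "U \<in> Sets M" "V \<in> Sets M" "\<And>p. p \<in> U \<union> V \<Longrightarrow> binary_string M p" "dense_open M (U \<union> V)"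
    using D unfolding baire_code_def open_code_def by blast+
  let ?true = "\<lambda>i. formula_true M (nth_set M T i) (nth_set M L i)"
  \<comment> \<open>Truth asks for some map with value one at the root. By uniqueness any given map
    decides it.\<close>
  have true_iff: "?true i \<longleftrightarrow> app M f (empty_seq M) = \<one>"
    if f: "formula_evaluation M (nth_set M T i) (nth_set M L i) f" for f i
  proof -
    have lt: "labeled_tree M {\<zero>, \<one>} (nth_set M T i) (nth_set M L i)"
      using fm[of i] by (simp add: Lw1w_formula_def)
    then have "empty_seq M \<in> nth_set M T i" by (simp add: labeled_tree_def wf_treeD(3))
    from evaluation_map_unique[OF lt _ _ this] show ?thesis
      using f unfolding formula_true_def formula_evaluation_def by blast
  qed
  have root: "empty_seq M \<in> ?T" by (rule empty_in_sum_tree)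
  have lt: "labeled_tree M {c. clopen_code M c} ?T ?L"
    using code by (simp add: borel_code_def)
  \<comment> \<open>At a generic point above both strings there are two evaluation maps:
    \<open>g\<close>, built from the formula, and \<open>g'\<close>, given by the approximation.
    They agree at the root.\<close>
  have U: "?true i" if q: "q \<in> U" "compatible q (marker i)" for q i
  proof -
    obtain X where X: "X \<in> cantor_space M" "elems M q \<subseteq> X" "elems M (marker i) \<subseteq> X"
      "\<And>n. in_open M X (nth_set M D n)"
      by (rule compatible_generic[OF D _ binary_string_marker q(2)]) (use UV(3) q(1) in auto)
    obtain f where f: "formula_evaluation M (nth_set M T i) (nth_set M L i) f"
      using cd unfolding completely_determined_formula_def by blast
    obtain g where g: "borel_evaluation M X ?T ?L g"
      "app M g (empty_seq M) = \<one> \<longleftrightarrow> True \<and> app M f (empty_seq M) = \<one>"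
      by (rule sum_evaluation[OF TL fm marker_iff[OF X(1,3)] f])
    have "in_open M X U" using q(1) X(2) unfolding in_open_def by blast
    then obtain g' where "borel_evaluation M X ?T ?L g'" "app M g' (empty_seq M) = \<one>"
      using approx[OF X(1,4)] unfolding in_borel_def by blast
    then have "app M f (empty_seq M) = \<one>"
      using evaluation_map_unique[OF lt _ _ root] g unfolding borel_evaluation_def by blast
    then show ?thesis using true_iff[OF f] by blast
  qed
  have V: "\<not> ?true i" if q: "q \<in> V" "compatible q (marker i)" for q i
  proof -
    obtain X where X: "X \<in> cantor_space M" "elems M q \<subseteq> X" "elems M (marker i) \<subseteq> X"
      "\<And>n. in_open M X (nth_set M D n)"
      by (rule compatible_generic[OF D _ binary_string_marker q(2)]) (use UV(3) q(1) in auto)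
    obtain f where f: "formula_evaluation M (nth_set M T i) (nth_set M L i) f"
      using cd unfolding completely_determined_formula_def by blast
    obtain g where g: "borel_evaluation M X ?T ?L g"
      "app M g (empty_seq M) = \<one> \<longleftrightarrow> True \<and> app M f (empty_seq M) = \<one>"
      by (rule sum_evaluation[OF TL fm marker_iff[OF X(1,3)] f])
    have "in_open M X V" using q(1) X(2) unfolding in_open_def by blast
    then obtain L' g' where "complement_labeling M ?T ?L L'"
      "borel_evaluation M X ?T L' g'" "app M g' (empty_seq M) = \<one>"
      using approx[OF X(1,4)] unfolding in_borel_complement_def in_borel_def by blast
    then have "app M f (empty_seq M) \<noteq> \<one>"
      using complement_evaluation[OF code _ X(1) g(1) _ root] g(2) by blast
    then show ?thesis using true_iff[OF f] by blast
  qed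
  \<comment> \<open>Density is applied to the cone of the marker. The resulting point extends
    \<open>q\<close> and the marker, which forces them to agree at common positions.\<close>
  have dense: "\<exists>q \<in> U \<union> V. compatible q (marker i)" for i
  proof -
    obtain X q where X: "X \<in> cantor_space M" "elems M (marker i) \<subseteq> X" "q \<in> U \<union> V" "elems M q \<subseteq> X"
      using UV(4) binary_string_marker unfolding dense_open_def in_open_def by blast
    have "compatible q (marker i)"
      unfolding compatible_iff using X(1,2,4) fun_on_unique unfolding cantor_space_def by blast
    then show ?thesis using X(3) by blast
  qed
  have sigma: "sigma_pred (\<lambda>e. \<exists>q. q \<in> A \<and> compatible q (marker (e 0)))" if "A \<in> Sets M" for A
    by (intro sigma_intros delta_sigma[OF delta_mem[OF that]]
        delta_sigma[OF delta_comp2[OF delta_compatible0]] fn_marker fn_intros)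
  \<comment> \<open>\<open>U\<close> and \<open>V\<close> give one direction each;
    \<open>dense\<close> says that some string always applies, which yields the converses.\<close>
  have iff: "?true i \<longleftrightarrow> (\<exists>q. q \<in> U \<and> compatible q (marker i))"
    "\<not> ?true i \<longleftrightarrow> (\<exists>q. q \<in> V \<and> compatible q (marker i))" for i
    using U V dense[of i] by blast+
  show "{i. ?true i} \<in> Sets M"
    by (rule delta_comprehension) (unfold iff, rule sigma[OF UV(1)], unfold iff(1)[symmetric] iff(2), rule sigma[OF UV(2)])
qed

end

theorem proposition3p6:
  fixes M :: "'a l2_structure"
  assumes "RCA0_model M"
    and "CD_PB M"
  shows "Lw1w_CA M"
proof -
  interpret rca0 M using assms(1) by (rule rca0.intro)
  show ?thesis using assms(2) by (rule CD_PB_imp_Lw1w_CA)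
qed

end
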